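(* Suppose that the Lagrangian can be written as $L(x,u)=L_1(x)+L_2(x,u)$ for all $(x,u)\in\mathbb R^{n+k}$, with $u\mapsto L_2(x,u)$ positively homogeneous of degree $1$ for every $x\in\mathbb R^n$. Then the problem of minimizing $\int_0^1L(x(t),u(t))\,dt$ subject to $\dot x=f(x)+G(x)u$, $x(0)=x^0$, $x(1)=x^1$ has no $L_1^k[0,1]$-$\mathcal F_{k,1}^0$ Lavrentiev gap.
   Context: The vector fields $f,g_1,\dots,g_k$ on $\mathbb R^n$ are locally Lipschitz, $G=(g_1,\dots,g_k)$, $x^0,x^1\in\mathbb R^n$. $L:\mathbb R^{n+k}\to\mathbb R$ is continuous, and convex in $u$. On $\mathbb R^n\times[0,+\infty[\times\mathbb R^k$: $\lambda(y,v,w)=L(y,\frac wv)v$ for $v>0$, $\lambda(y,0,w)=\lim_{\eta\to0^+}L(y,\frac w\eta)\eta\in\,]-\infty,+\infty]$. Generalized controls: let $\mathcal T$ be the set of increasing locally absolutely continuous bijections of $[0,+\infty[$ with locally absolutely continuous inverse; locally absolutely continuous functions $g_1,g_2$ on $[0,+\infty[$ are equivalent if $\inf_{\alpha\in\mathcal T}\|g_1-g_2\circ\alpha\|_{L_\infty[0,+\infty[}=0$. $\mathcal F_{k,1}^0$ is the set of equivalence classes $[(V,W)]$ of locally absolutely continuous $(V,W):[0,+\infty[\to\mathbb R^{1+k}$ with $V(0)=0$, $W(0)=0$, $\dot V\ge0$ a.e., infinite total length, and $V(\infty)>1$. Put $(v,w)=(\dot V,\dot W)$, $V^{\#}(1)=\sup\{s\ge0:V(s)\le1\}$,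 let $y_{(v,w)}$ be the maximal solution of $\dot y=f(y)v+G(y)w$, $y(0)=x^0$, and, when it is defined on $[0,V^{\#}(1)]$, put $I([(V,W)])=\int_0^{V^{\#}(1)}\lambda(y_{(v,w)},v,w)\,d\tau$ (independent of the representative). For $u\in L_1^k[0,1]$, $U(t)=\int_0^tu\,ds$ and $x_u$ is the trajectory of $\dot x=f(x)+G(x)u$, $x(0)=x^0$; then $I([(t,U)])=\int_0^1L(x_u,u)\,dt$. Lavrentiev gap: the problem (the functional $I$) exhibits an $L_1^k[0,1]$-$\mathcal F_{k,1}^0$ Lavrentiev gap if $$\lim_{\varepsilon\to0^+}\ \inf_{u\in L_1^k[0,1],\ |x_u(1)-x^1|\le\varepsilon}I([(t,U)])\ >\ \inf_{[(V,W)]\in\mathcal F_{k,1}^0,\ y_{(v,w)}(V^{\#}(1))=x^1}I([(V,W)]),$$ where only controls whose trajectories are defined up to the final time are considered, and $\inf\emptyset=+\infty$. *)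

theory Defs
  imports "HOL-Analysis.Analysis" "HOL-Probability.Essential_Supremum"
begin

subsection \<open>Locally Lipschitz and absolutely continuous functions\<close>

definition locally_lipschitz :: "('a::metric_space \<Rightarrow> 'b::metric_space) \<Rightarrow> bool" where
  "locally_lipschitz h \<longleftrightarrow> (\<forall>x. \<exists>r>0. \<exists>C. C-lipschitz_on (ball x r) h)"

text \<open>In the next definition \<open>d\<close> ranges over the finite families of non-overlapping compact
  intervals contained in \<open>J\<close>; \<open>Inf k\<close> and \<open>Sup k\<close> are the endpoints of \<open>k\<close>.\<close>

definition abs_cont_on :: "real set \<Rightarrow> (real \<Rightarrow> 'a::real_normed_vector) \<Rightarrow> bool" where
  "abs_cont_on J h \<longleftrightarrow>
     (\<forall>\<epsilon>>0. \<exists>\<delta>>0. \<forall>d S. d division_of S \<and> S \<subseteq> J \<and> (\<Sum>k\<in>d. Sup k - Inf k) < \<delta> \<longrightarrow>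
        (\<Sum>k\<in>d. norm (h (Sup k) - h (Inf k))) < \<epsilon>)"

definition locally_abs_cont_on :: "real set \<Rightarrow> (real \<Rightarrow> 'a::real_normed_vector) \<Rightarrow> bool" where
  "locally_abs_cont_on J h \<longleftrightarrow> (\<forall>a b. {a..b} \<subseteq> J \<longrightarrow> abs_cont_on {a..b} h)"

subsection \<open>Lebesgue integral with values in the extended reals\<close>

text \<open>Positive part minus negative part (\<open>e2ennreal\<close> sends negative numbers to \<open>0\<close>). The
  convention \<open>\<infinity> - \<infinity> = \<infinity>\<close> of \<open>ereal\<close> plays no role for the cost functionals below: along a
  trajectory, convexity bounds the integrand from below by an integrable function.\<close>

definition ext_integral :: "'a measure \<Rightarrow> ('a \<Rightarrow> ereal) \<Rightarrow> ereal" where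
  "ext_integral M h =
     enn2ereal (\<integral>\<^sup>+ t. e2ennreal (h t) \<partial>M) - enn2ereal (\<integral>\<^sup>+ t. e2ennreal (- h t) \<partial>M)"

subsection \<open>Trajectories\<close>

definition control_system ::
  "(real^'n \<Rightarrow> real^'n) \<Rightarrow> ('k::finite \<Rightarrow> real^'n \<Rightarrow> real^'n) \<Rightarrow> real^'n \<Rightarrow> real \<Rightarrow> real^'k \<Rightarrow> real^'n" where
  "control_system f g y v w = v *\<^sub>R f y + (\<Sum>i\<in>UNIV. (w $ i) *\<^sub>R g i y)"

definition solves_on ::
  "(real^'n \<Rightarrow> real^'n) \<Rightarrow> ('k::finite \<Rightarrow> real^'n \<Rightarrow> real^'n) \<Rightarrow> real^'n \<Rightarrow>
   (real \<Rightarrow> real) \<Rightarrow> (real \<Rightarrow> real^'k) \<Rightarrow> real \<Rightarrow> (real \<Rightarrow> real^'n) \<Rightarrow> bool" where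
  "solves_on f g x0 v w T y \<longleftrightarrow>
     abs_cont_on {0..T} y \<and> y 0 = x0 \<and>
     (AE t in lebesgue_on {0..T}.
        (y has_vector_derivative control_system f g (y t) (v t) (w t)) (at t within {0..T}))"

definition traj_defined ::
  "(real^'n \<Rightarrow> real^'n) \<Rightarrow> ('k::finite \<Rightarrow> real^'n \<Rightarrow> real^'n) \<Rightarrow> real^'n \<Rightarrow>
   (real \<Rightarrow> real) \<Rightarrow> (real \<Rightarrow> real^'k) \<Rightarrow> real \<Rightarrow> bool" where
  "traj_defined f g x0 v w T \<longleftrightarrow> (\<exists>y. solves_on f g x0 v w T y)"

text \<open>The maximal solution is the union of all solutions on compact intervals \<open>[0, T]\<close>. For locally
  Lipschitz vector fields and locally integrable controls any two of these agree on the smaller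
  interval.\<close>

definition traj ::
  "(real^'n \<Rightarrow> real^'n) \<Rightarrow> ('k::finite \<Rightarrow> real^'n \<Rightarrow> real^'n) \<Rightarrow> real^'n \<Rightarrow>
   (real \<Rightarrow> real) \<Rightarrow> (real \<Rightarrow> real^'k) \<Rightarrow> real \<Rightarrow> real^'n" where
  "traj f g x0 v w t = (THE p. \<exists>y. solves_on f g x0 v w t y \<and> y t = p)"

subsection \<open>The extended Lagrangian\<close>

text \<open>Only \<open>v \<ge> 0\<close> is meaningful.\<close>

definition ext_lagrangian ::
  "(real^'n \<Rightarrow> real^'k \<Rightarrow> real) \<Rightarrow> real^'n \<Rightarrow> real \<Rightarrow> real^'k \<Rightarrow> ereal" where
  "ext_lagrangian L y v w =
     (if v > 0 then ereal (L y (w /\<^sub>R v) * v)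
      else Lim (at_right 0) (\<lambda>\<eta>. ereal (L y (w /\<^sub>R \<eta>) * \<eta>)))"

subsection \<open>Generalized controls\<close>

text \<open>A pair \<open>(V, W)\<close> is one function \<open>P\<close> into the product space, whose norm is Euclidean.
  Functions on \<open>[0, \<infinity>)\<close> are functions on \<open>real\<close> whose values at negative arguments are
  ignored.\<close>

definition time_changes :: "(real \<Rightarrow> real) set" where
  "time_changes = {\<alpha>. mono_on {0..} \<alpha> \<and> bij_betw \<alpha> {0..} {0..} \<and>
     locally_abs_cont_on {0..} \<alpha> \<and> locally_abs_cont_on {0..} (the_inv_into {0..} \<alpha>)}"

definition equiv_paths :: "(real \<Rightarrow> 'a::real_normed_vector) \<Rightarrow> (real \<Rightarrow> 'a) \<Rightarrow> bool" where
  "equiv_paths h1 h2 \<longleftrightarrow>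
     (INF \<alpha>\<in>time_changes. esssup (lebesgue_on {0..}) (\<lambda>s. ereal (norm (h1 s - h2 (\<alpha> s))))) = 0"

definition vdot :: "(real \<Rightarrow> real \<times> (real^'k)) \<Rightarrow> real \<Rightarrow> real" where
  "vdot P t = fst (vector_derivative P (at t))"

definition wdot :: "(real \<Rightarrow> real \<times> (real^'k)) \<Rightarrow> real \<Rightarrow> real^'k" where
  "wdot P t = snd (vector_derivative P (at t))"

definition control_paths :: "(real \<Rightarrow> real \<times> (real^'k)) set" where
  "control_paths = {P. locally_abs_cont_on {0..} P \<and> P 0 = 0 \<and>
     (AE t in lebesgue_on {0..}. vdot P t \<ge> 0) \<and>
     (\<integral>\<^sup>+ t. ennreal (norm (vector_derivative P (at t))) \<partial>lebesgue_on {0..}) = \<infinity> \<and>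
     Lim at_top (\<lambda>t. ereal (fst (P t))) > 1}"

text \<open>The class \<open>\<F>\<^sup>0\<^bsub>k,1\<^esub>\<close>. All conditions in \<open>control_paths\<close> are invariant under
  \<open>equiv_paths\<close>.\<close>

definition generalized_controls :: "(real \<Rightarrow> real \<times> (real^'k)) set set" where
  "generalized_controls =
     control_paths // {(P, Q). P \<in> control_paths \<and> Q \<in> control_paths \<and> equiv_paths P Q}"

definition representative :: "'a set \<Rightarrow> 'a" where
  "representative C = (SOME P. P \<in> C)"

definition final_param :: "(real \<Rightarrow> real \<times> (real^'k)) \<Rightarrow> real" where
  "final_param P = Sup {s. 0 \<le> s \<and> fst (P s) \<le> 1}"

text \<open>Neither the terminal constraint nor the cost depends on the chosen representative.\<close>

definition reaches_target ::
  "(real^'n \<Rightarrow> real^'n) \<Rightarrow> ('k::finite \<Rightarrow> real^'n \<Rightarrow> real^'n) \<Rightarrow> real^'n \<Rightarrow> real^'n \<Rightarrow>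
   (real \<Rightarrow> real \<times> (real^'k)) set \<Rightarrow> bool" where
  "reaches_target f g x0 x1 C \<longleftrightarrow>
     (let P = representative C in
        traj_defined f g x0 (vdot P) (wdot P) (final_param P) \<and>
        traj f g x0 (vdot P) (wdot P) (final_param P) = x1)"

definition generalized_cost ::
  "(real^'n \<Rightarrow> real^'n) \<Rightarrow> ('k::finite \<Rightarrow> real^'n \<Rightarrow> real^'n) \<Rightarrow> (real^'n \<Rightarrow> real^'k \<Rightarrow> real) \<Rightarrow> real^'n \<Rightarrow>
   (real \<Rightarrow> real \<times> (real^'k)) set \<Rightarrow> ereal" where
  "generalized_cost f g L x0 C =
     (let P = representative C in
        ext_integral (lebesgue_on {0..final_param P})
          (\<lambda>t. ext_lagrangian L (traj f g x0 (vdot P) (wdot P) t) (vdot P t) (wdot P t)))"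

subsection \<open>Ordinary controls and the Lavrentiev gap\<close>

text \<open>An ordinary control \<open>u\<close> corresponds to \<open>V(t) = t\<close>, that is, \<open>v = 1\<close> and \<open>w = u\<close>.\<close>

definition ordinary_cost ::
  "(real^'n \<Rightarrow> real^'n) \<Rightarrow> ('k::finite \<Rightarrow> real^'n \<Rightarrow> real^'n) \<Rightarrow> (real^'n \<Rightarrow> real^'k \<Rightarrow> real) \<Rightarrow> real^'n \<Rightarrow>
   (real \<Rightarrow> real^'k) \<Rightarrow> ereal" where
  "ordinary_cost f g L x0 u =
     ext_integral (lebesgue_on {0..1}) (\<lambda>t. ereal (L (traj f g x0 (\<lambda>_. 1) u t) (u t)))"

definition near_feasible ::
  "(real^'n \<Rightarrow> real^'n) \<Rightarrow> ('k::finite \<Rightarrow> real^'n \<Rightarrow> real^'n) \<Rightarrow> real^'n \<Rightarrow> real^'n \<Rightarrow> real \<Rightarrow>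
   (real \<Rightarrow> real^'k) set" where
  "near_feasible f g x0 x1 \<epsilon> =
     {u. u absolutely_integrable_on {0..1} \<and> traj_defined f g x0 (\<lambda>_. 1) u 1 \<and>
         norm (traj f g x0 (\<lambda>_. 1) u 1 - x1) \<le> \<epsilon>}"

definition lavrentiev_gap ::
  "(real^'n \<Rightarrow> real^'n) \<Rightarrow> ('k::finite \<Rightarrow> real^'n \<Rightarrow> real^'n) \<Rightarrow> (real^'n \<Rightarrow> real^'k \<Rightarrow> real) \<Rightarrow>
   real^'n \<Rightarrow> real^'n \<Rightarrow> bool" where
  "lavrentiev_gap f g L x0 x1 \<longleftrightarrow>
     Lim (at_right 0) (\<lambda>\<epsilon>. INF u\<in>near_feasible f g x0 x1 \<epsilon>. ordinary_cost f g L x0 u)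
       > (INF C\<in>{C \<in> generalized_controls. reaches_target f g x0 x1 C}.
            generalized_cost f g L x0 C)"

end

theory Submission
  imports Defs
begin

text \<open>When \<open>L = L\<^sub>1 + L\<^sub>2\<close> with \<open>L\<^sub>2\<close> positively homogeneous, the extended Lagrangian
  is the finite continuous function \<open>\<lambda>(y, v, w) = L\<^sub>1(y) v + L\<^sub>2(y, w)\<close>, Lipschitz and
  positively homogeneous in \<open>(v, w)\<close>. The cost and the trajectory of a generalized control are
  therefore continuous in \<open>(v, w)\<close> in the mean (integral) norm, and they do not
  change under reparametrization. Given a generalized control on \<open>[0, T]\<close>, approximate its velocity
  \<open>(v, w)\<close> in this norm by continuous functions \<open>(\<nu>, \<omega>)\<close> with \<open>\<nu> > 0\<close> and
  \<open>\<integral>\<nu> = 1\<close>. Taking \<open>V(s) = \<integral>\<^sub>0\<^sup>s \<nu>\<close> as the new time turns them into the ordinary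
  control \<open>u = (\<omega> / \<nu>) \<circ> V\<^sup>-\<^sup>1\<close> on \<open>[0, 1]\<close>, whose end point and cost are as close
  as desired to those of the generalized control.\<close>

subsection \<open>Absolutely continuous functions\<close>

text \<open>For a general convex \<open>L\<close> the extended Lagrangian may be infinite or
  discontinuous where \<open>v = 0\<close>, and mean convergence of velocities then gives no control
  of the costs. Homogeneity removes this obstacle: in \<open>L (y, w / \<nu>) \<nu>\<close> the
  factor cancels in the part \<open>L2\<close>, so the cost of a jump at frozen time is the limit of
  the costs of fast motions. At such a jump \<open>w / v\<close> is undefined; the continuous
  positive \<open>\<nu>\<close> makes \<open>u\<close> continuous, hence admissible. The unit time
  interval comes from the clock: \<open>V\<close> equals 1 at the final parameter, so
  \<open>v\<close> already has integral 1 and normalizing \<open>\<nu>\<close> is a small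
  perturbation. The fields are only locally Lipschitz, so existence of the perturbed trajectory up
  to the final time has to come out of the estimate itself. Absolute continuity is the
  \<epsilon>-\<delta> condition and velocities are pointwise derivatives; differentiability almost
  everywhere and the integral formula are derived from coverings and Riemann sums.\<close>

lemma division_of_realD:
  fixes S :: "real set"
  assumes "d division_of S" "k \<in> d"
  shows "k = {Inf k..Sup k}" "Inf k \<le> Sup k" "Inf k \<in> S" "Sup k \<in> S" "k \<subseteq> S"
proof -
  obtain a b where "k = cbox a b" using assms division_ofD(4) by blast
  then have k: "k = {a..b}" by simp
  have "k \<noteq> {}" and S: "k \<subseteq> S" using assms division_ofD by auto
  with k have "a \<le> b" by auto
  with k S show "k = {Inf k..Sup k}" "Inf k \<le> Sup k" "Inf k \<in> S" "Sup k \<in> S" "k \<subseteq> S"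
    by auto
qed

lemma sum_length_division:
  fixes S :: "real set"
  assumes "d division_of S"
  shows "(\<Sum>k\<in>d. Sup k - Inf k) = measure lebesgue S"
proof -
  have "(\<Sum>k\<in>d. Sup k - Inf k) = (\<Sum>k\<in>d. measure lebesgue k)"
  proof (rule sum.cong[OF refl])
    fix k assume "k \<in> d"
    note k = division_of_realD(1,2)[OF assms this]
    have "measure lebesgue {Inf k..Sup k} = Sup k - Inf k" using k(2) by simp
    then show "Sup k - Inf k = measure lebesgue k" by (subst (asm) k(1)[symmetric]) simp
  qed
  also have "\<dots> = measure lebesgue S" using assms by (rule content_division)
  finally show ?thesis .
qed

lemma sum_length_division_le:
  fixes a b :: real
  assumes "d division_of S" "S \<subseteq> {a..b}" "a \<le> b"
  shows "(\<Sum>k\<in>d. Sup k - Inf k) \<le> b - a"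
proof -
  have "S \<in> lmeasurable" using assms(1) by blast
  then have "measure lebesgue S \<le> measure lebesgue {a..b}"
    using assms(2) by (intro measure_mono_fmeasurable) auto
  then show ?thesis using assms by (simp add: sum_length_division)
qed

lemma sum_increments_division:
  fixes h :: "real \<Rightarrow> 'a::real_normed_vector"
  assumes "d division_of {a..b}" "a \<le> b"
  shows "(\<Sum>k\<in>d. h (Sup k) - h (Inf k)) = h b - h a"
proof -
  \<comment> \<open>Tagging each cell by its left endpoint turns the division into a tagged one, on
    which increments telescope.\<close>
  let ?p = "(\<lambda>k. (Inf k, k)) ` d"
  note D = division_of_realD[OF assms(1)]
  have "?p tagged_division_of {a..b}"
  proof (rule tagged_division_ofI)
    show "finite ?p" using assms(1) by auto
    show "x \<in> K" "K \<subseteq> {a..b}" "\<exists>a b. K = cbox a b" if "(x, K) \<in> ?p" for x K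
    proof -
      from that have K: "K \<in> d" "x = Inf K" by auto
      show "x \<in> K" by (subst D(1)[OF K(1)]) (simp add: K(2) D(2)[OF K(1)])
      show "K \<subseteq> {a..b}" using D(5)[OF K(1)] .
      show "\<exists>a b. K = cbox a b" using assms(1) K(1) division_ofD(4) by blast
    qed
    show "interior K1 \<inter> interior K2 = {}"
      if "(x1, K1) \<in> ?p" "(x2, K2) \<in> ?p" "(x1, K1) \<noteq> (x2, K2)" for x1 K1 x2 K2
      using that division_ofD(5)[OF assms(1)] by auto
    show "\<Union> {K. \<exists>x. (x, K) \<in> ?p} = {a..b}"
      using division_ofD(6)[OF assms(1)] by (auto simp: image_iff)
  qed
  from additive_tagged_division_1[OF assms(2) this, of h] show ?thesis
    by (subst (asm) sum.reindex) (auto simp: inj_on_def)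
qed

text \<open>Coverings below are indexed by pairs of endpoints, while variation sums run over
  divisions. Injectivity lets a sum over pairs be rewritten as a sum over cells.\<close>

lemma division_of_pair_intervals:
  fixes F :: "(real \<times> real) set"
  assumes "finite F" "\<And>i. i \<in> F \<Longrightarrow> fst i < snd i"
    and "pairwise (\<lambda>i j. disjnt {fst i..snd i} {fst j..snd j}) F"
  defines "D \<equiv> (\<lambda>i. {fst i..snd i}) ` F"
  shows "D division_of \<Union>D" "inj_on (\<lambda>i. {fst i..snd i}) F"
proof -
  show "inj_on (\<lambda>i. {fst i..snd i}) F"
  proof (rule inj_onI)
    fix i j assume ij: "i \<in> F" "j \<in> F" "{fst i..snd i} = {fst j..snd j}"
    show "i = j"
    proof (rule ccontr)
      assume "i \<noteq> j"
      with ij assms(3) have "disjnt {fst i..snd i} {fst j..snd j}" by (auto simp: pairwise_def)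
      then show False using ij(3) assms(2)[OF ij(1)] by (auto simp: disjnt_def)
    qed
  qed
  show "D division_of \<Union>D"
  proof (rule division_ofI)
    show "finite D" using assms by auto
    show "K \<subseteq> \<Union>D" if "K \<in> D" for K using that by auto
    show "K \<noteq> {}" if "K \<in> D" for K using that assms(2) unfolding D_def by fastforce
    show "\<exists>a b. K = cbox a b" if "K \<in> D" for K using that unfolding D_def by auto
    show "interior K1 \<inter> interior K2 = {}" if K: "K1 \<in> D" "K2 \<in> D" "K1 \<noteq> K2" for K1 K2
    proof -
      obtain i j where ij: "i \<in> F" "j \<in> F" "K1 = {fst i..snd i}" "K2 = {fst j..snd j}"
        using K unfolding D_def by blast
      with K(3) have "i \<noteq> j" by auto
      then have "disjnt K1 K2" using ij assms(3) by (auto simp: pairwise_def)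
      then show ?thesis using interior_subset[of K1] interior_subset[of K2] by (auto simp: disjnt_def)
    qed
  qed auto
qed

lemma abs_cont_onD:
  assumes "abs_cont_on J h" "\<epsilon> > 0"
  obtains \<delta> where "\<delta> > 0"
    "\<And>d S. d division_of S \<Longrightarrow> S \<subseteq> J \<Longrightarrow> (\<Sum>k\<in>d. Sup k - Inf k) < \<delta> \<Longrightarrow>
        (\<Sum>k\<in>d. norm (h (Sup k) - h (Inf k))) < \<epsilon>"
  using assms unfolding abs_cont_on_def by metis

lemma abs_cont_on_subset: "abs_cont_on J h \<Longrightarrow> I \<subseteq> J \<Longrightarrow> abs_cont_on I h"
  unfolding abs_cont_on_def by (meson order_trans)

lemma abs_cont_on_norm_le:
  fixes h :: "real \<Rightarrow> 'a::real_normed_vector" and h' :: "real \<Rightarrow> 'b::real_normed_vector"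
  assumes "abs_cont_on J h" "\<And>s t. s \<in> J \<Longrightarrow> t \<in> J \<Longrightarrow> norm (h' t - h' s) \<le> norm (h t - h s)"
  shows "abs_cont_on J h'"
  unfolding abs_cont_on_def
proof (intro allI impI)
  fix \<epsilon> :: real assume "\<epsilon> > 0"
  from abs_cont_onD[OF assms(1) this] obtain \<delta> where d: "\<delta> > 0"
    "\<And>d S. d division_of S \<Longrightarrow> S \<subseteq> J \<Longrightarrow> (\<Sum>k\<in>d. Sup k - Inf k) < \<delta> \<Longrightarrow>
        (\<Sum>k\<in>d. norm (h (Sup k) - h (Inf k))) < \<epsilon>" by blast
  have "(\<Sum>k\<in>d. norm (h' (Sup k) - h' (Inf k))) < \<epsilon>"
    if D: "d division_of S" "S \<subseteq> J" "(\<Sum>k\<in>d. Sup k - Inf k) < \<delta>" for d S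
  proof -
    have "(\<Sum>k\<in>d. norm (h' (Sup k) - h' (Inf k))) \<le> (\<Sum>k\<in>d. norm (h (Sup k) - h (Inf k)))"
      using division_of_realD(3,4)[OF D(1)] D(2) assms(2) by (intro sum_mono) blast
    then show ?thesis using d(2)[OF D] by simp
  qed
  then show "\<exists>\<delta>>0. \<forall>d S. d division_of S \<and> S \<subseteq> J \<and> (\<Sum>k\<in>d. Sup k - Inf k) < \<delta> \<longrightarrow>
        (\<Sum>k\<in>d. norm (h' (Sup k) - h' (Inf k))) < \<epsilon>" using d(1) by blast
qed

text \<open>The source of absolute continuity for what is constructed later: trajectories with
  bounded velocity and the identity time change.\<close>

lemma lipschitz_imp_abs_cont_on:
  assumes "C-lipschitz_on J h"
  shows "abs_cont_on J h"
  unfolding abs_cont_on_def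
proof (intro allI impI)
  fix \<epsilon> :: real assume e: "\<epsilon> > 0"
  have C: "C \<ge> 0" using assms lipschitz_on_nonneg by blast
  \<comment> \<open>The threshold uses \<open>C + 1\<close> because \<open>\<epsilon> / C\<close>
    would be 0 for \<open>C = 0\<close>.\<close>
  have "(\<Sum>k\<in>d. norm (h (Sup k) - h (Inf k))) < \<epsilon>"
    if D: "d division_of S" "S \<subseteq> J" "(\<Sum>k\<in>d. Sup k - Inf k) < \<epsilon> / (C + 1)" for d S
  proof -
    have "(\<Sum>k\<in>d. norm (h (Sup k) - h (Inf k))) \<le> (\<Sum>k\<in>d. C * (Sup k - Inf k))"
    proof (rule sum_mono)
      fix k assume "k \<in> d"
      then show "norm (h (Sup k) - h (Inf k)) \<le> C * (Sup k - Inf k)"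
        using division_of_realD(2-4)[OF D(1)] D(2) lipschitz_onD[OF assms, of "Sup k" "Inf k"]
        by (auto simp: dist_norm)
    qed
    also have "\<dots> = C * (\<Sum>k\<in>d. Sup k - Inf k)" by (simp add: sum_distrib_left)
    also have "\<dots> \<le> C * (\<epsilon> / (C + 1))" using D(3) C by (intro mult_left_mono) auto
    also have "\<dots> < \<epsilon>" using C e by (simp add: field_simps)
    finally show ?thesis .
  qed
  then show "\<exists>\<delta>>0. \<forall>d S. d division_of S \<and> S \<subseteq> J \<and> (\<Sum>k\<in>d. Sup k - Inf k) < \<delta> \<longrightarrow>
        (\<Sum>k\<in>d. norm (h (Sup k) - h (Inf k))) < \<epsilon>"
    using e C by (intro exI[of _ "\<epsilon> / (C + 1)"]) auto
qed

lemma abs_cont_on_increment: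
  assumes "abs_cont_on {a..b} h" "\<epsilon> > 0"
  obtains \<delta> where "\<delta> > 0"
    "\<And>s t. s \<in> {a..b} \<Longrightarrow> t \<in> {a..b} \<Longrightarrow> \<bar>s - t\<bar> < \<delta> \<Longrightarrow> norm (h s - h t) < \<epsilon>"
proof -
  from abs_cont_onD[OF assms] obtain \<delta> where d: "\<delta> > 0"
    "\<And>d S. d division_of S \<Longrightarrow> S \<subseteq> {a..b} \<Longrightarrow> (\<Sum>k\<in>d. Sup k - Inf k) < \<delta> \<Longrightarrow>
        (\<Sum>k\<in>d. norm (h (Sup k) - h (Inf k))) < \<epsilon>" by blast
  have *: "norm (h t - h s) < \<epsilon>" if "s \<in> {a..b}" "t \<in> {a..b}" "s \<le> t" "t - s < \<delta>" for s t
    using d(2)[of "{{s..t}}" "{s..t}"] that division_of_self[of s t] by auto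
  show ?thesis
  proof
    show "\<delta> > 0" by fact
    fix s t assume st: "s \<in> {a..b}" "t \<in> {a..b}" "\<bar>s - t\<bar> < \<delta>"
    show "norm (h s - h t) < \<epsilon>"
      using *[OF st(1,2)] *[OF st(2,1)] st(3) by (cases "s \<le> t") (auto simp: norm_minus_commute)
  qed
qed

lemma abs_cont_on_imp_continuous_on:
  assumes "abs_cont_on {a..b} h"
  shows "continuous_on {a..b} h"
  unfolding continuous_on_iff
proof (intro ballI allI impI)
  fix x \<epsilon> :: real assume x: "x \<in> {a..b}" "\<epsilon> > 0"
  from abs_cont_on_increment[OF assms x(2)] obtain \<delta> where "\<delta> > 0"
    "\<And>s t. s \<in> {a..b} \<Longrightarrow> t \<in> {a..b} \<Longrightarrow> \<bar>s - t\<bar> < \<delta> \<Longrightarrow> norm (h s - h t) < \<epsilon>" by blast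
  then show "\<exists>d>0. \<forall>x'\<in>{a..b}. dist x' x < d \<longrightarrow> dist (h x') (h x) < \<epsilon>"
    using x by (intro exI[of _ \<delta>]) (auto simp: dist_norm)
qed

text \<open>In the Henstock sums, tags in the exceptional null set are forced into intervals of small total
  length, where absolute continuity controls the increments.\<close>

lemma abs_cont_has_integral:
  fixes h \<phi> :: "real \<Rightarrow> 'a::euclidean_space"
  assumes ac: "abs_cont_on {a..b} h" and ab: "a \<le> b" and N: "negligible N"
    and der: "\<And>t. t \<in> {a..b} - N \<Longrightarrow> (h has_vector_derivative \<phi> t) (at t within {a..b})"
  shows "(\<phi> has_integral h b - h a) {a..b}"
proof (cases "a = b")
  case True then show ?thesis by (simp add: has_integral_refl)
next
  case False
  with ab have ab: "a < b" by simp
  \<comment> \<open>Values of \<open>\<phi>\<close> on \<open>N\<close> are arbitrary and could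
    spoil the Riemann sums at tags in \<open>N\<close>; they are set to 0 and restored at the end by
    a change on a null set.\<close>
  let ?\<phi> = "\<lambda>t. if t \<in> N then 0 else \<phi> t"
  have "(?\<phi> has_integral h b - h a) {a..b}"
    unfolding has_integral_factor_content_real
  proof (intro allI impI)
    fix e :: real assume e: "e > 0"
    define e1 where "e1 = e / 2"
    \<comment> \<open>The allowed error \<open>e * (b - a)\<close> is shared equally between tags
      inside and outside \<open>N\<close>: each group gets \<open>e2\<close>.\<close>
    define e2 where "e2 = e1 * (b - a)"
    have e1: "e1 > 0" and e2: "e2 > 0" using e ab by (auto simp: e1_def e2_def)
    from abs_cont_onD[OF ac e2] obtain \<delta> where d: "\<delta> > 0"
      "\<And>d S. d division_of S \<Longrightarrow> S \<subseteq> {a..b} \<Longrightarrow> (\<Sum>k\<in>d. Sup k - Inf k) < \<delta> \<Longrightarrow>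
          (\<Sum>k\<in>d. norm (h (Sup k) - h (Inf k))) < e2" by blast
    have "N \<in> sets lebesgue" using N negligible_imp_sets by blast
    from sets_lebesgue_outer_open[OF this d(1)] obtain U where U: "open U" "N \<subseteq> U"
      "U - N \<in> lmeasurable" "emeasure lebesgue (U - N) < ennreal \<delta>" by blast
    have U': "U \<in> lmeasurable" "measure lebesgue U < \<delta>"
    proof -
      have NL: "N \<in> lmeasurable" "measure lebesgue N = 0"
        using N negligible_iff_measure by auto
      have "U = (U - N) \<union> N" using U by auto
      then show "U \<in> lmeasurable" using U(3) NL(1) by (metis fmeasurable.Un)
      have "measure lebesgue U \<le> measure lebesgue (U - N) + measure lebesgue N"
        by (metis \<open>U = (U - N) \<union> N\<close> U(3) NL(1) measure_Un_le fmeasurableD)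
      moreover have "measure lebesgue (U - N) < \<delta>"
        using U(3,4) d(1) by (simp add: emeasure_eq_measure2 ennreal_less_iff)
      ultimately show "measure lebesgue U < \<delta>" using NL by simp
    qed
    have "\<exists>r>0. (t \<in> N \<longrightarrow> ball t r \<subseteq> U) \<and> (t \<in> {a..b} - N \<longrightarrow>
       (\<forall>s\<in>{a..b}. \<bar>s - t\<bar> < r \<longrightarrow> norm (h s - h t - (s - t) *\<^sub>R \<phi> t) \<le> e1 * \<bar>s - t\<bar>))" for t
    proof (cases "t \<in> N")
      case True
      then show ?thesis using U(1,2) by (meson DiffD2 openE subsetD)
    next
      case False
      show ?thesis
      proof (cases "t \<in> {a..b}")
        case True
        with False der have "(h has_derivative (\<lambda>x. x *\<^sub>R \<phi> t)) (at t within {a..b})"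
          unfolding has_vector_derivative_def by auto
        then show ?thesis using False e1
          unfolding has_derivative_within_alt by (auto simp: real_norm_def)
      qed (use False in \<open>auto intro: exI[of _ 1]\<close>)
    qed
    then obtain r where r: "\<And>t. r t > 0" "\<And>t. t \<in> N \<Longrightarrow> ball t (r t) \<subseteq> U"
      "\<And>t s. t \<in> {a..b} - N \<Longrightarrow> s \<in> {a..b} \<Longrightarrow> \<bar>s - t\<bar> < r t \<Longrightarrow>
        norm (h s - h t - (s - t) *\<^sub>R \<phi> t) \<le> e1 * \<bar>s - t\<bar>" by metis
    define \<gamma> where "\<gamma> = (\<lambda>t. ball t (r t))"
    have "gauge \<gamma>" unfolding \<gamma>_def using r(1) by (intro gauge_ball_dependent) auto
    moreover have "norm (sum (\<lambda>(x,k). measure lborel k *\<^sub>R ?\<phi> x) p - (h b - h a)) \<le> e * measure lborel {a..b}"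
      if p: "p tagged_division_of {a..b}" "\<gamma> fine p" for p
    proof -
      let ?E = "\<lambda>(x,k). measure lborel k *\<^sub>R ?\<phi> x - (h (Sup k) - h (Inf k))"
      let ?p1 = "{q\<in>p. fst q \<in> N}" and ?p2 = "{q\<in>p. fst q \<notin> N}"
      have fin: "finite p" using p by auto
      have K: "k = {Inf k..Sup k}" "Inf k \<le> Sup k" "x \<in> k" "k \<subseteq> {a..b}" "k \<subseteq> \<gamma> x"
        if xkp: "(x,k) \<in> p" for x k
      proof -
        obtain u v where "k = cbox u v" using tagged_division_ofD(4)[OF p(1) xkp] by blast
        then have k: "k = {u..v}" by simp
        show xk: "x \<in> k" "k \<subseteq> {a..b}" using tagged_division_ofD(2,3)[OF p(1) xkp] .
        have "u \<le> v" using xk(1) unfolding k by simp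
        then show "k = {Inf k..Sup k}" "Inf k \<le> Sup k" unfolding k by simp_all
        show "k \<subseteq> \<gamma> x" using p(2) xkp unfolding fine_def by blast
      qed
      have tp: "sum (\<lambda>(x,k). h (Sup k) - h (Inf k)) p = h b - h a"
        by (rule additive_tagged_division_1[OF less_imp_le[OF ab] p(1)])
      have "sum ?E p = sum (\<lambda>(x,k). measure lborel k *\<^sub>R ?\<phi> x) p
          - sum (\<lambda>(x,k). h (Sup k) - h (Inf k)) p"
        unfolding sum_subtractf[symmetric] by (rule sum.cong) auto
      then have "sum (\<lambda>(x,k). measure lborel k *\<^sub>R ?\<phi> x) p - (h b - h a) = sum ?E p"
        unfolding tp by (rule sym)
      also have "\<dots> = sum ?E (?p1 \<union> ?p2)" by (rule arg_cong[of _ _ "sum ?E"]) blast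
      also have "\<dots> = sum ?E ?p1 + sum ?E ?p2"
        using fin by (intro sum.union_disjoint) auto
      finally have eq: "norm (sum (\<lambda>(x,k). measure lborel k *\<^sub>R ?\<phi> x) p - (h b - h a)) \<le>
          norm (sum ?E ?p1) + norm (sum ?E ?p2)" by (simp only: norm_triangle_ineq)
      have pt: "?p1 tagged_partial_division_of {a..b}"
        by (rule tagged_partial_division_subset[OF _ Collect_restrict])
          (use p(1) in \<open>simp add: tagged_division_of_def\<close>)
      have D1: "snd ` ?p1 division_of \<Union>(snd ` ?p1)" using partial_division_of_tagged_division[OF pt] .
      have sub: "\<Union>(snd ` ?p1) \<subseteq> {a..b}" using K(4) by force
      have subU: "\<Union>(snd ` ?p1) \<subseteq> U"
      proof clarify
        fix y x k assume "(x, k) \<in> p" "fst (x, k) \<in> N" "y \<in> snd (x, k)"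
        then show "y \<in> U" using K(5)[of x k] r(2)[of x] unfolding \<gamma>_def by auto
      qed
      have "(\<Sum>k\<in>snd ` ?p1. Sup k - Inf k) \<le> measure lebesgue U"
        unfolding sum_length_division[OF D1] using subU U'(1) D1
        by (intro measure_mono_fmeasurable) (auto intro: lmeasurable_division fmeasurableD)
      then have "(\<Sum>k\<in>snd ` ?p1. norm (h (Sup k) - h (Inf k))) < e2"
        using d(2)[OF D1 sub] U'(2) by simp
      moreover have "(\<Sum>k\<in>snd ` ?p1. norm (h (Sup k) - h (Inf k))) =
          (\<Sum>q\<in>?p1. norm (h (Sup (snd q)) - h (Inf (snd q))))"
      \<comment> \<open>Distinct entries of \<open>p\<close> have disjoint interiors; if they share
        the cell, its interior is empty, so it is a point with zero increment.\<close>
      proof (subst sum.reindex_nontrivial)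
        show "finite ?p1" using fin by simp
        fix q q' assume q: "q \<in> ?p1" "q' \<in> ?p1" "q \<noteq> q'" "snd q = snd q'"
        define k where "k = snd q"
        have "(fst q, k) = q" "(fst q', k) = q'" using q(4) by (simp_all add: k_def prod_eq_iff)
        then have qp: "(fst q, k) \<in> p" "(fst q', k) \<in> p" "(fst q, k) \<noteq> (fst q', k)"
          using q(1-3) by simp_all
        have "interior k \<inter> interior k = {}" by (rule tagged_division_ofD(5)[OF p(1) qp])
        then have "interior {Inf k..Sup k} = {}" by (subst (asm) (1 2) K(1)[OF qp(1)]) simp
        then have "Inf k = Sup k" using K(2)[OF qp(1)] by simp
        then show "norm (h (Sup (snd q)) - h (Inf (snd q))) = 0" by (simp add: k_def)
      qed simp
      moreover have "norm (sum ?E ?p1) \<le> (\<Sum>(x,k)\<in>?p1. norm (h (Sup k) - h (Inf k)))"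
        by (rule order_trans[OF norm_sum]) (auto intro!: sum_mono simp: norm_minus_commute)
      ultimately have b1: "norm (sum ?E ?p1) \<le> e2" by (simp add: split_def)
      have "norm (sum ?E ?p2) \<le> (\<Sum>(x,k)\<in>?p2. e1 * measure lborel k)"
      proof (rule order_trans[OF norm_sum], rule sum_mono, clarify)
        fix x k assume xk: "(x, k) \<in> p" "fst (x,k) \<notin> N"
        define u v where "u = Inf k" and "v = Sup k"
        note k = K[OF xk(1), folded u_def v_def]
        have c: "measure lborel k = v - u" by (subst k(1)) (simp add: k(2))
        have xi: "u \<le> x" "x \<le> v" using k(3) by (subst (asm) k(1), simp)+
        have xx: "x \<in> {a..b} - N" using k xk by auto
        have uv: "u \<in> {a..b}" "v \<in> {a..b}" "\<bar>u - x\<bar> < r x" "\<bar>v - x\<bar> < r x"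
        proof -
          have "u \<in> k" "v \<in> k" by (subst k(1), simp add: k(2))+
          then show "u \<in> {a..b}" "v \<in> {a..b}" "\<bar>u - x\<bar> < r x" "\<bar>v - x\<bar> < r x"
            using k(4,5) unfolding \<gamma>_def by (auto simp: dist_real_def subset_iff)
        qed
        \<comment> \<open>Splitting the increment at the tag: the derivative estimate holds on
          either side of \<open>x\<close>, and since \<open>u \<le> x \<le> v\<close> the two errors
          add up to \<open>e1\<close> times the length of the cell.\<close>
        have "measure lborel k *\<^sub>R \<phi> x - (h v - h u) =
          (h u - h x - (u - x) *\<^sub>R \<phi> x) - (h v - h x - (v - x) *\<^sub>R \<phi> x)"
          unfolding c by (simp add: algebra_simps)
        also have "norm \<dots> \<le> e1 * \<bar>u - x\<bar> + e1 * \<bar>v - x\<bar>"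
          using r(3)[OF xx uv(1,3)] r(3)[OF xx uv(2,4)] norm_triangle_ineq4 by (smt (verit))
        also have "\<dots> = e1 * measure lborel k" using xi unfolding c by (simp add: algebra_simps)
        finally show "norm (measure lborel k *\<^sub>R ?\<phi> x - (h (Sup k) - h (Inf k))) \<le> e1 * measure lborel k"
          using xk by (simp add: u_def v_def)
      qed
      also have "\<dots> \<le> (\<Sum>(x,k)\<in>p. e1 * measure lborel k)"
        using fin e1 by (intro sum_mono2) auto
      also have "\<dots> = e1 * (\<Sum>(x,k)\<in>p. measure lborel k)" by (simp add: sum_distrib_left split_def)
      also have "\<dots> = e2" using additive_content_tagged_division[of p a b] p(1) ab by (simp add: e2_def)
      finally have b2: "norm (sum ?E ?p2) \<le> e2" .
      have "e * measure lborel {a..b} = e2 + e2" using ab by (simp add: e2_def e1_def field_simps)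
      then show ?thesis using eq b1 b2 by linarith
    qed
    ultimately show "\<exists>d. gauge d \<and> (\<forall>p. p tagged_division_of {a..b} \<and> d fine p \<longrightarrow>
         norm (sum (\<lambda>(x,k). measure lborel k *\<^sub>R ?\<phi> x) p - (h b - h a)) \<le> e * measure lborel {a..b})" by (intro exI[of _ \<gamma>]) simp
  qed
  then show ?thesis by (rule has_integral_spike[OF N, rotated]) auto
qed

section \<open>Vitali coverings and differentiability almost everywhere\<close>

text \<open>The Vitali theorem selects from \<open>K\<close> a countable disjoint subfamily that
  covers \<open>E\<close> up to a null set. A length bound on finite disjoint subfamilies passes to
  its union, so smallness of \<open>E\<close> becomes a combinatorial estimate on finitely many
  intervals.\<close>

lemma vitali_cover_measure_le:
  fixes E :: "real set" and K :: "(real \<times> real) set"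
  assumes pos: "\<And>i. i \<in> K \<Longrightarrow> fst i < snd i"
    and small: "\<And>t \<rho>. t \<in> E \<Longrightarrow> 0 < \<rho> \<Longrightarrow> \<exists>i\<in>K. fst i \<le> t \<and> t \<le> snd i \<and> snd i - fst i < \<rho>"
    and bound: "\<And>F. finite F \<Longrightarrow> F \<subseteq> K \<Longrightarrow>
      pairwise (\<lambda>i j. disjnt {fst i..snd i} {fst j..snd j}) F \<Longrightarrow> (\<Sum>i\<in>F. snd i - fst i) \<le> m"
  obtains T where "E \<subseteq> T" "T \<in> lmeasurable" "measure lebesgue T \<le> m"
proof -
  \<comment> \<open>The covering theorem speaks of closed balls; an interval is the ball given by
    its midpoint and half its length.\<close>
  let ?a = "\<lambda>i::real\<times>real. (fst i + snd i) / 2" and ?r = "\<lambda>i::real\<times>real. (snd i - fst i) / 2"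
  have cb: "cball (?a i) (?r i) = {fst i..snd i}" for i
    unfolding cball_eq_atLeastAtMost by (simp add: field_simps)
  have 1: "0 < ?r i" if "i \<in> K" for i using pos[OF that] by simp
  have 2: "\<exists>i. i \<in> K \<and> t \<in> cball (?a i) (?r i) \<and> ?r i < \<rho>" if t: "t \<in> E" "0 < \<rho>" for t \<rho>
  proof -
    obtain i where "i \<in> K" "fst i \<le> t" "t \<le> snd i" "snd i - fst i < \<rho>" using small[OF t] by blast
    then show ?thesis using pos[of i] unfolding cb by (intro exI[of _ i]) auto
  qed
  from Vitali_covering_theorem_cballs[of K ?r E ?a, OF 1 2]
  obtain C where C: "countable C" "C \<subseteq> K"
    "pairwise (\<lambda>i j. disjnt {fst i..snd i} {fst j..snd j}) C"
    "negligible (E - (\<Union>i\<in>C. {fst i..snd i}))" unfolding cb by blast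
  let ?U = "\<Union>i\<in>C. {fst i..snd i}"
  have fin: "measure lebesgue (\<Union>i\<in>F. {fst i..snd i}) \<le> m" if F: "F \<subseteq> C" "finite F" for F
  proof -
    have "measure lebesgue (\<Union>i\<in>F. {fst i..snd i}) \<le> (\<Sum>i\<in>F. measure lebesgue {fst i..snd i})"
      using F(2) by (intro measure_UNION_le) auto
    also have "\<dots> = (\<Sum>i\<in>F. snd i - fst i)"
      using F C(2) pos by (intro sum.cong) (auto simp: less_imp_le subset_iff)
    also have "\<dots> \<le> m"
      using F C(2) C(3) by (intro bound) (auto intro: pairwise_subset)
    finally show ?thesis .
  qed
  have U: "?U \<in> lmeasurable" by (rule fmeasurable_UN_bound[OF C(1) _ fin]) auto
  have mU: "measure lebesgue ?U \<le> m" by (rule measure_UN_bound[OF C(1) _ fin]) auto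
  let ?N = "E - ?U"
  have N: "?N \<in> lmeasurable" "measure lebesgue ?N = 0" using C(4) by (simp_all add: negligible_iff_measure)
  show ?thesis
  proof
    show "E \<subseteq> ?U \<union> ?N" by blast
    show "?U \<union> ?N \<in> lmeasurable" using U N by (intro fmeasurable.Un)
    have "measure lebesgue (?U \<union> ?N) \<le> measure lebesgue ?U + measure lebesgue ?N"
      using U N by (intro measure_Un_le) (auto dest: fmeasurableD)
    then show "measure lebesgue (?U \<union> ?N) \<le> m" using mU N(2) by linarith
  qed
qed

text \<open>The families range over all divisions inside \<open>J\<close>, not only those that
  exhaust it, so disjoint intervals produced by a covering argument are admissible as they
  stand.\<close>

definition variation_le :: "real set \<Rightarrow> (real \<Rightarrow> 'a::real_normed_vector) \<Rightarrow> real \<Rightarrow> bool" where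
  "variation_le J h B \<longleftrightarrow>
    (\<forall>d S. d division_of S \<and> S \<subseteq> J \<longrightarrow> (\<Sum>k\<in>d. norm (h (Sup k) - h (Inf k))) \<le> B)"

lemma variation_leD:
  "variation_le J h B \<Longrightarrow> d division_of S \<Longrightarrow> S \<subseteq> J \<Longrightarrow> (\<Sum>k\<in>d. norm (h (Sup k) - h (Inf k))) \<le> B"
  unfolding variation_le_def by blast

text \<open>Disjoint intervals whose chords have slope at least \<open>l\<close> in norm have total
  length at most \<open>B / l\<close>, and \<open>l\<close> is arbitrary.\<close>

lemma negligible_steep:
  fixes h :: "real \<Rightarrow> 'a::real_normed_vector"
  assumes var: "variation_le {a..b} h B"
    and steep: "\<And>t l \<rho>. t \<in> E \<Longrightarrow> 0 < l \<Longrightarrow> 0 < \<rho> \<Longrightarrow> \<exists>p q. p < q \<and> a \<le> p \<and> q \<le> b \<and> p \<le> t \<and> t \<le> q \<and>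
       q - p < \<rho> \<and> l * (q - p) \<le> norm (h q - h p)"
  shows "negligible E"
  unfolding negligible_outer_le
proof (intro allI impI)
  fix e :: real assume e: "e > 0"
  have B: "B \<ge> 0" using variation_leD[OF var, of "{}" "{}"] by simp
  \<comment> \<open>This slope makes \<open>B / l\<close> at most \<open>e\<close>; the
    \<open>+ 1\<close> keeps \<open>l\<close> positive when \<open>B = 0\<close>.\<close>
  define l where "l = (B + 1) / e"
  have l: "l > 0" using B e by (simp add: l_def)
  define K where "K = {(p, q). p < q \<and> a \<le> p \<and> q \<le> b \<and> l * (q - p) \<le> norm (h q - h p)}"
  have bound: "(\<Sum>i\<in>F. snd i - fst i) \<le> e"
    if F: "finite F" "F \<subseteq> K" "pairwise (\<lambda>i j. disjnt {fst i..snd i} {fst j..snd j}) F" for F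
  proof -
    let ?I = "\<lambda>i::real\<times>real. {fst i..snd i}"
    have pos: "fst i < snd i" if "i \<in> F" for i using that F(2) by (auto simp: K_def)
    note D = division_of_pair_intervals[OF F(1) pos F(3)]
    have "l * (\<Sum>i\<in>F. snd i - fst i) \<le> (\<Sum>i\<in>F. norm (h (snd i) - h (fst i)))"
      unfolding sum_distrib_left using F(2) by (intro sum_mono) (auto simp: K_def)
    also have "\<dots> = (\<Sum>i\<in>F. norm (h (Sup (?I i)) - h (Inf (?I i))))"
      by (intro sum.cong refl) (simp add: less_imp_le pos)
    also have "\<dots> = (\<Sum>k\<in>?I ` F. norm (h (Sup k) - h (Inf k)))"
      by (simp only: sum.reindex[OF D(2)] o_def)
    also have "\<dots> \<le> B"
      using F(2) by (intro variation_leD[OF var D(1)]) (auto simp: K_def)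
    finally have "(\<Sum>i\<in>F. snd i - fst i) \<le> B / l" using l by (simp add: field_simps)
    also have "\<dots> \<le> e" using B e by (simp add: l_def field_simps)
    finally show ?thesis .
  qed
  have small: "\<exists>i\<in>K. fst i \<le> t \<and> t \<le> snd i \<and> snd i - fst i < \<rho>" if t: "t \<in> E" "0 < \<rho>" for t \<rho>
    using steep[OF t(1) l t(2)] unfolding K_def by fastforce
  have pos: "fst i < snd i" if "i \<in> K" for i using that by (auto simp: K_def)
  from vitali_cover_measure_le[OF pos small bound] obtain T where
    "E \<subseteq> T" "T \<in> lmeasurable" "measure lebesgue T \<le> e" by blast
  then show "\<exists>T. E \<subseteq> T \<and> T \<in> lmeasurable \<and> measure lebesgue T \<le> e" by blast
qed

text \<open>With \<open>s\<close> the sign of the net increment, the signed increments sum to its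
  absolute value. A cell of \<open>F\<close> contributes at most \<open>- c\<close> times its length
  to that sum but at least \<open>c\<close> times its length to the variation, which accounts for
  the factor 2.\<close>

lemma division_variation_gain:
  fixes h :: "real \<Rightarrow> real"
  assumes q: "q division_of {u..v}" "u \<le> v" and F: "F \<subseteq> q" and s: "\<bar>s\<bar> = 1" "0 \<le> s * (h v - h u)"
    and opp: "\<And>i. i \<in> F \<Longrightarrow> s * (h (Sup i) - h (Inf i)) \<le> - c * (Sup i - Inf i)"
  shows "\<bar>h v - h u\<bar> + 2 * c * (\<Sum>i\<in>F. Sup i - Inf i) \<le> (\<Sum>i\<in>q. \<bar>h (Sup i) - h (Inf i)\<bar>)"
proof -
  let ?\<Delta> = "\<lambda>i. h (Sup i) - h (Inf i)"
  have fin: "finite q" using q(1) by auto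
  have le: "\<bar>x\<bar> \<ge> s * x" "\<bar>x\<bar> \<ge> - (s * x)" for x
    using s(1) by (auto simp: abs_if split: if_splits)
  have abs: "\<bar>h v - h u\<bar> = s * (h v - h u)" using s by (auto simp: abs_if split: if_splits)
  have split: "sum f q = sum f (q - F) + sum f F" for f :: "real set \<Rightarrow> real"
    by (rule sum.subset_diff[OF F fin])
  have "\<bar>h v - h u\<bar> = (\<Sum>i\<in>q. s * ?\<Delta> i)"
    unfolding abs sum_distrib_left[symmetric] sum_increments_division[OF q] by simp
  also have "\<dots> = (\<Sum>i\<in>q - F. s * ?\<Delta> i) + (\<Sum>i\<in>F. s * ?\<Delta> i)" by (rule split)
  finally have 1: "\<bar>h v - h u\<bar> = (\<Sum>i\<in>q - F. s * ?\<Delta> i) + (\<Sum>i\<in>F. s * ?\<Delta> i)" .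
  have 2: "(\<Sum>i\<in>q - F. s * ?\<Delta> i) \<le> (\<Sum>i\<in>q - F. \<bar>?\<Delta> i\<bar>)" by (intro sum_mono le)
  have 3: "(\<Sum>i\<in>F. - (s * ?\<Delta> i)) \<le> (\<Sum>i\<in>F. \<bar>?\<Delta> i\<bar>)" by (intro sum_mono le)
  have 4: "(\<Sum>i\<in>F. s * ?\<Delta> i) \<le> (\<Sum>i\<in>F. - c * (Sup i - Inf i))" by (intro sum_mono opp)
  have 5: "(\<Sum>i\<in>F. - c * (Sup i - Inf i)) = - (c * (\<Sum>i\<in>F. Sup i - Inf i))"
    by (simp add: sum_distrib_left sum_negf)
  have 6: "2 * c * x = c * x + c * x" for x by simp
  show ?thesis using 1 2 3 4 split[of "\<lambda>i. \<bar>?\<Delta> i\<bar>"] unfolding 5 6 sum_negf by linarith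
qed

text \<open>Austin's argument: on a partition that nearly exhausts the variation, disjoint intervals with
  slope opposite to that of the cell containing them would add their increments twice to the
  variation, so their total length is small.\<close>

lemma negligible_oscillating:
  fixes h :: "real \<Rightarrow> real"
  assumes var: "variation_le {a..b} h B" and ab: "a \<le> b" and c: "c > 0" and E: "E \<subseteq> {a..b}"
    and osc: "\<And>t \<rho> s. t \<in> E \<Longrightarrow> 0 < \<rho> \<Longrightarrow> s \<in> {-1, 1} \<Longrightarrow> \<exists>p q. p < q \<and> p \<le> t \<and> t \<le> q \<and> q - p < \<rho> \<and>
       s * (h q - h p) \<le> - c * (q - p)"
  shows "negligible E"
proof -
  let ?\<Delta> = "\<lambda>k. \<bar>h (Sup k) - h (Inf k)\<bar>"
  \<comment> \<open>Closeness to the supremum of these sums, rather than the bound \<open>B\<close>,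
    is what limits the variation that a refinement can still gain.\<close>
  define W where "W = {sum ?\<Delta> d | d. d division_of \<Union>d \<and> \<Union>d \<subseteq> {a..b}}"
  have W_le: "x \<le> B" if "x \<in> W" for x
    using that variation_leD[OF var] unfolding W_def by auto
  then have bdd: "bdd_above W" by (rule bdd_aboveI)
  have W0: "W \<noteq> {}" unfolding W_def by (auto intro!: exI[of _ "{}"])
  define V where "V = Sup W"
  \<comment> \<open>\<open>Z\<close> collects the endpoints of the partition: a small interval
    around such a point may fail to fit into one cell. Finitely many points are harmless.\<close>
  have cover: "\<exists>Z T. finite Z \<and> E - Z \<subseteq> T \<and> T \<in> lmeasurable \<and> measure lebesgue T \<le> e" if e: "e > 0" for e
  proof -
    \<comment> \<open>Opposing intervals of total length \<open>l\<close> raise the variation by at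
      least \<open>2 * c * l\<close>; this deficit therefore forces
      \<open>l \<le> e\<close>.\<close>
    have "V - 2 * c * e < Sup W" using c e by (simp add: V_def)
    then obtain w where "w \<in> W" "V - 2 * c * e < w" unfolding less_cSup_iff[OF W0 bdd] by blast
    then obtain d1 where d1: "d1 division_of \<Union>d1" "\<Union>d1 \<subseteq> {a..b}" "V - 2 * c * e < sum ?\<Delta> d1"
      unfolding W_def by auto
    obtain d0 where d0: "d1 \<subseteq> d0" "d0 division_of {a..b}"
      using partial_division_extend_interval[OF d1(1)] d1(2) by (metis box_real(2))
    have fin0: "finite d0" using d0(2) by auto
    have "sum ?\<Delta> d1 \<le> sum ?\<Delta> d0" using fin0 d0(1) by (intro sum_mono2) auto
    with d1(3) have near: "V - 2 * c * e < sum ?\<Delta> d0" by linarith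
    define s where "s = (\<lambda>k. if h (Inf k) \<le> h (Sup k) then 1 else - 1 :: real)"
    define K where "K = {(p, q). p < q \<and> (\<exists>k\<in>d0. {p..q} \<subseteq> k \<and> s k * (h q - h p) \<le> - c * (q - p))}"
    define Z where "Z = Inf ` d0 \<union> Sup ` d0"
    have pos: "fst i < snd i" if "i \<in> K" for i using that by (auto simp: K_def)
    have small: "\<exists>i\<in>K. fst i \<le> t \<and> t \<le> snd i \<and> snd i - fst i < \<rho>" if t: "t \<in> E - Z" "0 < \<rho>" for t \<rho>
    proof -
      have "t \<in> \<Union>d0" using t(1) E division_ofD(6)[OF d0(2)] by blast
      then obtain k where k: "k \<in> d0" "t \<in> k" by blast
      note D = division_of_realD[OF d0(2) k(1)]
      have "t \<in> {Inf k..Sup k}" using D(1) k(2) by blast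
      moreover have "t \<noteq> Inf k" "t \<noteq> Sup k" using t(1) k(1) unfolding Z_def by blast+
      ultimately have tk: "Inf k < t" "t < Sup k" by auto
      let ?\<rho> = "min \<rho> (min (t - Inf k) (Sup k - t))"
      have "?\<rho> > 0" "s k \<in> {-1, 1}" using tk t(2) by (auto simp: s_def)
      from osc[OF _ this] t(1) obtain p q where pq: "p < q" "p \<le> t" "t \<le> q" "q - p < ?\<rho>"
        "s k * (h q - h p) \<le> - c * (q - p)" by blast
      have "{p..q} \<subseteq> {Inf k..Sup k}" using pq(1-4) by auto
      then have "(p, q) \<in> K" using pq(1,5) k(1) D(1) unfolding K_def by blast
      then show ?thesis using pq by (intro bexI[of _ "(p, q)"]) auto
    qed
    have bound: "(\<Sum>i\<in>F. snd i - fst i) \<le> e"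
      if F: "finite F" "F \<subseteq> K" "pairwise (\<lambda>i j. disjnt {fst i..snd i} {fst j..snd j}) F" for F
    proof -
      let ?I = "\<lambda>i::real\<times>real. {fst i..snd i}"
      have "\<forall>i\<in>F. \<exists>k\<in>d0. ?I i \<subseteq> k \<and> s k * (h (snd i) - h (fst i)) \<le> - c * (snd i - fst i)"
      proof
        fix i assume "i \<in> F"
        then have "(fst i, snd i) \<in> K" using F(2) by auto
        then show "\<exists>k\<in>d0. ?I i \<subseteq> k \<and> s k * (h (snd i) - h (fst i)) \<le> - c * (snd i - fst i)"
          unfolding K_def mem_Collect_eq case_prod_conv by blast
      qed
      then obtain \<kappa> where \<kappa>: "\<And>i. i \<in> F \<Longrightarrow> \<kappa> i \<in> d0" "\<And>i. i \<in> F \<Longrightarrow> ?I i \<subseteq> \<kappa> i"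
        "\<And>i. i \<in> F \<Longrightarrow> s (\<kappa> i) * (h (snd i) - h (fst i)) \<le> - c * (snd i - fst i)" by metis
      define G where "G = (\<lambda>k. {i \<in> F. \<kappa> i = k})"
      have Gpos: "fst i < snd i" if "i \<in> G k" for i k using that F(2) pos by (auto simp: G_def)
      have GI: "?I ` G k division_of \<Union>(?I ` G k)" "inj_on ?I (G k)" for k
      proof -
        have "finite (G k)" "pairwise (\<lambda>i j. disjnt {fst i..snd i} {fst j..snd j}) (G k)"
          using F by (auto simp: G_def intro: pairwise_subset)
        from division_of_pair_intervals[OF this(1) Gpos this(2)]
        show "?I ` G k division_of \<Union>(?I ` G k)" "inj_on ?I (G k)" by auto
      qed
      \<comment> \<open>Filling the gaps between the chosen intervals gives a full division of the
        cell, on which the increments telescope.\<close>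
      have "\<exists>q. ?I ` G k \<subseteq> q \<and> q division_of {Inf k..Sup k}" if k: "k \<in> d0" for k
      proof -
        have "\<Union>(?I ` G k) \<subseteq> k" using \<kappa>(2) by (auto simp: G_def)
        also have "k = cbox (Inf k) (Sup k)" using division_of_realD(1)[OF d0(2) k] by simp
        finally have "\<Union>(?I ` G k) \<subseteq> cbox (Inf k) (Sup k)" .
        from partial_division_extend_interval[OF GI(1) this] show ?thesis by (metis box_real(2))
      qed
      then obtain Q where Q: "\<And>k. k \<in> d0 \<Longrightarrow> ?I ` G k \<subseteq> Q k"
        "\<And>k. k \<in> d0 \<Longrightarrow> Q k division_of {Inf k..Sup k}" by metis
      \<comment> \<open>Refinements of neighbouring cells may share a one-point cell at the common
        endpoint. Dropping cells with empty interior makes the families \<open>R k\<close> disjoint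
        and loses no variation.\<close>
      define R where "R = (\<lambda>k. {i \<in> Q k. interior i \<noteq> {}})"
      have gain: "?\<Delta> k + 2 * c * (\<Sum>i\<in>G k. snd i - fst i) \<le> sum ?\<Delta> (R k)" if k: "k \<in> d0" for k
      proof -
        have "(\<Sum>i\<in>G k. snd i - fst i) = (\<Sum>i\<in>G k. Sup (?I i) - Inf (?I i))"
          by (intro sum.cong refl) (simp add: less_imp_le Gpos)
        also have "\<dots> = (\<Sum>j\<in>?I ` G k. Sup j - Inf j)" by (subst sum.reindex[OF GI(2)]) simp
        finally have "?\<Delta> k + 2 * c * (\<Sum>i\<in>G k. snd i - fst i) =
          ?\<Delta> k + 2 * c * (\<Sum>j\<in>?I ` G k. Sup j - Inf j)" by simp
        also have "\<dots> \<le> sum ?\<Delta> (Q k)"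
        proof (rule division_variation_gain[OF Q(2)[OF k] division_of_realD(2)[OF d0(2) k] Q(1)[OF k]])
          show "\<bar>s k\<bar> = 1" "0 \<le> s k * (h (Sup k) - h (Inf k))" by (auto simp: s_def)
          fix j assume "j \<in> ?I ` G k"
          then obtain i where i: "i \<in> F" "\<kappa> i = k" "j = ?I i" "fst i < snd i" using Gpos by (auto simp: G_def)
          then show "s k * (h (Sup j) - h (Inf j)) \<le> - c * (Sup j - Inf j)" using \<kappa>(3)[OF i(1)] by simp
        qed
        also have "sum ?\<Delta> (Q k) = sum ?\<Delta> (R k)"
        proof (rule sum.mono_neutral_right)
          show "finite (Q k)" "R k \<subseteq> Q k" using Q(2)[OF k] by (auto simp: R_def)
          show "\<forall>i\<in>Q k - R k. ?\<Delta> i = 0"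
          proof
            fix i assume i: "i \<in> Q k - R k"
            then have iQ: "i \<in> Q k" and "interior i = {}" by (auto simp: R_def)
            note Di = division_of_realD(1,2)[OF Q(2)[OF k] iQ]
            have "interior {Inf i..Sup i} = {}" using \<open>interior i = {}\<close> by (subst (asm) Di(1)) 
            then have "Inf i = Sup i" using Di(2) by simp
            then show "?\<Delta> i = 0" by simp
          qed
        qed
        finally show ?thesis .
      qed
      have sub: "i \<subseteq> k" if "k \<in> d0" "i \<in> R k" for i k
      proof -
        have "i \<in> Q k" using that(2) by (simp add: R_def)
        then have "i \<subseteq> {Inf k..Sup k}" using division_ofD(2)[OF Q(2)[OF that(1)]] by blast
        then show ?thesis using division_of_realD(1)[OF d0(2) that(1)] by blast
      qed
      have disj: "R k \<inter> R k' = {}" if "k \<in> d0" "k' \<in> d0" "k \<noteq> k'" for k k'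
      proof (rule ccontr)
        assume "R k \<inter> R k' \<noteq> {}"
        then obtain i where i: "i \<in> R k" "i \<in> R k'" by blast
        have "interior i \<subseteq> interior k \<inter> interior k'"
          using sub[OF that(1) i(1)] sub[OF that(2) i(2)] by (simp add: interior_mono)
        then show False using division_ofD(5)[OF d0(2) that] i(1) by (auto simp: R_def)
      qed
      have D: "\<Union>(R ` d0) division_of \<Union>(\<Union>(R ` d0))"
      proof (rule division_of_Union)
        show "finite (R ` d0)" using fin0 by simp
        fix p assume "p \<in> R ` d0"
        then obtain k where k: "k \<in> d0" "p = R k" by blast
        have "p \<subseteq> Q k" using k(2) by (auto simp: R_def)
        then show "p division_of \<Union>p" using division_of_subset[OF division_of_union_self[OF Q(2)[OF k(1)]]] by blast
      next
        fix i j assume ij: "i \<in> \<Union>(R ` d0)" "j \<in> \<Union>(R ` d0)" "i \<noteq> j"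
        then obtain k l where kl: "k \<in> d0" "l \<in> d0" "i \<in> R k" "j \<in> R l" by blast
        show "interior i \<inter> interior j = {}"
        proof (cases "k = l")
          case True
          then have "i \<in> Q k" "j \<in> Q k" using kl by (auto simp: R_def)
          then show ?thesis using division_ofD(5)[OF Q(2)[OF kl(1)]] ij(3) by blast
        next
          case False
          have "interior i \<subseteq> interior k" "interior j \<subseteq> interior l"
            using sub kl by (simp_all add: interior_mono)
          then show ?thesis using division_ofD(5)[OF d0(2) kl(1,2) False] by blast
        qed
      qed
      have "\<Union>(\<Union>(R ` d0)) \<subseteq> {a..b}" using sub division_ofD(2)[OF d0(2)] by blast
      with D have "sum ?\<Delta> (\<Union>(R ` d0)) \<le> V"
        unfolding V_def by (intro cSup_upper bdd) (auto simp: W_def)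
      moreover have "sum ?\<Delta> (\<Union>(R ` d0)) = (\<Sum>k\<in>d0. sum ?\<Delta> (R k))"
      proof (rule sum.UNION_disjoint)
        show "finite d0" by (rule fin0)
        show "\<forall>k\<in>d0. finite (R k)"
          unfolding R_def using division_of_finite[OF Q(2)] by (intro ballI finite_Collect_conjI disjI1) simp
        show "\<forall>k\<in>d0. \<forall>k'\<in>d0. k \<noteq> k' \<longrightarrow> R k \<inter> R k' = {}" using disj by blast
      qed
      moreover have "(\<Sum>k\<in>d0. ?\<Delta> k + 2 * c * (\<Sum>i\<in>G k. snd i - fst i)) \<le> (\<Sum>k\<in>d0. sum ?\<Delta> (R k))"
        by (intro sum_mono gain)
      moreover have "(\<Sum>k\<in>d0. ?\<Delta> k + 2 * c * (\<Sum>i\<in>G k. snd i - fst i)) =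
        sum ?\<Delta> d0 + 2 * c * (\<Sum>i\<in>F. snd i - fst i)"
      proof -
        have "(\<Sum>k\<in>d0. \<Sum>i\<in>G k. snd i - fst i) = (\<Sum>i\<in>F. snd i - fst i)"
          unfolding G_def using F(1) fin0 \<kappa>(1) by (intro sum.group) auto
        then show ?thesis by (simp add: sum.distrib sum_distrib_left[symmetric])
      qed
      ultimately have "2 * c * (\<Sum>i\<in>F. snd i - fst i) < 2 * c * e" using near by linarith
      then show ?thesis using c by simp
    qed
    from vitali_cover_measure_le[OF pos small bound] obtain T where
      "E - Z \<subseteq> T" "T \<in> lmeasurable" "measure lebesgue T \<le> e" by blast
    then show ?thesis using fin0 by (intro exI[of _ Z] exI[of _ T]) (auto simp: Z_def)
  qed
  show ?thesis
    unfolding negligible_outer_le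
  proof (intro allI impI)
    fix e :: real assume "e > 0"
    from cover[OF this] obtain Z T where ZT: "finite Z" "E - Z \<subseteq> T" "T \<in> lmeasurable" "measure lebesgue T \<le> e"
      by blast
    have Z: "Z \<in> lmeasurable" "measure lebesgue Z = 0"
      using negligible_finite[OF ZT(1)] by (simp_all add: negligible_iff_measure)
    have "measure lebesgue (T \<union> Z) \<le> measure lebesgue T + measure lebesgue Z"
      using ZT Z by (intro measure_Un_le) (auto dest: fmeasurableD)
    then show "\<exists>T. E \<subseteq> T \<and> T \<in> lmeasurable \<and> measure lebesgue T \<le> e"
      using ZT Z by (intro exI[of _ "T \<union> Z"]) (auto intro: fmeasurable.Un)
  qed
qed

text \<open>Subtracting a line of slope \<open>m\<close> shifts all slopes by \<open>m\<close>.
  Slopes oscillating between two values then oscillate symmetrically about 0, the form that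
  \<open>negligible_oscillating\<close> treats.\<close>

lemma variation_le_add_linear:
  fixes h :: "real \<Rightarrow> real"
  assumes "variation_le {a..b} h B" "a \<le> b"
  shows "variation_le {a..b} (\<lambda>t. h t - m * t) (B + \<bar>m\<bar> * (b - a))"
  unfolding variation_le_def
proof (intro allI impI, elim conjE)
  fix d S assume d: "d division_of S" "S \<subseteq> {a..b}"
  have "(\<Sum>k\<in>d. norm (h (Sup k) - m * Sup k - (h (Inf k) - m * Inf k))) \<le>
    (\<Sum>k\<in>d. norm (h (Sup k) - h (Inf k)) + \<bar>m\<bar> * (Sup k - Inf k))"
  proof (rule sum_mono)
    fix k assume "k \<in> d"
    then have "Inf k \<le> Sup k" by (rule division_of_realD(2)[OF d(1)])
    then have "\<bar>m * (Sup k - Inf k)\<bar> = \<bar>m\<bar> * (Sup k - Inf k)" by (simp add: abs_mult)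
    moreover have "h (Sup k) - m * Sup k - (h (Inf k) - m * Inf k) =
      (h (Sup k) - h (Inf k)) - m * (Sup k - Inf k)" by (simp add: algebra_simps)
    ultimately show "norm (h (Sup k) - m * Sup k - (h (Inf k) - m * Inf k)) \<le>
      norm (h (Sup k) - h (Inf k)) + \<bar>m\<bar> * (Sup k - Inf k)"
      using abs_triangle_ineq4[of "h (Sup k) - h (Inf k)" "m * (Sup k - Inf k)"] by simp
  qed
  also have "\<dots> = (\<Sum>k\<in>d. norm (h (Sup k) - h (Inf k))) + \<bar>m\<bar> * (\<Sum>k\<in>d. Sup k - Inf k)"
    by (simp add: sum.distrib sum_distrib_left)
  also have "\<dots> \<le> B + \<bar>m\<bar> * (b - a)"
    using variation_leD[OF assms(1) d] sum_length_division_le[OF d assms(2)]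
    by (intro add_mono mult_left_mono) auto
  finally show "(\<Sum>k\<in>d. norm (h (Sup k) - m * Sup k - (h (Inf k) - m * Inf k))) \<le> B + \<bar>m\<bar> * (b - a)" .
qed

text \<open>If the lower limit of the difference quotients were below the upper one, two rationals
  would fit between them and contradict \<open>noosc\<close>. So the quotients converge in the
  extended reals, and \<open>bd\<close> makes the limit finite.\<close>

lemma real_differentiable_if_derivates:
  fixes h :: "real \<Rightarrow> real"
  defines "Q \<equiv> \<lambda>t s. (h s - h t) / (s - t)"
  assumes bd: "\<forall>\<^sub>F s in at t. \<bar>Q t s\<bar> \<le> B"
    and noosc: "\<And>p q::rat. p < q \<Longrightarrow>
      (\<forall>\<^sub>F s in at t. of_rat p \<le> Q t s) \<or> (\<forall>\<^sub>F s in at t. Q t s \<le> of_rat q)"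
  shows "h differentiable at t"
proof -
  let ?q = "\<lambda>s. ereal (Q t s)"
  have nt: "at t \<noteq> bot" by simp
  have "Limsup (at t) ?q \<le> Liminf (at t) ?q"
  proof (rule ccontr)
    assume "\<not> ?thesis"
    then have "Liminf (at t) ?q < Limsup (at t) ?q" by simp
    from ereal_dense3[OF this] obtain p :: rat where p: "Liminf (at t) ?q < real_of_rat p"
      "real_of_rat p < Limsup (at t) ?q" by blast
    from ereal_dense3[OF p(2)] obtain q :: rat where q: "ereal (real_of_rat p) < real_of_rat q"
      "real_of_rat q < Limsup (at t) ?q" by blast
    have "p < q" using q(1) by (simp add: of_rat_less)
    from noosc[OF this] show False
    proof
      assume "\<forall>\<^sub>F s in at t. of_rat p \<le> Q t s"
      then have "ereal (of_rat p) \<le> Liminf (at t) ?q" by (intro Liminf_bounded) simp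
      then show False using p(1) by simp
    next
      assume "\<forall>\<^sub>F s in at t. Q t s \<le> of_rat q"
      then have "Limsup (at t) ?q \<le> ereal (of_rat q)" by (intro Limsup_bounded) simp
      then show False using q(2) by simp
    qed
  qed
  then have eq: "Liminf (at t) ?q = Limsup (at t) ?q"
    using Liminf_le_Limsup[OF nt, of ?q] by simp
  define l where "l = Limsup (at t) ?q"
  have lim: "(?q \<longlongrightarrow> l) (at t)"
    using eq unfolding tendsto_iff_Liminf_eq_Limsup[OF nt] l_def by simp
  have "l \<le> ereal B" "ereal (-B) \<le> l"
  proof -
    show "l \<le> ereal B" unfolding l_def
      by (rule Limsup_bounded) (use bd in \<open>auto elim!: eventually_mono\<close>)
    show "ereal (-B) \<le> l" unfolding l_def eq[symmetric]
      by (rule Liminf_bounded) (use bd in \<open>auto elim!: eventually_mono\<close>)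
  qed
  then obtain r where "l = ereal r" by (cases l) auto
  with lim have "(Q t \<longlongrightarrow> r) (at t)" by simp
  then have "(h has_field_derivative r) (at t)"
    unfolding has_field_derivative_iff Q_def .
  then show ?thesis using real_differentiable_def by blast
qed

text \<open>At a point of non-differentiability, either arbitrarily short chords around it have
  unbounded slope, or their slopes keep falling below \<open>p\<close> and rising above
  \<open>q\<close> for some rationals \<open>p < q\<close>. Each case gives a null set, and there
  are countably many pairs of rationals.\<close>

lemma variation_le_differentiable:
  fixes h :: "real \<Rightarrow> real"
  assumes var: "variation_le {a..b} h B" and ab: "a \<le> b"
  shows "negligible {t \<in> {a<..<b}. \<not> h differentiable at t}"
proof -
  define N0 where "N0 = {t \<in> {a<..<b}. \<forall>l>0. \<forall>\<rho>>0. \<exists>p q. p < q \<and> a \<le> p \<and> q \<le> b \<and> p \<le> t \<and> t \<le> q \<and>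
       q - p < \<rho> \<and> l * (q - p) \<le> norm (h q - h p)}"
  define O' where "O' = (\<lambda>m c. {t \<in> {a<..<b}. \<forall>\<rho>>0. \<forall>s\<in>{-1, 1}. \<exists>p q. p < q \<and> p \<le> t \<and> t \<le> q \<and> q - p < \<rho> \<and>
       s * ((h q - m * q) - (h p - m * p)) \<le> - c * (q - p)})"
  have N0: "negligible N0" by (rule negligible_steep[OF var]) (auto simp: N0_def)
  have neg: "negligible (O' m c)" if c: "c > 0" for m c
  proof (rule negligible_oscillating[OF variation_le_add_linear[OF var ab] ab c])
    show "O' m c \<subseteq> {a..b}" by (auto simp: O'_def)
    fix t \<rho> s :: real assume "t \<in> O' m c" "0 < \<rho>" "s \<in> {-1, 1}"
    then show "\<exists>p q. p < q \<and> p \<le> t \<and> t \<le> q \<and> q - p < \<rho> \<and>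
       s * ((h q - m * q) - (h p - m * p)) \<le> - c * (q - p)" unfolding O'_def by blast
  qed
  \<comment> \<open>Midpoint and half the gap: slopes below \<open>p\<close> and above
    \<open>q\<close> become slopes below \<open>- c\<close> and above \<open>c\<close> after
    subtracting \<open>m\<close>.\<close>
  define m where "m = (\<lambda>p q::rat. (real_of_rat p + real_of_rat q) / 2)"
  define c where "c = (\<lambda>p q::rat. (real_of_rat q - real_of_rat p) / 2)"
  let ?O = "\<Union>z\<in>{z. fst z < snd z}. O' (m (fst z) (snd z)) (c (fst z) (snd z))"
  have "negligible (N0 \<union> ?O)"
  proof (intro negligible_Un N0 negligible_countable_Union)
    show "countable ((\<lambda>z. O' (m (fst z) (snd z)) (c (fst z) (snd z))) ` {z. fst z < snd z})"
      by (intro countable_image countableI_type)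
    fix S assume "S \<in> (\<lambda>z. O' (m (fst z) (snd z)) (c (fst z) (snd z))) ` {z. fst z < snd z}"
    then show "negligible S" by (auto simp: c_def of_rat_less intro!: neg)
  qed
  moreover have "{t \<in> {a<..<b}. \<not> h differentiable at t} \<subseteq> N0 \<union> ?O"
  proof
    fix t assume t: "t \<in> {t \<in> {a<..<b}. \<not> h differentiable at t}"
    show "t \<in> N0 \<union> ?O"
    proof (rule ccontr)
      assume no: "t \<notin> N0 \<union> ?O"
      let ?Q = "\<lambda>s. (h s - h t) / (s - t)"
      \<comment> \<open>A difference quotient at \<open>t\<close> is the slope of the interval
        between \<open>s\<close> and \<open>t\<close>, which has \<open>t\<close> as an endpoint and
        so is one of the intervals tested in \<open>N0\<close> and \<open>O'\<close>.\<close>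
      have freq: "\<exists>p q. p < q \<and> p \<le> t \<and> t \<le> q \<and> q - p < \<rho> \<and> h q - h p = ?Q s * (q - p)"
        if "s \<noteq> t" "\<bar>s - t\<bar> < \<rho>" for s \<rho>
      proof (cases "s < t")
        case True
        then show ?thesis using that by (intro exI[of _ s] exI[of _ t]) (auto simp: field_simps)
      next
        case False
        then show ?thesis using that by (intro exI[of _ t] exI[of _ s]) (auto simp: field_simps)
      qed
      have "t \<notin> N0" "t \<in> {a<..<b}" using no t by auto
      then obtain l r where lr: "l > 0" "r > 0" and
        nost: "\<And>p q. p < q \<Longrightarrow> a \<le> p \<Longrightarrow> q \<le> b \<Longrightarrow> p \<le> t \<Longrightarrow> t \<le> q \<Longrightarrow> q - p < r \<Longrightarrow>
          norm (h q - h p) < l * (q - p)"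
        unfolding N0_def mem_Collect_eq not_le[symmetric] by blast
      define \<rho> where "\<rho> = min r (min (t - a) (b - t))"
      have rho: "\<rho> > 0" using t lr by (auto simp: \<rho>_def)
      have cancel: "x < y" if "x * d < y * d" "d > 0" for x y d :: real using that by simp
      have abs_cancel: "\<bar>x\<bar> \<le> y" if "\<bar>x * d\<bar> < y * d" "d > 0" for x y d :: real
        using that by (simp add: abs_mult)
      have "h differentiable at t"
      proof (rule real_differentiable_if_derivates)
        have "\<bar>?Q s\<bar> \<le> l" if s: "s \<noteq> t" "dist s t < \<rho>" for s
        proof -
          obtain p q where pq: "p < q" "p \<le> t" "t \<le> q" "q - p < \<rho>" "h q - h p = ?Q s * (q - p)"
            using freq[of s \<rho>] s by (auto simp: dist_real_def)
          have "\<bar>?Q s * (q - p)\<bar> < l * (q - p)"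
            unfolding pq(5)[symmetric] using nost[of p q] pq by (auto simp: \<rho>_def)
          then show ?thesis by (rule abs_cancel) (use pq(1) in simp)
        qed
        then show "\<forall>\<^sub>F s in at t. \<bar>?Q s\<bar> \<le> l"
          unfolding eventually_at using rho by auto
      next
        fix p q :: rat assume pq: "p < q"
        have "t \<notin> O' (m p q) (c p q)" using no pq by auto
        then obtain \<rho>' s' where rs: "\<rho>' > 0" "s' \<in> {-1, 1::real}" and
          noosc: "\<And>u v. u < v \<Longrightarrow> u \<le> t \<Longrightarrow> t \<le> v \<Longrightarrow> v - u < \<rho>' \<Longrightarrow>
            - c p q * (v - u) < s' * ((h v - m p q * v) - (h u - m p q * u))"
          using \<open>t \<in> {a<..<b}\<close> unfolding O'_def mem_Collect_eq not_le[symmetric] by blast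
        have Qs: "- c p q < s' * (?Q s - m p q)" if s: "s \<noteq> t" "dist s t < \<rho>'" for s
        proof -
          obtain u v where uv: "u < v" "u \<le> t" "t \<le> v" "v - u < \<rho>'" "h v - h u = ?Q s * (v - u)"
            using freq[of s \<rho>'] s by (auto simp: dist_real_def)
          have "(h v - m p q * v) - (h u - m p q * u) = (h v - h u) - m p q * (v - u)"
            by (simp add: algebra_simps)
          also have "\<dots> = (?Q s - m p q) * (v - u)" unfolding uv(5) by (simp add: left_diff_distrib)
          finally have "- c p q * (v - u) < (s' * (?Q s - m p q)) * (v - u)"
            using noosc[OF uv(1-4)] by (simp add: mult.assoc)
          then show ?thesis by (rule cancel) (use uv(1) in simp)
        qed
        \<comment> \<open>For \<open>s' = 1\<close> the inequality in \<open>Qs\<close> bounds the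
          quotient below by \<open>m p q - c p q\<close>, for \<open>s' = - 1\<close> it bounds it
          above by \<open>m p q + c p q\<close>.\<close>
        have mc: "m p q - c p q = of_rat p" "m p q + c p q = of_rat q"
          by (simp_all add: m_def c_def field_simps)
        show "(\<forall>\<^sub>F s in at t. of_rat p \<le> ?Q s) \<or> (\<forall>\<^sub>F s in at t. ?Q s \<le> of_rat q)"
        proof (cases "s' = 1")
          case True
          then have "of_rat p \<le> ?Q s" if "s \<noteq> t" "dist s t < \<rho>'" for s
            using Qs[OF that] mc by simp
          then show ?thesis unfolding eventually_at using rs(1) by blast
        next
          case False
          then have "?Q s \<le> of_rat q" if "s \<noteq> t" "dist s t < \<rho>'" for s
            using Qs[OF that] mc rs(2) by simp
          then show ?thesis unfolding eventually_at using rs(1) by blast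
        qed
      qed
      then show False using t by simp
    qed
  qed
  ultimately show ?thesis by (rule negligible_subset)
qed

section \<open>Derivatives of absolutely continuous functions\<close>

text \<open>The \<delta> belonging to \<epsilon> = 1 bounds the variation on every shorter interval.
  Local bounds suffice, because null sets and integrability are glued over short intervals by
  bisection.\<close>

lemma abs_cont_local_variation:
  assumes "abs_cont_on {a..b} h"
  obtains \<delta> where "\<delta> > 0"
    "\<And>u v. {u..v} \<subseteq> {a..b} \<Longrightarrow> u \<le> v \<Longrightarrow> v - u < \<delta> \<Longrightarrow> variation_le {u..v} h 1"
proof -
  from abs_cont_onD[OF assms zero_less_one] obtain \<delta> where d: "\<delta> > 0"
    "\<And>d S. d division_of S \<Longrightarrow> S \<subseteq> {a..b} \<Longrightarrow> (\<Sum>k\<in>d. Sup k - Inf k) < \<delta> \<Longrightarrow>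
        (\<Sum>k\<in>d. norm (h (Sup k) - h (Inf k))) < 1" by blast
  have "variation_le {u..v} h 1" if uv: "{u..v} \<subseteq> {a..b}" "u \<le> v" "v - u < \<delta>" for u v
    unfolding variation_le_def
  proof (intro allI impI, elim conjE)
    fix d S assume dS: "d division_of S" "S \<subseteq> {u..v}"
    have "(\<Sum>k\<in>d. Sup k - Inf k) < \<delta>" using sum_length_division_le[OF dS uv(2)] uv(3) by simp
    then show "(\<Sum>k\<in>d. norm (h (Sup k) - h (Inf k))) \<le> 1"
      using d(2)[OF dS(1)] dS(2) uv(1) by (meson less_imp_le order_trans)
  qed
  with d(1) show ?thesis by (rule that)
qed

text \<open>Coordinates reduce the claim to real functions of bounded variation; the exceptional
  sets of short intervals are then joined together with the separating points.\<close>

lemma abs_cont_differentiable_ae: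
  fixes h :: "real \<Rightarrow> 'a::euclidean_space"
  assumes ac: "abs_cont_on {a..b} h" and ab: "a \<le> b"
  shows "negligible {t \<in> {a<..<b}. \<not> h differentiable at t}"
proof -
  let ?N = "\<lambda>u v. {t \<in> {u<..<v}. \<not> h differentiable at t}"
  from abs_cont_local_variation[OF ac] obtain \<delta> where d: "\<delta> > 0"
    "\<And>u v. {u..v} \<subseteq> {a..b} \<Longrightarrow> u \<le> v \<Longrightarrow> v - u < \<delta> \<Longrightarrow> variation_le {u..v} h 1" by blast
  have loc: "negligible (?N u v)" if uv: "{u..v} \<subseteq> {a..b}" "u \<le> v" "v - u < \<delta>" for u v
  proof -
    have "negligible {t \<in> {u<..<v}. \<not> (\<lambda>t. h t \<bullet> i) differentiable at t}" if i: "i \<in> Basis" for i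
    proof (rule variation_le_differentiable[OF _ uv(2), of _ 1])
      show "variation_le {u..v} (\<lambda>t. h t \<bullet> i) 1"
        unfolding variation_le_def
      proof (intro allI impI, elim conjE)
        fix d S assume dS: "d division_of S" "S \<subseteq> {u..v}"
        have "(\<Sum>k\<in>d. norm (h (Sup k) \<bullet> i - h (Inf k) \<bullet> i)) \<le> (\<Sum>k\<in>d. norm (h (Sup k) - h (Inf k)))"
          unfolding inner_diff_left[symmetric] real_norm_def by (intro sum_mono Basis_le_norm i)
        also have "\<dots> \<le> 1" by (rule variation_leD[OF d(2)[OF uv] dS])
        finally show "(\<Sum>k\<in>d. norm (h (Sup k) \<bullet> i - h (Inf k) \<bullet> i)) \<le> 1" .
      qed
    qed
    then have "negligible (\<Union>i\<in>Basis. {t \<in> {u<..<v}. \<not> (\<lambda>t. h t \<bullet> i) differentiable at t})"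
      by (intro negligible_Union) auto
    then show ?thesis
      by (rule negligible_subset) (auto simp: differentiable_componentwise_within[of h])
  qed
  \<comment> \<open>\<open>A\<close> stays fixed while the bisection varies the endpoints; otherwise
    the hypothesis would change with them.\<close>
  define A where "A = {a..b}"
  have "{a..b} \<subseteq> A \<longrightarrow> negligible (?N a b)"
    using ab
  proof (induction rule: Bolzano)
    case (trans u v w)
    show ?case
    proof
      assume "{u..w} \<subseteq> A"
      with trans have "negligible (?N u v \<union> ?N v w \<union> {v})"
        by (intro negligible_Un negligible_sing) auto
      then show "negligible (?N u w)" by (rule negligible_subset) auto
    qed
  next
    case (local x)
    then show ?case using loc d(1) unfolding A_def by (intro exI[of _ \<delta>]) auto
  qed
  then show ?thesis by (simp add: A_def)
qed

text \<open>The integral of \<open>\<phi>\<close> over a cell is the increment of \<open>h\<close>,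
  so on a short interval the sums of the norms of these integrals are variation sums bounded by 1.
  Bounded variation of the indefinite integral gives absolute integrability.\<close>

lemma abs_cont_derivative_absolutely_integrable:
  fixes h \<phi> :: "real \<Rightarrow> 'a::euclidean_space"
  assumes ac: "abs_cont_on {a..b} h" and ab: "a \<le> b" and N: "negligible N"
    and der: "\<And>t. t \<in> {a..b} - N \<Longrightarrow> (h has_vector_derivative \<phi> t) (at t within {a..b})"
  shows "\<phi> absolutely_integrable_on {a..b}"
proof -
  from abs_cont_local_variation[OF ac] obtain \<delta> where d: "\<delta> > 0"
    "\<And>u v. {u..v} \<subseteq> {a..b} \<Longrightarrow> u \<le> v \<Longrightarrow> v - u < \<delta> \<Longrightarrow> variation_le {u..v} h 1" by blast
  have int: "(\<phi> has_integral h v - h u) {u..v}" if uv: "{u..v} \<subseteq> {a..b}" "u \<le> v" for u v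
    by (rule abs_cont_has_integral[OF abs_cont_on_subset[OF ac uv(1)] uv(2) N])
      (use der uv has_vector_derivative_within_subset in blast)
  have loc: "\<phi> absolutely_integrable_on {u..v}" if uv: "{u..v} \<subseteq> {a..b}" "u \<le> v" "v - u < \<delta>" for u v
  proof -
    have "\<phi> absolutely_integrable_on cbox u v"
    proof (rule bounded_variation_absolutely_integrable_interval[where B=1])
      show "\<phi> integrable_on cbox u v" using int[OF uv(1,2)] by auto
      fix q assume q: "q division_of cbox u v"
      have "norm (integral k \<phi>) = norm (h (Sup k) - h (Inf k))" if k: "k \<in> q" for k
      proof -
        note D = division_of_realD[OF q k]
        have "(\<phi> has_integral h (Sup k) - h (Inf k)) {Inf k..Sup k}"
          using D uv by (intro int) auto
        then have "integral k \<phi> = h (Sup k) - h (Inf k)" by (subst D(1)) (rule integral_unique)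
        then show ?thesis by simp
      qed
      then have "(\<Sum>k\<in>q. norm (integral k \<phi>)) = (\<Sum>k\<in>q. norm (h (Sup k) - h (Inf k)))" by simp
      also have "\<dots> \<le> 1" using variation_leD[OF d(2)[OF uv], of q "cbox u v"] q by simp
      finally show "(\<Sum>k\<in>q. norm (integral k \<phi>)) \<le> 1" .
    qed
    then show ?thesis by simp
  qed
  define A where "A = {a..b}"
  have "{a..b} \<subseteq> A \<longrightarrow> \<phi> absolutely_integrable_on {a..b}"
    using ab
  proof (induction rule: Bolzano)
    case (trans u v w)
    show ?case
    proof
      assume "{u..w} \<subseteq> A"
      with trans have "\<phi> absolutely_integrable_on {u..v}" "\<phi> absolutely_integrable_on {v..w}" by auto
      then show "\<phi> absolutely_integrable_on {u..w}"
        using trans(3,4) by (rule absolutely_integrable_on_combine)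
    qed
  next
    case (local x)
    then show ?case using loc d(1) unfolding A_def by (intro exI[of _ \<delta>]) auto
  qed
  then show ?thesis by (simp add: A_def)
qed

subsection \<open>Continuous approximation, Gronwall inequalities and the Picard theorem\<close>

lemma integrable_lebesgue_on_Icc:
  fixes f :: "real \<Rightarrow> 'a::euclidean_space"
  shows "integrable (lebesgue_on {a..b}) f \<longleftrightarrow> f absolutely_integrable_on {a..b}"
  by (simp add: integrable_restrict_space set_integrable_def)

text \<open>\<open>A\<close> is squeezed between a closed \<open>T\<close> and an open
  \<open>U\<close>; a Urysohn function that is 1 on \<open>T\<close> and 0 outside \<open>U\<close>
  differs from the indicator only on \<open>(U - A) \<union> (A - T)\<close>, a set of small
  measure.\<close>

lemma approx_indicator_continuous:
  fixes A :: "real set" and c :: "'a::euclidean_space"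
  assumes A: "A \<in> sets (lebesgue_on {a..b})" and e: "e > 0"
  shows "\<exists>g. continuous_on UNIV g \<and>
    (\<integral>x. norm (indicator A x *\<^sub>R c - g x) \<partial>lebesgue_on {a..b}) < e"
proof -
  have AL: "A \<in> sets lebesgue" using A by (auto simp: sets_restrict_space)
  \<comment> \<open>The exceptional set has measure below \<open>2 * \<eta>\<close> and the
    integrand is at most \<open>norm c\<close> on it; the \<open>+ 1\<close> takes care of
    \<open>c = 0\<close>.\<close>
  define \<eta> where "\<eta> = e / (2 * (norm c + 1))"
  have eta: "\<eta> > 0" using e by (simp add: \<eta>_def add_nonneg_pos)
  from sets_lebesgue_outer_open[OF AL eta] obtain U where U: "open U" "A \<subseteq> U"
    "U - A \<in> lmeasurable" "emeasure lebesgue (U - A) < ennreal \<eta>" by blast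
  from sets_lebesgue_inner_closed[OF AL eta] obtain T where T: "closed T" "T \<subseteq> A"
    "A - T \<in> lmeasurable" "emeasure lebesgue (A - T) < ennreal \<eta>" by blast
  have "closed (- U)" "- U \<inter> T = {}" using U(1,2) T(2) by auto
  from Urysohn[OF this(1) T(1) this(2), of 0 "1::real"] obtain g :: "real \<Rightarrow> real" where g: "continuous_on UNIV g"
    "\<And>x. g x \<in> closed_segment 0 1" "\<And>x. x \<in> - U \<Longrightarrow> g x = 0" "\<And>x. x \<in> T \<Longrightarrow> g x = 1" by blast
  have g01: "0 \<le> g x" "g x \<le> 1" for x using g(2)[of x] by (auto simp: closed_segment_eq_real_ivl)
  define D where "D = (U - A) \<union> (A - T)"
  have D: "D \<in> lmeasurable" unfolding D_def using U(3) T(3) by (intro fmeasurable.Un)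
  have "measure lebesgue D \<le> measure lebesgue (U - A) + measure lebesgue (A - T)"
    unfolding D_def using U(3) T(3) by (intro measure_Un_le) (auto dest: fmeasurableD)
  moreover have "measure lebesgue (U - A) < \<eta>" "measure lebesgue (A - T) < \<eta>"
    using U(3,4) T(3,4) eta by (simp_all add: emeasure_eq_measure2 ennreal_less_iff)
  ultimately have mD: "measure lebesgue D < 2 * \<eta>" by simp
  have pt: "norm (indicator A x *\<^sub>R c - g x *\<^sub>R c) \<le> indicator D x * norm c" for x
  proof -
    have "\<bar>indicator A x - g x\<bar> \<le> indicator D x"
      using g01[of x] g(3,4)[of x] U(2) T(2) unfolding D_def by (auto simp: indicator_def)
    then have "\<bar>indicator A x - g x\<bar> * norm c \<le> indicator D x * norm c" by (intro mult_right_mono) auto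
    then show ?thesis by (simp add: scaleR_diff_left[symmetric])
  qed
  have "integrable lebesgue (\<lambda>x. indicator D x * norm c :: real)"
    by (intro integrable_mult_left integrable_real_indicator) (use D in \<open>auto simp: fmeasurable_def\<close>)
  then have iDU: "(\<lambda>x. indicator D x * norm c :: real) absolutely_integrable_on UNIV"
    by (simp add: set_integrable_def)
  have iD: "integrable (lebesgue_on {a..b}) (\<lambda>x. indicator D x * norm c :: real)"
    unfolding integrable_lebesgue_on_Icc by (rule set_integrable_subset[OF iDU]) auto
  have cg: "continuous_on UNIV (\<lambda>x. g x *\<^sub>R c)" using g(1) by (intro continuous_intros)
  have ig: "integrable (lebesgue_on {a..b}) (\<lambda>x. g x *\<^sub>R c)" unfolding integrable_lebesgue_on_Icc
    by (intro absolutely_integrable_continuous_real continuous_on_subset[OF cg]) auto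
  have iA: "integrable (lebesgue_on {a..b}) (\<lambda>x. indicator A x *\<^sub>R c)"
  proof (intro integrable_scaleR_left integrable_real_indicator A)
    have sub: "A \<subseteq> {a..b}" using A by (auto simp: sets_restrict_space)
    then have "emeasure (lebesgue_on {a..b}) A = emeasure lebesgue A"
      by (intro emeasure_restrict_space) simp_all
    also have "\<dots> \<le> emeasure lebesgue {a..b}" by (rule emeasure_mono[OF sub]) simp
    also have "\<dots> < \<infinity>" using fmeasurableD2[OF lmeasurable_cbox[of a b]] by (simp add: less_top)
    finally show "emeasure (lebesgue_on {a..b}) A < \<infinity>" .
  qed
  have "(\<integral>x. norm (indicator A x *\<^sub>R c - g x *\<^sub>R c) \<partial>lebesgue_on {a..b}) \<le>
      (\<integral>x. indicator D x * norm c \<partial>lebesgue_on {a..b})"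
    using ig iA iD by (intro integral_mono pt) auto
  also have "\<dots> = integral {a..b} (\<lambda>x. indicator D x * norm c)"
    by (rule lebesgue_integral_eq_integral[OF iD]) simp
  also have "\<dots> \<le> integral UNIV (\<lambda>x. indicator D x * norm c)"
    using iD iDU unfolding integrable_lebesgue_on_Icc
    by (intro integral_subset_le set_lebesgue_integral_eq_integral(1)) auto
  also have "\<dots> = measure lebesgue D * norm c"
    using D by (simp add: lmeasure_integral_UNIV)
  also have "\<dots> \<le> 2 * \<eta> * norm c" using mD by (intro mult_right_mono) auto
  also have "\<dots> < 2 * \<eta> * (norm c + 1)" using eta by simp
  also have "\<dots> = e"
  proof -
    have "norm c + 1 \<noteq> 0" using norm_ge_zero[of c] by linarith
    moreover have "2 * (e / (2 * n)) * n = e" if "n \<noteq> 0" for n :: real using that by simp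
    ultimately show ?thesis unfolding \<eta>_def by blast
  qed
  finally show ?thesis using cg by blast
qed

text \<open>Approximability in mean holds for indicators and survives sums and dominated limits, the
  operations from which integrable functions are built.\<close>

lemma absolutely_integrable_approx_continuous:
  fixes f :: "real \<Rightarrow> 'a::euclidean_space"
  assumes f: "f absolutely_integrable_on {a..b}" and e: "e > 0"
  obtains g where "continuous_on UNIV g" "integral {a..b} (\<lambda>x. norm (f x - g x)) < e"
proof -
  let ?M = "lebesgue_on {a..b}"
  have ic: "integrable ?M g" if "continuous_on UNIV g" for g :: "real \<Rightarrow> 'a"
    unfolding integrable_lebesgue_on_Icc
    by (intro absolutely_integrable_continuous_real continuous_on_subset[OF that]) auto
  have "integrable ?M f" using f by (simp add: integrable_lebesgue_on_Icc)
  then have "\<forall>e>0. \<exists>g. continuous_on UNIV g \<and> (\<integral>x. norm (f x - g x) \<partial>?M) < e"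
  proof (induction rule: integrable_induct)
    case (base A c)
    then show ?case using approx_indicator_continuous by blast
  next
    case (add f1 f2)
    show ?case
    proof (intro allI impI)
      fix e :: real assume "e > 0"
      then have "e / 2 > 0" by simp
      with add obtain g1 g2 where g: "continuous_on UNIV g1" "(\<integral>x. norm (f1 x - g1 x) \<partial>?M) < e / 2"
        "continuous_on UNIV g2" "(\<integral>x. norm (f2 x - g2 x) \<partial>?M) < e / 2" by meson
      note i = ic[OF g(1)] ic[OF g(3)] add.hyps
      have "(\<integral>x. norm (f1 x + f2 x - (g1 x + g2 x)) \<partial>?M) \<le> (\<integral>x. norm (f1 x - g1 x) + norm (f2 x - g2 x) \<partial>?M)"
        using i by (intro integral_mono) (auto simp: norm_diff_triangle_ineq)
      also have "\<dots> = (\<integral>x. norm (f1 x - g1 x) \<partial>?M) + (\<integral>x. norm (f2 x - g2 x) \<partial>?M)"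
        using i by (intro Bochner_Integration.integral_add) auto
      also have "\<dots> < e" using g by simp
      finally show "\<exists>g. continuous_on UNIV g \<and> (\<integral>x. norm (f1 x + f2 x - g x) \<partial>?M) < e"
        using g by (intro exI[of _ "\<lambda>x. g1 x + g2 x"]) (auto intro!: continuous_intros)
    qed
  next
    case (lim f s)
    show ?case
    proof (intro allI impI)
      fix e :: real assume "e > 0"
      have mf: "f \<in> borel_measurable ?M" and ms: "\<And>i. s i \<in> borel_measurable ?M"
        using lim.hyps by auto
      have "(\<lambda>i. \<integral>x. norm (f x - s i x) \<partial>?M) \<longlonglongrightarrow> (\<integral>x. 0 \<partial>?M)"
      \<comment> \<open>The approximants supplied by the induction satisfy
        \<open>norm (s i x) \<le> 2 * norm (f x)\<close>, so the differences are dominated by three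
        times the norm of \<open>f\<close>.\<close>
      proof (rule integral_dominated_convergence[where w="\<lambda>x. 3 * norm (f x)"])
        show "AE x in ?M. (\<lambda>i. norm (f x - s i x)) \<longlonglongrightarrow> 0"
        proof (rule AE_I2)
          fix x assume "x \<in> space ?M"
          then have "(\<lambda>i. s i x) \<longlonglongrightarrow> f x" by (rule lim.hyps)
          then have "(\<lambda>i. norm (f x - s i x)) \<longlonglongrightarrow> norm (f x - f x)" by (intro tendsto_intros)
          then show "(\<lambda>i. norm (f x - s i x)) \<longlonglongrightarrow> 0" by simp
        qed
        show "AE x in ?M. norm (norm (f x - s i x)) \<le> 3 * norm (f x)" for i
        proof (rule AE_I2)
          fix x assume "x \<in> space ?M"
          then have "norm (s i x) \<le> 2 * norm (f x)" by (rule lim.hyps)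
          then show "norm (norm (f x - s i x)) \<le> 3 * norm (f x)"
            using norm_triangle_ineq4[of "f x" "s i x"] by simp
        qed
      qed (use lim.hyps mf ms in \<open>auto intro!: borel_measurable_norm borel_measurable_diff\<close>)
      then have "(\<lambda>i. \<integral>x. norm (f x - s i x) \<partial>?M) \<longlonglongrightarrow> 0" by simp
      then have "\<forall>\<^sub>F i in sequentially. (\<integral>x. norm (f x - s i x) \<partial>?M) < e / 2"
        by (rule order_tendstoD) (use \<open>e > 0\<close> in simp)
      then obtain i where i: "(\<integral>x. norm (f x - s i x) \<partial>?M) < e / 2"
        using eventually_happens'[OF sequentially_bot] by blast
      have "e / 2 > 0" using \<open>e > 0\<close> by simp
      with lim.IH[of i] obtain g where g: "continuous_on UNIV g" "(\<integral>x. norm (s i x - g x) \<partial>?M) < e / 2"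
        by blast
      note int = ic[OF g(1)] lim.hyps
      have "(\<integral>x. norm (f x - g x) \<partial>?M) \<le> (\<integral>x. norm (f x - s i x) + norm (s i x - g x) \<partial>?M)"
        using int by (intro integral_mono) (auto intro: norm_diff_triangle_le)
      also have "\<dots> = (\<integral>x. norm (f x - s i x) \<partial>?M) + (\<integral>x. norm (s i x - g x) \<partial>?M)"
        using int by (intro Bochner_Integration.integral_add) auto
      also have "\<dots> < e" using g i by simp
      finally show "\<exists>g. continuous_on UNIV g \<and> (\<integral>x. norm (f x - g x) \<partial>?M) < e" using g by blast
    qed
  qed
  then obtain g where g: "continuous_on UNIV g" "(\<integral>x. norm (f x - g x) \<partial>?M) < e" using e by blast
  have "integrable ?M (\<lambda>x. norm (f x - g x))"
    using \<open>integrable ?M f\<close> ic[OF g(1)] by auto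
  then have "(\<integral>x. norm (f x - g x) \<partial>?M) = integral {a..b} (\<lambda>x. norm (f x - g x))"
    by (rule lebesgue_integral_eq_integral) simp
  with g show ?thesis using that by metis
qed

section \<open>Gronwall inequalities\<close>

text \<open>With \<open>R\<close> the right-hand side of \<open>le\<close> and \<open>M\<close> the
  primitive of \<open>m\<close>, the product of \<open>R\<close> and \<open>exp (- M)\<close> has
  derivative \<open>m * exp (- M) * (\<phi> - R) \<le> 0\<close>. Continuity of \<open>m\<close>
  makes both factors differentiable at every interior point.\<close>

lemma gronwall_continuous:
  fixes \<phi> m :: "real \<Rightarrow> real"
  assumes cont: "continuous_on {0..T} \<phi>" "continuous_on {0..T} m"
    and m0: "\<And>s. s \<in> {0..T} \<Longrightarrow> 0 \<le> m s"
    and le: "\<And>t. t \<in> {0..T} \<Longrightarrow> \<phi> t \<le> c + integral {0..t} (\<lambda>s. m s * \<phi> s)"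
    and t: "t \<in> {0..T}"
  shows "\<phi> t \<le> c * exp (integral {0..t} m)"
proof -
  define R where "R = (\<lambda>t. c + integral {0..t} (\<lambda>s. m s * \<phi> s))"
  define M where "M = (\<lambda>t. integral {0..t} m)"
  have cm: "continuous_on {0..T} (\<lambda>s. m s * \<phi> s)" using cont by (intro continuous_intros)
  have cR: "continuous_on {0..T} R" unfolding R_def
    by (intro continuous_intros indefinite_integral_continuous_1 integrable_continuous_real cm)
  have cM: "continuous_on {0..T} M" unfolding M_def
    by (intro indefinite_integral_continuous_1 integrable_continuous_real cont)
  have "R t * exp (- M t) \<le> R 0 * exp (- M 0)"
  proof (rule DERIV_nonpos_imp_decreasing_open[where f="\<lambda>t. R t * exp (- M t)"])
    show "0 \<le> t" using t by simp
    show "continuous_on {0..t} (\<lambda>t. R t * exp (- M t))"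
      using t by (intro continuous_intros continuous_on_subset[OF cR] continuous_on_subset[OF cM]) auto
    fix x assume x: "0 < x" "x < t"
    then have xT: "x \<in> {0..T}" "x \<in> {0<..<T}" using t by auto
    have at: "at x within {0..T} = at x" using xT(2) by (simp add: at_within_Icc_at)
    have "(R has_real_derivative m x * \<phi> x) (at x)"
      using integral_has_real_derivative[OF cm xT(1)] unfolding at R_def
      by (auto intro!: derivative_eq_intros)
    moreover have "(M has_real_derivative m x) (at x)"
      using integral_has_real_derivative[OF cont(2) xT(1)] unfolding at M_def .
    ultimately have "((\<lambda>t. R t * exp (- M t)) has_real_derivative
        (m x * \<phi> x) * exp (- M x) + R x * (exp (- M x) * - m x)) (at x)"
      by (auto intro!: derivative_eq_intros)
    moreover have "(m x * \<phi> x) * exp (- M x) + R x * (exp (- M x) * - m x) = m x * exp (- M x) * (\<phi> x - R x)"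
      by (simp add: algebra_simps)
    moreover have "\<dots> \<le> 0"
      using m0[OF xT(1)] le[OF xT(1)] by (intro mult_nonneg_nonpos) (auto simp: R_def)
    ultimately show "\<exists>y. ((\<lambda>t. R t * exp (- M t)) has_real_derivative y) (at x) \<and> y \<le> 0" by auto
  qed
  then have "R t * exp (- M t) \<le> c" by (simp add: R_def M_def)
  then have "R t * exp (- M t) * exp (M t) \<le> c * exp (M t)" by (intro mult_right_mono) auto
  then have "R t \<le> c * exp (M t)" by (simp add: mult.assoc exp_add[symmetric])
  then show ?thesis using le[OF t] by (simp add: R_def M_def)
qed

text \<open>The primitive of a merely integrable \<open>m\<close> may fail to be differentiable at
  some points, so \<open>m\<close> is replaced by the absolute value of a continuous function close
  to it in mean. The error, at most \<open>B * \<epsilon>\<close>, enters as the constant of the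
  continuous inequality and tends to 0.\<close>

lemma gronwall_absolutely_integrable:
  fixes \<phi> m :: "real \<Rightarrow> real"
  assumes cont: "continuous_on {0..T} \<phi>" and m: "m absolutely_integrable_on {0..T}"
    and m0: "\<And>s. s \<in> {0..T} \<Longrightarrow> 0 \<le> m s" and p0: "\<And>s. s \<in> {0..T} \<Longrightarrow> 0 \<le> \<phi> s"
    and le: "\<And>t. t \<in> {0..T} \<Longrightarrow> \<phi> t \<le> integral {0..t} (\<lambda>s. m s * \<phi> s)"
    and t: "t \<in> {0..T}"
  shows "\<phi> t = 0"
proof -
  have "bounded (\<phi> ` {0..T})" by (intro compact_imp_bounded compact_continuous_image cont) auto
  then obtain B where B: "B > 0" "\<And>s. s \<in> {0..T} \<Longrightarrow> \<bar>\<phi> s\<bar> \<le> B"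
    by (auto simp: bounded_pos)
  \<comment> \<open>As the mean error is at most 1, the integral of the approximating weight exceeds
    that of \<open>m\<close> by at most 1; the final bound is then
    \<open>\<epsilon> * C\<close>.\<close>
  define C where "C = B * exp (integral {0..T} m + 1)"
  have "\<phi> t \<le> 0 + e" if e: "e > 0" for e
  proof -
    define \<epsilon> where "\<epsilon> = min 1 (e / C)"
    have C: "C > 0" using B(1) by (simp add: C_def)
    have eps: "\<epsilon> > 0" "\<epsilon> \<le> 1" "\<epsilon> * C \<le> e" using e C by (auto simp: \<epsilon>_def min_def field_simps)
    from absolutely_integrable_approx_continuous[OF m eps(1)] obtain g where
      g: "continuous_on UNIV g" "integral {0..T} (\<lambda>x. norm (m x - g x)) < \<epsilon>" by blast
    define n where "n = (\<lambda>x. \<bar>g x\<bar>)"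
    have cn: "continuous_on UNIV n" unfolding n_def using g(1) by (intro continuous_intros)
    have cnT: "continuous_on S n" for S by (rule continuous_on_subset[OF cn]) auto
    have gi: "g absolutely_integrable_on {0..T}"
      by (intro absolutely_integrable_continuous_real continuous_on_subset[OF g(1)]) auto
    have di: "(\<lambda>x. norm (m x - g x)) integrable_on {0..T}"
      using absolutely_integrable_norm[OF set_integral_diff(1)[OF m gi]]
      by (simp add: o_def set_lebesgue_integral_eq_integral(1))
    have "\<phi> t \<le> (B * \<epsilon>) * exp (integral {0..t} n)"
    proof (rule gronwall_continuous[OF cont cnT])
      show "0 \<le> n s" for s by (simp add: n_def)
      show "t \<in> {0..T}" by fact
      fix r assume r: "r \<in> {0..T}"
      have sub: "{0..r} \<subseteq> {0..T}" using r by auto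
      note ir = integrable_on_subinterval[OF _ sub]
      have mphi: "(\<lambda>s. m s * \<phi> s) integrable_on {0..r}"
      proof (rule ir)
        have "(\<lambda>s. \<phi> s * m s) absolutely_integrable_on {0..T}"
          by (intro absolutely_integrable_bounded_measurable_product_real m
              compact_imp_bounded compact_continuous_image continuous_imp_measurable_on_sets_lebesgue cont) auto
        then show "(\<lambda>s. m s * \<phi> s) integrable_on {0..T}"
          by (simp add: mult.commute set_lebesgue_integral_eq_integral(1))
      qed
      have nphi: "(\<lambda>s. n s * \<phi> s) integrable_on {0..r}"
        by (intro integrable_continuous_real continuous_intros cnT continuous_on_subset[OF cont sub])
      have Bd: "(\<lambda>s. B * norm (m s - g s)) integrable_on {0..r}"
        by (intro integrable_on_mult_right ir di)
      have "\<phi> r \<le> integral {0..r} (\<lambda>s. m s * \<phi> s)" by (rule le[OF r])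
      also have "\<dots> \<le> integral {0..r} (\<lambda>s. B * norm (m s - g s) + n s * \<phi> s)"
      proof (rule integral_le[OF mphi integrable_add[OF Bd nphi]])
        fix s assume "s \<in> {0..r}"
        then have s: "s \<in> {0..T}" using sub by auto
        have "m s * \<phi> s \<le> (norm (m s - g s) + n s) * \<phi> s"
          using p0[OF s] by (intro mult_right_mono) (auto simp: n_def)
        also have "\<dots> \<le> B * norm (m s - g s) + n s * \<phi> s"
          using B(2)[OF s] mult_right_mono[of "\<phi> s" B "norm (m s - g s)"]
          by (simp add: algebra_simps)
        finally show "m s * \<phi> s \<le> B * norm (m s - g s) + n s * \<phi> s" .
      qed
      also have "\<dots> = B * integral {0..r} (\<lambda>s. norm (m s - g s)) + integral {0..r} (\<lambda>s. n s * \<phi> s)"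
        by (subst integral_add[OF Bd nphi]) simp
      also have "integral {0..r} (\<lambda>s. norm (m s - g s)) \<le> \<epsilon>"
        using integral_subset_le[OF sub ir[OF di] di] g(2) by simp
      finally show "\<phi> r \<le> B * \<epsilon> + integral {0..r} (\<lambda>s. n s * \<phi> s)" using B(1) by simp
    qed
    also have "integral {0..t} n \<le> integral {0..T} n"
      using t cnT by (intro integral_subset_le integrable_continuous_real) (auto simp: n_def)
    also have "integral {0..T} n \<le> integral {0..T} (\<lambda>s. m s + norm (m s - g s))"
    proof (rule integral_le)
      show "n integrable_on {0..T}" by (intro integrable_continuous_real cnT)
      show "(\<lambda>s. m s + norm (m s - g s)) integrable_on {0..T}"
        by (intro integrable_add di set_lebesgue_integral_eq_integral(1) m)
      show "n s \<le> m s + norm (m s - g s)" if "s \<in> {0..T}" for s using m0[OF that] by (simp add: n_def)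
    qed
    also have "\<dots> = integral {0..T} m + integral {0..T} (\<lambda>s. norm (m s - g s))"
      using m di by (intro integral_add) (auto simp: set_lebesgue_integral_eq_integral(1))
    also have "\<dots> \<le> integral {0..T} m + 1" using g(2) eps by simp
    finally have "\<phi> t \<le> (B * \<epsilon>) * exp (integral {0..T} m + 1)" using B eps by simp
    also have "\<dots> = \<epsilon> * C" by (simp add: C_def)
    finally show ?thesis using eps(3) by simp
  qed
  then have "\<phi> t \<le> 0" by (rule field_le_epsilon)
  then show ?thesis using p0[OF t] by simp
qed

text \<open>The weight \<open>exp (- 2 c t)\<close> makes the Picard operator a contraction on the whole of
  \<open>[0, T]\<close>.\<close>

lemma integral_equation_exists:
  fixes F :: "real \<Rightarrow> 'a::euclidean_space \<Rightarrow> 'a"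
  assumes T: "0 \<le> T" and K: "0 \<le> K"
    and cont: "\<And>z. continuous_on {0..T} z \<Longrightarrow> continuous_on {0..T} (\<lambda>s. F s (z s))"
    and lip: "\<And>s x x'. s \<in> {0..T} \<Longrightarrow> norm (F s x - F s x') \<le> K * norm (x - x')"
  obtains z where "continuous_on {0..T} z"
    "\<And>t. t \<in> {0..T} \<Longrightarrow> z t = x0 + integral {0..t} (\<lambda>s. F s (z s))"
proof -
  \<comment> \<open>A positive \<open>c \<ge> K\<close> gives the contraction factor
    \<open>K / (2 * c) \<le> 1 / 2\<close>; adding 1 covers \<open>K = 0\<close>.\<close>
  define c where "c = K + 1"
  have c: "c > 0" "K \<le> c" using K by (auto simp: c_def)
  \<comment> \<open>\<open>W\<close> is the Picard operator for the solution multiplied by the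
    weight, so that the weighted norm becomes the ordinary supremum norm.\<close>
  define W where "W = (\<lambda>(z::real \<Rightarrow>\<^sub>C 'a) t. exp (- 2 * c * t) *\<^sub>R
     (x0 + integral {0..t} (\<lambda>s. F s (exp (2 * c * s) *\<^sub>R z s))))"
  have ci: "continuous_on {0..T} (\<lambda>s. F s (exp (2 * c * s) *\<^sub>R apply_bcontfun z s))" for z
    by (intro cont continuous_intros) auto
  \<comment> \<open>Extension from \<open>[0, T]\<close> by the boundary values places the image in
    the complete space of bounded continuous functions on the line.\<close>
  have ex: "\<exists>w::real \<Rightarrow>\<^sub>C 'a. (\<forall>t\<in>{0..T}. w t = W z t) \<and> (\<forall>t. w t = W z (clamp 0 T t))" for z
  proof -
    have "continuous_on (cbox 0 T) (W z)" unfolding W_def box_real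
      by (intro continuous_intros indefinite_integral_continuous_1 integrable_continuous_real ci)
    from continuous_on_cbox_bcontfunE[OF this] show ?thesis by (metis box_real(2))
  qed
  then obtain w :: "(real \<Rightarrow>\<^sub>C 'a) \<Rightarrow> (real \<Rightarrow>\<^sub>C 'a)" where
    w: "\<And>z t. t \<in> {0..T} \<Longrightarrow> w z t = W z t" "\<And>z t. w z t = W z (clamp 0 T t)" by metis
  have "dist (w z1) (w z2) \<le> 1/2 * dist z1 z2" for z1 z2
  proof (rule dist_bound)
    fix t0 :: real
    define t where "t = clamp 0 T t0"
    have t: "t \<in> {0..T}" using clamp_in_interval[of 0 T t0] T by (simp add: t_def)
    have sub: "{0..t} \<subseteq> {0..T}" using t by auto
    let ?F = "\<lambda>z s. F s (exp (2 * c * s) *\<^sub>R apply_bcontfun z s)"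
    have i: "?F z integrable_on {0..t}" for z
      by (intro integrable_continuous_real continuous_on_subset[OF ci sub])
    have "((\<lambda>s. (K * dist z1 z2) * exp (2 * c * s)) has_integral
       (K * dist z1 z2) * (exp (2 * c * t) / (2 * c)) - (K * dist z1 z2) * (exp (2 * c * 0) / (2 * c))) {0..t}"
      using t c by (intro fundamental_theorem_of_calculus)
        (auto intro!: derivative_eq_intros simp: has_real_derivative_iff_has_vector_derivative[symmetric])
    note hi = this
    have "norm (integral {0..t} (\<lambda>s. ?F z1 s - ?F z2 s)) \<le>
        integral {0..t} (\<lambda>s. (K * dist z1 z2) * exp (2 * c * s))"
    proof (rule integral_norm_bound_integral[OF integrable_diff[OF i i] has_integral_integrable[OF hi]])
      fix s assume "s \<in> {0..t}"
      then have "s \<in> {0..T}" using sub by auto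
      then have "norm (?F z1 s - ?F z2 s) \<le> K * norm (exp (2 * c * s) *\<^sub>R z1 s - exp (2 * c * s) *\<^sub>R z2 s)"
        by (rule lip)
      also have "\<dots> = K * (exp (2 * c * s) * dist (z1 s) (z2 s))"
        by (simp add: scaleR_diff_right[symmetric] dist_norm)
      also have "\<dots> \<le> K * (exp (2 * c * s) * dist z1 z2)"
        using K by (intro mult_left_mono dist_bounded) auto
      finally show "norm (?F z1 s - ?F z2 s) \<le> (K * dist z1 z2) * exp (2 * c * s)"
        by (simp add: mult_ac)
    qed
    also have "\<dots> = (K * dist z1 z2) * ((exp (2 * c * t) - 1) / (2 * c))"
      using integral_unique[OF hi] by (simp add: algebra_simps diff_divide_distrib)
    also have "\<dots> \<le> (c * dist z1 z2) * (exp (2 * c * t) / (2 * c))"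
      using c t K by (intro mult_mono divide_right_mono) auto
    also have "\<dots> = exp (2 * c * t) * (1/2 * dist z1 z2)" using c by simp
    finally have b: "norm (integral {0..t} (\<lambda>s. ?F z1 s - ?F z2 s)) \<le> exp (2 * c * t) * (1/2 * dist z1 z2)" .
    have "W z1 t - W z2 t = exp (- 2 * c * t) *\<^sub>R integral {0..t} (\<lambda>s. ?F z1 s - ?F z2 s)"
      unfolding W_def integral_diff[OF i i] by (simp add: scaleR_diff_right[symmetric])
    then have "dist (w z1 t0) (w z2 t0) = exp (- 2 * c * t) * norm (integral {0..t} (\<lambda>s. ?F z1 s - ?F z2 s))"
      unfolding w(2) t_def[symmetric] by (simp add: dist_norm)
    also have "\<dots> \<le> exp (- 2 * c * t) * (exp (2 * c * t) * (1/2 * dist z1 z2))"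
      by (intro mult_left_mono b) auto
    also have "\<dots> = 1/2 * dist z1 z2" by (simp add: mult.assoc[symmetric] exp_add[symmetric])
    finally show "dist (w z1 t0) (w z2 t0) \<le> 1/2 * dist z1 z2" .
  qed
  then have "\<exists>!z. w z = z" by (intro banach_fix_type[of "1/2"]) auto
  then obtain z where z: "w z = z" by blast
  define y where "y = (\<lambda>t. exp (2 * c * t) *\<^sub>R z t)"
  show ?thesis
  proof
    show "continuous_on {0..T} y" unfolding y_def by (intro continuous_intros) auto
    fix t assume t: "t \<in> {0..T}"
    have "y t = exp (2 * c * t) *\<^sub>R W z t" using w(1)[OF t, of z] unfolding z by (simp add: y_def)
    also have "\<dots> = x0 + integral {0..t} (\<lambda>s. F s (y s))"
      unfolding W_def y_def scaleR_scaleR exp_add[symmetric] by simp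
    finally show "y t = x0 + integral {0..t} (\<lambda>s. F s (y s))" .
  qed
qed

subsection \<open>Dependence of trajectories and costs on the control\<close>

text \<open>The control is only measurable and possibly unbounded: continuity of
  \<open>\<Psi>\<close> gives measurability of the composite, linear growth in \<open>p\<close> an
  integrable majorant. The vector field and the cost are both of this kind.\<close>

lemma absolutely_integrable_compose_linear_growth:
  fixes \<Psi> :: "'a::euclidean_space \<Rightarrow> 'b::euclidean_space \<Rightarrow> 'c::euclidean_space"
    and y :: "real \<Rightarrow> 'a" and p :: "real \<Rightarrow> 'b"
  assumes cont: "continuous_on UNIV (\<lambda>(x, p). \<Psi> x p)"
    and growth: "\<And>s. s \<in> {a..b} \<Longrightarrow> norm (\<Psi> (y s) (p s)) \<le> C * norm (p s)"
    and y: "continuous_on {a..b} y" and p: "p absolutely_integrable_on {a..b}"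
  shows "(\<lambda>s. \<Psi> (y s) (p s)) absolutely_integrable_on {a..b}"
proof (rule measurable_bounded_by_integrable_imp_absolutely_integrable)
  have my: "y \<in> borel_measurable (lebesgue_on {a..b})"
    using y by (intro continuous_imp_measurable_on_sets_lebesgue) auto
  have mp: "p \<in> borel_measurable (lebesgue_on {a..b})"
    using p absolutely_integrable_measurable[of "{a..b}" p] by auto
  have "(\<lambda>s. (\<lambda>(x, p). \<Psi> x p) (y s, p s)) \<in> borel_measurable (lebesgue_on {a..b})"
    by (rule measurable_compose[OF borel_measurable_Pair[OF my mp] borel_measurable_continuous_onI[OF cont]])
  then show "(\<lambda>s. \<Psi> (y s) (p s)) \<in> borel_measurable (lebesgue_on {a..b})" by simp
  have "(\<lambda>s. norm (p s)) integrable_on {a..b}"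
    using p by (simp add: absolutely_integrable_on_def)
  then show "(\<lambda>s. C * norm (p s)) integrable_on {a..b}" by (rule integrable_on_mult_right)
qed (use growth in auto)

lemma absolutely_integrable_norm_diff:
  fixes p q :: "real \<Rightarrow> 'a::euclidean_space"
  assumes "p absolutely_integrable_on S" "q absolutely_integrable_on S"
  shows "(\<lambda>s. norm (p s - q s)) integrable_on S"
  using set_integral_diff(1)[OF assms] by (simp add: absolutely_integrable_on_def)

text \<open>The distance of two solutions satisfies a Gronwall inequality with weight
  \<open>K * norm (p s)\<close>. This weight is merely integrable, which calls for
  \<open>gronwall_absolutely_integrable\<close>.\<close>

lemma integral_equation_unique:
  fixes \<Phi> :: "'a::euclidean_space \<Rightarrow> 'b::euclidean_space \<Rightarrow> 'a"
    and y z :: "real \<Rightarrow> 'a" and p :: "real \<Rightarrow> 'b"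
  assumes cont: "continuous_on UNIV (\<lambda>(x, p). \<Phi> x p)"
    and B: "\<And>x p. x \<in> cball 0 R \<Longrightarrow> norm (\<Phi> x p) \<le> B * norm p"
    and K: "\<And>x x' p. x \<in> cball 0 R \<Longrightarrow> x' \<in> cball 0 R \<Longrightarrow> norm (\<Phi> x p - \<Phi> x' p) \<le> K * norm (x - x') * norm p"
    and K0: "0 \<le> K"
    and p: "p absolutely_integrable_on {0..T}"
    and y: "continuous_on {0..T} y" "y ` {0..T} \<subseteq> cball 0 R"
      "\<And>t. t \<in> {0..T} \<Longrightarrow> y t = x0 + integral {0..t} (\<lambda>s. \<Phi> (y s) (p s))"
    and z: "continuous_on {0..T} z" "z ` {0..T} \<subseteq> cball 0 R"
      "\<And>t. t \<in> {0..T} \<Longrightarrow> z t = x0 + integral {0..t} (\<lambda>s. \<Phi> (z s) (p s))"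
    and t: "t \<in> {0..T}"
  shows "y t = z t"
proof -
  have ii: "(\<lambda>s. \<Phi> (x s) (p s)) integrable_on {0..r}"
    if "continuous_on {0..T} x" "x ` {0..T} \<subseteq> cball 0 R" "r \<in> {0..T}" for x r
  proof -
    have "(\<lambda>s. \<Phi> (x s) (p s)) absolutely_integrable_on {0..T}"
      by (rule absolutely_integrable_compose_linear_growth[OF cont _ that(1) p])
        (rule B, use that(2) in blast)
    then have "(\<lambda>s. \<Phi> (x s) (p s)) integrable_on {0..T}" by (rule set_lebesgue_integral_eq_integral(1))
    then show ?thesis by (rule integrable_on_subinterval) (use that(3) in auto)
  qed
  have cn: "continuous_on {0..T} (\<lambda>s. norm (y s - z s))" using y(1) z(1) by (intro continuous_intros)
  have np: "(\<lambda>s. K * norm (p s)) absolutely_integrable_on {0..T}"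
    using absolutely_integrable_norm[OF p] by (intro set_integrable_mult_right) (simp add: o_def)
  have "norm (y t - z t) = 0"
  proof (rule gronwall_absolutely_integrable[OF cn np _ _ _ t])
    fix r assume r: "r \<in> {0..T}"
    have "y r - z r = integral {0..r} (\<lambda>s. \<Phi> (y s) (p s) - \<Phi> (z s) (p s))"
      unfolding y(3)[OF r] z(3)[OF r] integral_diff[OF ii[OF y(1,2) r] ii[OF z(1,2) r]] by simp
    also have "norm \<dots> \<le> integral {0..r} (\<lambda>s. K * norm (p s) * norm (y s - z s))"
    proof (rule integral_norm_bound_integral)
      show "(\<lambda>s. \<Phi> (y s) (p s) - \<Phi> (z s) (p s)) integrable_on {0..r}"
        by (rule integrable_diff[OF ii[OF y(1,2) r] ii[OF z(1,2) r]])
      have "(\<lambda>s. norm (y s - z s) * (K * norm (p s))) absolutely_integrable_on {0..T}"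
        by (intro absolutely_integrable_bounded_measurable_product_real np
            compact_imp_bounded compact_continuous_image continuous_imp_measurable_on_sets_lebesgue cn) auto
      then have "(\<lambda>s. K * norm (p s) * norm (y s - z s)) integrable_on {0..T}"
        by (simp add: mult.commute set_lebesgue_integral_eq_integral(1))
      then show "(\<lambda>s. K * norm (p s) * norm (y s - z s)) integrable_on {0..r}"
        by (rule integrable_on_subinterval) (use r in auto)
      fix s assume "s \<in> {0..r}"
      then have "s \<in> {0..T}" using r by auto
      then have "y s \<in> cball 0 R" "z s \<in> cball 0 R" using y(2) z(2) by blast+
      from K[OF this] show "norm (\<Phi> (y s) (p s) - \<Phi> (z s) (p s)) \<le> K * norm (p s) * norm (y s - z s)"
        by (simp add: mult_ac)
    qed
    finally show "norm (y r - z r) \<le> integral {0..r} (\<lambda>s. K * norm (p s) * norm (y s - z s))" .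
  qed (use K0 in auto)
  then show ?thesis by simp
qed

text \<open>The perturbed equation is solved for the field composed with the projection onto the ball, which is
  globally Lipschitz; the Gronwall estimate then keeps the solution inside the ball.\<close>

lemma integral_equation_approx:
  fixes \<Phi> :: "'a::euclidean_space \<Rightarrow> 'b::euclidean_space \<Rightarrow> 'a"
    and y :: "real \<Rightarrow> 'a" and p :: "real \<Rightarrow> 'b"
  assumes cont: "continuous_on UNIV (\<lambda>(x, p). \<Phi> x p)"
    and lin: "\<And>x p q. \<Phi> x (p - q) = \<Phi> x p - \<Phi> x q"
    and B: "\<And>x p. x \<in> cball 0 R \<Longrightarrow> norm (\<Phi> x p) \<le> B * norm p"
    and K: "\<And>x x' p. x \<in> cball 0 R \<Longrightarrow> x' \<in> cball 0 R \<Longrightarrow> norm (\<Phi> x p - \<Phi> x' p) \<le> K * norm (x - x') * norm p"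
    and B0: "0 \<le> B" and K0: "0 \<le> K" and T: "0 \<le> T" and R: "0 \<le> R"
    and p: "p absolutely_integrable_on {0..T}"
    and y: "continuous_on {0..T} y" "\<And>t. t \<in> {0..T} \<Longrightarrow> norm (y t) + 1 \<le> R"
      "\<And>t. t \<in> {0..T} \<Longrightarrow> y t = x0 + integral {0..t} (\<lambda>s. \<Phi> (y s) (p s))"
    and e: "e > 0"
  obtains d where "d > 0"
    "\<And>q. continuous_on {0..T} q \<Longrightarrow> integral {0..T} (\<lambda>s. norm (q s - p s)) < d \<Longrightarrow>
      \<exists>z. continuous_on {0..T} z \<and> (\<forall>t\<in>{0..T}. z t = x0 + integral {0..t} (\<lambda>s. \<Phi> (z s) (q s))) \<and>
        (\<forall>t\<in>{0..T}. norm (z t - y t) < e \<and> z t \<in> cball 0 R)"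
proof -
  define E where "E = exp (K * (integral {0..T} (\<lambda>s. norm (p s)) + 1))"
  \<comment> \<open>The Gronwall bound on the distance will be \<open>B * d * E\<close>. It must
    stay below \<open>e\<close>, the required accuracy, and below 1, the margin between
    \<open>y\<close> and the boundary of the ball. The bound \<open>d \<le> 1\<close> justifies the
    \<open>+ 1\<close> inside \<open>E\<close>, and \<open>B + 1\<close> avoids division by
    0.\<close>
  define d where "d = min 1 (min 1 e / ((B + 1) * E))"
  have E: "E > 0" by (simp add: E_def)
  have d: "d > 0" "d \<le> 1" using e B0 E by (auto simp: d_def)
  have dE: "B * d * E < min 1 e"
  proof -
    have "B * d * E < (B + 1) * d * E" using d E by simp
    also have "\<dots> = d * ((B + 1) * E)" by simp
    also have "\<dots> \<le> (min 1 e / ((B + 1) * E)) * ((B + 1) * E)"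
      using B0 E by (intro mult_right_mono) (auto simp: d_def)
    also have "\<dots> = min 1 e" using B0 E by simp
    finally show ?thesis .
  qed
  define \<pi> where "\<pi> = closest_point (cball (0::'a) R)"
  have ne: "cball (0::'a) R \<noteq> {}" using R by simp
  have pi_in: "\<pi> x \<in> cball 0 R" for x
    unfolding \<pi>_def by (rule closest_point_in_set[OF closed_cball ne])
  have pi_lip: "norm (\<pi> x - \<pi> x') \<le> norm (x - x')" for x x'
    using closest_point_lipschitz[OF convex_cball closed_cball ne] unfolding \<pi>_def dist_norm .
  have pi_id: "\<pi> x = x" if "x \<in> cball 0 R" for x
    unfolding \<pi>_def by (rule closest_point_self[OF that])
  have pi_cont: "continuous_on UNIV \<pi>"
    unfolding \<pi>_def by (rule continuous_on_closest_point[OF convex_cball closed_cball ne])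
  have cont': "continuous_on S (\<lambda>s. \<Phi> (a s) (b s))" if "continuous_on S a" "continuous_on S b" for S :: "real set" and a b
    using continuous_on_compose2[OF cont continuous_on_Pair[OF that]] by simp
  have yR: "y s \<in> cball 0 R" if "s \<in> {0..T}" for s using y(2)[OF that] by simp
  have np: "(\<lambda>s. norm (p s)) integrable_on {0..T}" using p by (simp add: absolutely_integrable_on_def)
  show ?thesis
  proof (rule that[OF d(1)])
    fix q assume q: "continuous_on {0..T} q" "integral {0..T} (\<lambda>s. norm (q s - p s)) < d"
    have qi: "q absolutely_integrable_on {0..T}" by (rule absolutely_integrable_continuous_real[OF q(1)])
    note qp = absolutely_integrable_norm_diff[OF qi p]
    \<comment> \<open>Continuity of \<open>q\<close> enters here: its bound turns the Lipschitz
      estimate, which is proportional to the size of the control, into one uniform in time, as the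
      contraction requires.\<close>
    have "bounded (q ` {0..T})" by (intro compact_imp_bounded compact_continuous_image q) auto
    then obtain Q where Q: "Q > 0" "\<And>s. s \<in> {0..T} \<Longrightarrow> norm (q s) \<le> Q" by (auto simp: bounded_pos)
    have cpi: "continuous_on {0..T} (\<lambda>s. \<pi> (z s))" if "continuous_on {0..T} z" for z :: "real \<Rightarrow> 'a"
      by (rule continuous_on_compose2[OF pi_cont that]) auto
    have lipF: "norm (\<Phi> (\<pi> x) (q s) - \<Phi> (\<pi> x') (q s)) \<le> K * Q * norm (x - x')"
      if s: "s \<in> {0..T}" for s x x'
    proof -
      have "norm (\<Phi> (\<pi> x) (q s) - \<Phi> (\<pi> x') (q s)) \<le> K * norm (\<pi> x - \<pi> x') * norm (q s)"
        by (rule K[OF pi_in pi_in])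
      also have "\<dots> \<le> K * norm (x - x') * Q"
        using K0 Q s by (intro mult_mono mult_left_mono pi_lip mult_nonneg_nonneg) auto
      finally show ?thesis by (simp add: mult_ac)
    qed
    obtain z where z: "continuous_on {0..T} z"
      "\<And>t. t \<in> {0..T} \<Longrightarrow> z t = x0 + integral {0..t} (\<lambda>s. \<Phi> (\<pi> (z s)) (q s))"
    proof (rule integral_equation_exists[OF T, of "K * Q" "\<lambda>s x. \<Phi> (\<pi> x) (q s)" x0])
      show "0 \<le> K * Q" using K0 Q(1) by simp
      show "continuous_on {0..T} (\<lambda>s. \<Phi> (\<pi> (z s)) (q s))" if "continuous_on {0..T} z" for z
        by (intro cont' cpi that q(1))
    qed (use lipF in auto)
    have close: "norm (z t - y t) \<le> (B * d) * exp (integral {0..t} (\<lambda>s. K * norm (q s)))"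
      if t: "t \<in> {0..T}" for t
    proof (rule gronwall_continuous[OF _ _ _ _ t])
      show "continuous_on {0..T} (\<lambda>t. norm (z t - y t))" "continuous_on {0..T} (\<lambda>s. K * norm (q s))"
        using z(1) y(1) q(1) by (auto intro!: continuous_intros)
      show "0 \<le> K * norm (q s)" for s using K0 by simp
      fix r assume r: "r \<in> {0..T}"
      then have sub: "{0..r} \<subseteq> {0..T}" by auto
      note ir = integrable_on_subinterval[OF _ sub]
      have i1: "(\<lambda>s. \<Phi> (\<pi> (z s)) (q s)) integrable_on {0..r}"
        by (rule ir, rule integrable_continuous_real, intro cont' cpi z(1) q(1))
      have "(\<lambda>s. \<Phi> (y s) (p s)) absolutely_integrable_on {0..T}"
        by (rule absolutely_integrable_compose_linear_growth[OF cont _ y(1) p]) (auto intro!: B yR)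
      then have i2: "(\<lambda>s. \<Phi> (y s) (p s)) integrable_on {0..r}"
        by (intro ir set_lebesgue_integral_eq_integral(1))
      have i3: "(\<lambda>s. B * norm (q s - p s)) integrable_on {0..r}"
        by (intro ir integrable_on_mult_right qp)
      have i4: "(\<lambda>s. K * norm (q s) * norm (z s - y s)) integrable_on {0..r}"
        by (rule ir, rule integrable_continuous_real) (use z(1) y(1) q(1) in \<open>auto intro!: continuous_intros\<close>)
      have "z r - y r = integral {0..r} (\<lambda>s. \<Phi> (\<pi> (z s)) (q s) - \<Phi> (y s) (p s))"
        unfolding y(3)[OF r] z(2)[OF r] integral_diff[OF i1 i2] by simp
      also have "norm \<dots> \<le> integral {0..r} (\<lambda>s. B * norm (q s - p s) + K * norm (q s) * norm (z s - y s))"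
      proof (rule integral_norm_bound_integral[OF integrable_diff[OF i1 i2] integrable_add[OF i3 i4]])
        fix s assume "s \<in> {0..r}"
        then have s: "s \<in> {0..T}" using sub by auto
        \<comment> \<open>The change of control is measured along the known trajectory
          \<open>y\<close>, the change of state under the continuous control \<open>q\<close>; hence
          the Gronwall weight \<open>K * norm (q s)\<close> is continuous.\<close>
        have "\<Phi> (\<pi> (z s)) (q s) - \<Phi> (y s) (p s) =
            \<Phi> (y s) (q s - p s) + (\<Phi> (\<pi> (z s)) (q s) - \<Phi> (\<pi> (y s)) (q s))"
          unfolding pi_id[OF yR[OF s]] lin by simp
        also have "norm \<dots> \<le> B * norm (q s - p s) + K * norm (\<pi> (z s) - \<pi> (y s)) * norm (q s)"
          by (intro norm_triangle_mono B K pi_in yR s)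
        also have "\<dots> \<le> B * norm (q s - p s) + K * norm (z s - y s) * norm (q s)"
          using K0 by (intro add_mono mult_right_mono mult_left_mono pi_lip) auto
        finally show "norm (\<Phi> (\<pi> (z s)) (q s) - \<Phi> (y s) (p s)) \<le>
            B * norm (q s - p s) + K * norm (q s) * norm (z s - y s)" by (simp add: mult_ac)
      qed
      also have "\<dots> = B * integral {0..r} (\<lambda>s. norm (q s - p s)) + integral {0..r} (\<lambda>s. K * norm (q s) * norm (z s - y s))"
        by (subst integral_add[OF i3 i4]) simp
      also have "\<dots> \<le> B * d + integral {0..r} (\<lambda>s. K * norm (q s) * norm (z s - y s))"
        using integral_subset_le[OF sub ir[OF qp] qp] q(2) B0 by (intro add_mono mult_left_mono) auto
      finally show "norm (z r - y r) \<le> B * d + integral {0..r} (\<lambda>s. K * norm (q s) * norm (z s - y s))" .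
    qed
    have Kq: "integral {0..t} (\<lambda>s. K * norm (q s)) \<le> K * (integral {0..T} (\<lambda>s. norm (p s)) + 1)"
      if t: "t \<in> {0..T}" for t
    proof -
      have cq: "continuous_on S (\<lambda>s. norm (q s))" if "S \<subseteq> {0..T}" for S
        by (intro continuous_on_norm continuous_on_subset[OF q(1) that])
      have "integral {0..t} (\<lambda>s. norm (q s)) \<le> integral {0..T} (\<lambda>s. norm (q s))"
        using t by (intro integral_subset_le integrable_continuous_real cq) auto
      also have "\<dots> \<le> integral {0..T} (\<lambda>s. norm (p s) + norm (q s - p s))"
      proof (rule integral_le[OF _ integrable_add[OF np qp]])
        show "(\<lambda>s. norm (q s)) integrable_on {0..T}" by (intro integrable_continuous_real cq) auto
        show "norm (q s) \<le> norm (p s) + norm (q s - p s)" for s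
          using norm_triangle_ineq[of "p s" "q s - p s"] by simp
      qed
      also have "\<dots> = integral {0..T} (\<lambda>s. norm (p s)) + integral {0..T} (\<lambda>s. norm (q s - p s))"
        by (rule integral_add[OF np qp])
      also have "\<dots> \<le> integral {0..T} (\<lambda>s. norm (p s)) + 1" using q(2) d(2) by simp
      finally show ?thesis using K0 by (simp add: mult_left_mono)
    qed
    have zy: "norm (z t - y t) < min 1 e" if t: "t \<in> {0..T}" for t
    proof -
      have "norm (z t - y t) \<le> (B * d) * exp (integral {0..t} (\<lambda>s. K * norm (q s)))" by (rule close[OF t])
      also have "\<dots> \<le> B * d * E" unfolding E_def using Kq[OF t] B0 d(1) by (intro mult_left_mono) auto
      finally show ?thesis using dE by simp
    qed
    have zR: "z t \<in> cball 0 R" if t: "t \<in> {0..T}" for t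
      using zy[OF t] y(2)[OF t] norm_triangle_sub[of "z t" "y t"] by simp
    have zeq: "z t = x0 + integral {0..t} (\<lambda>s. \<Phi> (z s) (q s))" if t: "t \<in> {0..T}" for t
    proof -
      have "integral {0..t} (\<lambda>s. \<Phi> (\<pi> (z s)) (q s)) = integral {0..t} (\<lambda>s. \<Phi> (z s) (q s))"
        using t zR pi_id by (intro Henstock_Kurzweil_Integration.integral_cong) auto
      then show ?thesis using z(2)[OF t] by simp
    qed
    show "\<exists>z. continuous_on {0..T} z \<and> (\<forall>t\<in>{0..T}. z t = x0 + integral {0..t} (\<lambda>s. \<Phi> (z s) (q s))) \<and>
        (\<forall>t\<in>{0..T}. norm (z t - y t) < e \<and> z t \<in> cball 0 R)"
      using z(1) zeq zy zR by (intro exI[of _ z]) auto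
  qed
qed

text \<open>The error splits into a change of velocity, Lipschitz with constant \<open>C\<close>,
  and a change of state at the old velocity. The modulus in the state is relative to
  \<open>norm p\<close>, so it can be integrated although \<open>p\<close> may be unbounded.\<close>

lemma integral_approx:
  fixes \<Lambda> :: "'a::euclidean_space \<Rightarrow> 'b::euclidean_space \<Rightarrow> real"
    and y :: "real \<Rightarrow> 'a" and p :: "real \<Rightarrow> 'b"
  assumes cont: "continuous_on UNIV (\<lambda>(x, p). \<Lambda> x p)"
    and C: "\<And>x p. x \<in> cball 0 R \<Longrightarrow> \<bar>\<Lambda> x p\<bar> \<le> C * norm p"
    and lip: "\<And>x p q. x \<in> cball 0 R \<Longrightarrow> \<bar>\<Lambda> x p - \<Lambda> x q\<bar> \<le> C * norm (p - q)"
    and uc: "\<And>\<epsilon>. \<epsilon> > 0 \<Longrightarrow> \<exists>\<delta>>0. \<forall>x\<in>cball 0 R. \<forall>x'\<in>cball 0 R. norm (x - x') < \<delta> \<longrightarrow>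
        (\<forall>p. \<bar>\<Lambda> x p - \<Lambda> x' p\<bar> \<le> \<epsilon> * norm p)"
    and C0: "0 \<le> C"
    and p: "p absolutely_integrable_on {0..T}"
    and y: "continuous_on {0..T} y" "y ` {0..T} \<subseteq> cball 0 R"
    and e: "e > 0"
  obtains d where "d > 0"
    "\<And>q z. continuous_on {0..T} q \<Longrightarrow> continuous_on {0..T} z \<Longrightarrow> z ` {0..T} \<subseteq> cball 0 R \<Longrightarrow>
      (\<And>t. t \<in> {0..T} \<Longrightarrow> norm (z t - y t) < d) \<Longrightarrow>
      integral {0..T} (\<lambda>s. norm (q s - p s)) < d \<Longrightarrow>
      \<bar>integral {0..T} (\<lambda>s. \<Lambda> (z s) (q s)) - integral {0..T} (\<lambda>s. \<Lambda> (y s) (p s))\<bar> < e"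
proof -
  define N where "N = integral {0..T} (\<lambda>s. norm (p s))"
  have np: "(\<lambda>s. norm (p s)) integrable_on {0..T}" using p by (simp add: absolutely_integrable_on_def)
  have N0: "N \<ge> 0" unfolding N_def by (rule integral_nonneg[OF np]) auto
  \<comment> \<open>Half of \<open>e\<close> is reserved for each of the two errors;
    \<open>N\<close> and, below, \<open>C\<close> are enlarged by 1 because they may vanish.\<close>
  define \<epsilon> where "\<epsilon> = e / (2 * (N + 1))"
  have eps: "\<epsilon> > 0" using e N0 by (simp add: \<epsilon>_def)
  from uc[OF eps] obtain \<delta> where del: "\<delta> > 0" "\<And>x x' p. x \<in> cball 0 R \<Longrightarrow> x' \<in> cball 0 R \<Longrightarrow>
     norm (x - x') < \<delta> \<Longrightarrow> \<bar>\<Lambda> x p - \<Lambda> x' p\<bar> \<le> \<epsilon> * norm p" by blast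
  define d where "d = min \<delta> (e / (2 * (C + 1)))"
  have d: "d > 0" "d \<le> \<delta>" "d \<le> e / (2 * (C + 1))" using del(1) e C0 by (auto simp: d_def)
  show ?thesis
  proof (rule that[OF d(1)])
    fix q z assume q: "continuous_on {0..T} q" and z: "continuous_on {0..T} z" "z ` {0..T} \<subseteq> cball 0 R"
      and zy: "\<And>t. t \<in> {0..T} \<Longrightarrow> norm (z t - y t) < d"
      and qd: "integral {0..T} (\<lambda>s. norm (q s - p s)) < d"
    note qi = absolutely_integrable_continuous_real[OF q]
    note qp = absolutely_integrable_norm_diff[OF qi p]
    have i: "(\<lambda>s. \<Lambda> (x s) (r s)) integrable_on {0..T}"
      if "continuous_on {0..T} x" "x ` {0..T} \<subseteq> cball 0 R" "r absolutely_integrable_on {0..T}" for x r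
    proof -
      have "(\<lambda>s. \<Lambda> (x s) (r s)) absolutely_integrable_on {0..T}"
        by (rule absolutely_integrable_compose_linear_growth[OF cont _ that(1,3), of C])
          (use that(2) C in \<open>auto simp: image_subset_iff\<close>)
      then show ?thesis by (rule set_lebesgue_integral_eq_integral(1))
    qed
    have "integral {0..T} (\<lambda>s. \<Lambda> (z s) (q s)) - integral {0..T} (\<lambda>s. \<Lambda> (y s) (p s)) =
        integral {0..T} (\<lambda>s. \<Lambda> (z s) (q s) - \<Lambda> (y s) (p s))"
      by (rule integral_diff[symmetric, OF i[OF z qi] i[OF y p]])
    also have "norm \<dots> \<le> integral {0..T} (\<lambda>s. C * norm (q s - p s) + \<epsilon> * norm (p s))"
    proof (rule integral_norm_bound_integral[OF integrable_diff[OF i[OF z qi] i[OF y p]]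
          integrable_add[OF integrable_on_mult_right[OF qp] integrable_on_mult_right[OF np]]])
      fix s assume s: "s \<in> {0..T}"
      then have zs: "z s \<in> cball 0 R" "y s \<in> cball 0 R" using z(2) y(2) by blast+
      have "\<bar>\<Lambda> (z s) (q s) - \<Lambda> (z s) (p s)\<bar> \<le> C * norm (q s - p s)" by (rule lip[OF zs(1)])
      moreover have "\<bar>\<Lambda> (z s) (p s) - \<Lambda> (y s) (p s)\<bar> \<le> \<epsilon> * norm (p s)"
        using zy[OF s] d(2) by (intro del(2) zs) auto
      ultimately show "norm (\<Lambda> (z s) (q s) - \<Lambda> (y s) (p s)) \<le> C * norm (q s - p s) + \<epsilon> * norm (p s)"
        unfolding real_norm_def by linarith
    qed
    also have "\<dots> = C * integral {0..T} (\<lambda>s. norm (q s - p s)) + \<epsilon> * N"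
      unfolding N_def
      by (subst integral_add[OF integrable_on_mult_right[OF qp] integrable_on_mult_right[OF np]]) simp
    also have "\<dots> < e / 2 + e / 2"
    proof (rule add_le_less_mono)
      have "C * integral {0..T} (\<lambda>s. norm (q s - p s)) \<le> C * (e / (2 * (C + 1)))"
        using qd d(3) C0 by (intro mult_left_mono) auto
      also have "\<dots> \<le> e / 2" using e C0 by (simp add: field_simps)
      finally show "C * integral {0..T} (\<lambda>s. norm (q s - p s)) \<le> e / 2" .
      show "\<epsilon> * N < e / 2" using e N0 by (simp add: \<epsilon>_def field_simps)
    qed
    finally show "\<bar>integral {0..T} (\<lambda>s. \<Lambda> (z s) (q s)) - integral {0..T} (\<lambda>s. \<Lambda> (y s) (p s))\<bar> < e" by simp
  qed
qed

section \<open>The control vector field and its trajectories\<close>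

text \<open>Joining \<open>v\<close> and \<open>w\<close> to one vector makes the field linear in a
  single argument, as the abstract integral equations expect.\<close>

definition control_field ::
  "(real^'n \<Rightarrow> real^'n) \<Rightarrow> ('k::finite \<Rightarrow> real^'n \<Rightarrow> real^'n) \<Rightarrow> real^'n \<Rightarrow> real \<times> (real^'k) \<Rightarrow> real^'n" where
  "control_field f g x p = control_system f g x (fst p) (snd p)"

lemma locally_lipschitz_imp_lipschitz_on:
  fixes h :: "'a::metric_space \<Rightarrow> 'b::metric_space"
  assumes h: "locally_lipschitz h" and X: "compact X"
  obtains C where "0 \<le> C" "C-lipschitz_on X h"
proof -
  \<comment> \<open>The notion used for the compactness argument carries a time parameter, here the
    single instant 0.\<close>
  have "local_lipschitz {0::real} X (\<lambda>_. h)"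
  proof (rule local_lipschitzI)
    fix t :: real and x :: 'a
    from h obtain r C where r: "r > 0" "C-lipschitz_on (ball x r) h"
      unfolding locally_lipschitz_def by blast
    have "C-lipschitz_on (cball x (r / 2) \<inter> X) h"
      by (rule lipschitz_on_subset[OF r(2)]) (use r(1) in auto)
    then show "\<exists>u>0. \<exists>L. \<forall>t\<in>cball t u \<inter> {0}. L-lipschitz_on (cball x u \<inter> X) h"
      using r(1) by (intro exI[of _ "r / 2"]) auto
  qed
  from local_lipschitz_compact_implies_lipschitz[OF this X]
  obtain C where "C-lipschitz_on X h" by auto
  then show ?thesis using lipschitz_on_nonneg that by blast
qed

lemma locally_lipschitz_imp_continuous_on:
  fixes h :: "'a::metric_space \<Rightarrow> 'b::metric_space"
  assumes h: "locally_lipschitz h"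
  shows "continuous_on S h"
proof -
  have "continuous (at x) h" for x
  proof -
    from h obtain r C where r: "r > 0" "C-lipschitz_on (ball x r) h"
      unfolding locally_lipschitz_def by blast
    have "continuous_on (ball x r) h" by (rule lipschitz_on_continuous_on[OF r(2)])
    then show ?thesis using r(1) by (simp add: continuous_on_eq_continuous_at)
  qed
  then show ?thesis by (intro continuous_at_imp_continuous_on) auto
qed

lemma control_field_diff: "control_field f g x (p - q) = control_field f g x p - control_field f g x q"
  by (simp add: control_field_def control_system_def sum_subtractf scaleR_diff_left)

lemma control_field_scaleR: "control_field f g x (c *\<^sub>R p) = c *\<^sub>R control_field f g x p"
  by (simp add: control_field_def control_system_def scaleR_add_right scaleR_sum_right)

lemma continuous_on_control_field:
  assumes "locally_lipschitz f" "\<And>i. locally_lipschitz (g i)"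
  shows "continuous_on UNIV (\<lambda>(x, p). control_field f g x p)"
proof -
  have "continuous_on UNIV (\<lambda>z. h (fst z))" if "locally_lipschitz h" for h :: "real^'n \<Rightarrow> real^'n"
    by (rule continuous_on_compose2[OF locally_lipschitz_imp_continuous_on[OF that, of UNIV]])
      (auto intro: continuous_intros)
  then show ?thesis using assms unfolding control_field_def control_system_def split_def
    by (intro continuous_intros) auto
qed

lemma control_field_lipschitz:
  fixes f :: "real^'n \<Rightarrow> real^'n" and g :: "'k::finite \<Rightarrow> real^'n \<Rightarrow> real^'n"
  assumes f: "locally_lipschitz f" and g: "\<And>i. locally_lipschitz (g i)"
  obtains K where "0 \<le> K"
    "\<And>x x' p. x \<in> cball 0 R \<Longrightarrow> x' \<in> cball 0 R \<Longrightarrow>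
       norm (control_field f g x p - control_field f g x' p) \<le> K * norm (x - x') * norm p"
proof -
  from locally_lipschitz_imp_lipschitz_on[OF f compact_cball] obtain Cf where
    Cf: "0 \<le> Cf" "Cf-lipschitz_on (cball 0 R) f" by blast
  have "\<exists>C. 0 \<le> C \<and> C-lipschitz_on (cball 0 R) (g i)" for i
    using locally_lipschitz_imp_lipschitz_on[OF g compact_cball] by metis
  then obtain Cg where Cg: "\<And>i. 0 \<le> Cg i" "\<And>i. (Cg i)-lipschitz_on (cball 0 R) (g i)" by metis
  show ?thesis
  proof
    show "0 \<le> Cf + (\<Sum>i\<in>UNIV. Cg i)" using Cf(1) Cg(1) by (intro add_nonneg_nonneg sum_nonneg) auto
    fix x x' :: "real^'n" and p :: "real \<times> (real^'k)" assume x: "x \<in> cball 0 R" "x' \<in> cball 0 R"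
    have "control_field f g x p - control_field f g x' p =
        fst p *\<^sub>R (f x - f x') + (\<Sum>i\<in>UNIV. (snd p $ i) *\<^sub>R (g i x - g i x'))"
      by (simp add: control_field_def control_system_def sum_subtractf scaleR_diff_right)
    also have "norm \<dots> \<le> norm p * (Cf * norm (x - x')) + (\<Sum>i\<in>UNIV. norm p * (Cg i * norm (x - x')))"
    proof (intro norm_triangle_mono sum_norm_le)
      have "norm (f x - f x') \<le> Cf * norm (x - x')"
        using lipschitz_onD[OF Cf(2) x] by (simp add: dist_norm)
      moreover have "\<bar>fst p\<bar> \<le> norm p" using norm_fst_le[of "fst p" "snd p"] by simp
      ultimately show "norm (fst p *\<^sub>R (f x - f x')) \<le> norm p * (Cf * norm (x - x'))"
        by (simp add: mult_mono)
      fix i :: 'k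
      have "norm (g i x - g i x') \<le> Cg i * norm (x - x')"
        using lipschitz_onD[OF Cg(2) x] by (simp add: dist_norm)
      moreover have "\<bar>snd p $ i\<bar> \<le> norm p"
        using component_le_norm_cart[of "snd p" i] norm_snd_le[of "snd p" "fst p"] by simp
      ultimately show "norm ((snd p $ i) *\<^sub>R (g i x - g i x')) \<le> norm p * (Cg i * norm (x - x'))"
        by (simp add: mult_mono)
    qed
    also have "\<dots> = (Cf + (\<Sum>i\<in>UNIV. Cg i)) * norm (x - x') * norm p"
      by (simp add: sum_distrib_left[symmetric] sum_distrib_right[symmetric] algebra_simps)
    finally show "norm (control_field f g x p - control_field f g x' p) \<le>
      (Cf + (\<Sum>i\<in>UNIV. Cg i)) * norm (x - x') * norm p" .
  qed
qed

lemma control_field_bound: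
  fixes f :: "real^'n \<Rightarrow> real^'n" and g :: "'k::finite \<Rightarrow> real^'n \<Rightarrow> real^'n"
  assumes f: "locally_lipschitz f" and g: "\<And>i. locally_lipschitz (g i)" and R: "0 \<le> R"
  obtains B where "0 \<le> B"
    "\<And>x p. x \<in> cball 0 R \<Longrightarrow> norm (control_field f g x p) \<le> B * norm p"
proof -
  from control_field_lipschitz[of f g R, OF f g] obtain K where K: "0 \<le> K"
    "\<And>x x' p. x \<in> cball 0 R \<Longrightarrow> x' \<in> cball 0 R \<Longrightarrow>
       norm (control_field f g x p - control_field f g x' p) \<le> K * norm (x - x') * norm p" by blast
  define B0 where "B0 = norm (f 0) + (\<Sum>i\<in>UNIV. norm (g i 0))"
  have B0: "norm (control_field f g 0 p) \<le> B0 * norm p" for p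
  proof -
    have "norm (control_field f g 0 p) \<le> norm p * norm (f 0) + (\<Sum>i\<in>UNIV. norm p * norm (g i 0))"
      unfolding control_field_def control_system_def
    proof (intro norm_triangle_mono sum_norm_le)
      show "norm (fst p *\<^sub>R f 0) \<le> norm p * norm (f 0)"
        using norm_fst_le[of "fst p" "snd p"] by (simp add: mult_right_mono)
      fix i :: 'k
      have "\<bar>snd p $ i\<bar> \<le> norm p"
        using component_le_norm_cart[of "snd p" i] norm_snd_le[of "snd p" "fst p"] by simp
      then show "norm ((snd p $ i) *\<^sub>R g i 0) \<le> norm p * norm (g i 0)" by (simp add: mult_right_mono)
    qed
    then show ?thesis by (simp add: B0_def sum_distrib_left[symmetric] algebra_simps)
  qed
  show ?thesis
  proof
    show "0 \<le> K * R + B0" using K(1) R by (auto simp: B0_def intro!: add_nonneg_nonneg sum_nonneg)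
    fix x :: "real^'n" and p :: "real \<times> (real^'k)" assume x: "x \<in> cball 0 R"
    have "norm (control_field f g x p) \<le> norm (control_field f g x p - control_field f g 0 p) + norm (control_field f g 0 p)"
      by (metis diff_add_cancel norm_triangle_ineq)
    \<comment> \<open>Comparison with the centre 0, which lies in the ball because
      \<open>0 \<le> R\<close>.\<close>
    also have "\<dots> \<le> K * norm (x - 0) * norm p + B0 * norm p" using x R by (intro add_mono K(2) B0) auto
    also have "\<dots> \<le> K * R * norm p + B0 * norm p"
      using x K(1) by (intro add_mono mult_right_mono mult_left_mono) auto
    finally show "norm (control_field f g x p) \<le> (K * R + B0) * norm p" by (simp add: algebra_simps)
  qed
qed

lemma AE_lebesgue_on_negligible:
  assumes "AE t in lebesgue_on {a..b::real}. P t"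
  obtains N where "negligible N" "\<And>t. t \<in> {a..b} - N \<Longrightarrow> P t"
proof -
  have "AE t in lebesgue. t \<in> {a..b} \<longrightarrow> P t"
    using assms by (subst (asm) AE_restrict_space_iff) auto
  from AE_E[OF this] obtain N where N: "{t \<in> space lebesgue. \<not> (t \<in> {a..b} \<longrightarrow> P t)} \<subseteq> N"
    "emeasure lebesgue N = 0" "N \<in> sets lebesgue" by metis
  have "negligible N" using N(2,3) by (simp add: negligible_iff_null_sets null_setsI)
  moreover have "P t" if "t \<in> {a..b} - N" for t using that N(1) by auto
  ultimately show ?thesis using that by blast
qed

lemma negligible_imp_AE_lebesgue_on:
  fixes S :: "real set"
  assumes "negligible N" "\<And>t. t \<in> S - N \<Longrightarrow> P t" "S \<in> sets lebesgue"
  shows "AE t in lebesgue_on S. P t"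
proof -
  have "AE t in lebesgue. t \<in> S \<longrightarrow> P t"
    by (rule AE_I'[of N]) (use assms in \<open>auto simp: negligible_iff_null_sets\<close>)
  then show ?thesis using assms(3) by (subst AE_restrict_space_iff) auto
qed

text \<open>The differential equation holds only almost everywhere; absolute continuity turns it
  into the integral equation, the form in which uniqueness and perturbation are treated.\<close>

lemma solves_on_integral:
  assumes s: "solves_on f g x0 v w T y" and t: "t \<in> {0..T}"
  shows "continuous_on {0..T} y"
    "y t = x0 + integral {0..t} (\<lambda>s. control_field f g (y s) (v s, w s))"
proof -
  have ac: "abs_cont_on {0..T} y" and y0: "y 0 = x0" using s by (auto simp: solves_on_def)
  show "continuous_on {0..T} y" by (rule abs_cont_on_imp_continuous_on[OF ac])
  from s obtain N where N: "negligible N" "\<And>t. t \<in> {0..T} - N \<Longrightarrow>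
      (y has_vector_derivative control_system f g (y t) (v t) (w t)) (at t within {0..T})"
    unfolding solves_on_def using AE_lebesgue_on_negligible by blast
  have sub: "{0..t} \<subseteq> {0..T}" using t by auto
  have "((\<lambda>s. control_field f g (y s) (v s, w s)) has_integral y t - y 0) {0..t}"
  proof (rule abs_cont_has_integral[OF abs_cont_on_subset[OF ac sub] _ N(1)])
    fix s assume "s \<in> {0..t} - N"
    then have "(y has_vector_derivative control_system f g (y s) (v s) (w s)) (at s within {0..T})"
      using sub by (intro N(2)) auto
    then show "(y has_vector_derivative control_field f g (y s) (v s, w s)) (at s within {0..t})"
      unfolding control_field_def fst_conv snd_conv by (rule has_vector_derivative_within_subset) (rule sub)
  qed (use t in auto)
  then show "y t = x0 + integral {0..t} (\<lambda>s. control_field f g (y s) (v s, w s))"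
    using y0 by (simp add: integral_unique)
qed

lemma solves_on_restrict:
  assumes s: "solves_on f g x0 v w T y" and t: "t \<in> {0..T}"
  shows "solves_on f g x0 v w t y"
proof -
  have sub: "{0..t} \<subseteq> {0..T}" using t by auto
  from s obtain N where N: "negligible N" "\<And>t. t \<in> {0..T} - N \<Longrightarrow>
      (y has_vector_derivative control_system f g (y t) (v t) (w t)) (at t within {0..T})"
    unfolding solves_on_def using AE_lebesgue_on_negligible by blast
  have "AE s in lebesgue_on {0..t}. (y has_vector_derivative control_system f g (y s) (v s) (w s)) (at s within {0..t})"
  proof (rule negligible_imp_AE_lebesgue_on[OF N(1)])
    fix s assume "s \<in> {0..t} - N"
    then have "s \<in> {0..T} - N" using sub by auto
    from N(2)[OF this]
    show "(y has_vector_derivative control_system f g (y s) (v s) (w s)) (at s within {0..t})"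
      by (rule has_vector_derivative_within_subset) (rule sub)
  qed simp
  then show ?thesis using s abs_cont_on_subset[OF _ sub] by (auto simp: solves_on_def)
qed

text \<open>\<open>traj\<close> is a definite description, so any other solution on
  \<open>[0, t]\<close> must end at the same point. Both are continuous on a compact interval and
  lie in a common ball, where the field has uniform constants and uniqueness applies.\<close>

lemma traj_eq:
  fixes f :: "real^'n \<Rightarrow> real^'n" and g :: "'k::finite \<Rightarrow> real^'n \<Rightarrow> real^'n"
  assumes f: "locally_lipschitz f" and g: "\<And>i. locally_lipschitz (g i)"
    and p: "(\<lambda>s. (v s, w s)) absolutely_integrable_on {0..T}"
    and s: "solves_on f g x0 v w T y" and t: "t \<in> {0..T}"
  shows "traj f g x0 v w t = y t"
  unfolding traj_def
proof (rule the_equality)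
  show "\<exists>z. solves_on f g x0 v w t z \<and> z t = y t" using solves_on_restrict[OF s t] by blast
  fix r assume "\<exists>z. solves_on f g x0 v w t z \<and> z t = r"
  then obtain z where z: "solves_on f g x0 v w t z" "z t = r" by blast
  note y = solves_on_restrict[OF s t]
  have tt: "t \<in> {0..t}" using t by simp
  note cy = solves_on_integral(1)[OF y tt] and cz = solves_on_integral(1)[OF z(1) tt]
  have "bounded (y ` {0..t} \<union> z ` {0..t})"
    by (intro bounded_Un[THEN iffD2] conjI compact_imp_bounded compact_continuous_image cy cz) auto
  then obtain R where R: "R > 0" "\<And>x. x \<in> y ` {0..t} \<union> z ` {0..t} \<Longrightarrow> norm x \<le> R"
    by (auto simp: bounded_pos)
  from control_field_lipschitz[of f g R, OF f g] obtain K where K: "0 \<le> K"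
    "\<And>x x' p. x \<in> cball 0 R \<Longrightarrow> x' \<in> cball 0 R \<Longrightarrow>
       norm (control_field f g x p - control_field f g x' p) \<le> K * norm (x - x') * norm p" by blast
  from control_field_bound[of f g R, OF f g less_imp_le[OF R(1)]] obtain B where B: "0 \<le> B"
    "\<And>x p. x \<in> cball 0 R \<Longrightarrow> norm (control_field f g x p) \<le> B * norm p" by blast
  have pt: "(\<lambda>s. (v s, w s)) absolutely_integrable_on {0..t}"
    by (rule set_integrable_subset[OF p]) (use t in auto)
  have "y t = z t"
    by (rule integral_equation_unique[OF continuous_on_control_field[OF f g] B(2) K(2) K(1) pt
          cy _ solves_on_integral(2)[OF y] cz _ solves_on_integral(2)[OF z(1)] tt])
      (use R(2) in auto)
  then show "r = y t" using z(2) by simp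
qed

subsection \<open>Homogeneous Lagrangians\<close>

text \<open>No sign is imposed on \<open>fst p\<close>, so the Lipschitz estimate in
  \<open>p\<close> holds on the whole product space rather than on a half-space.\<close>

definition homogeneous_cost :: "('a \<Rightarrow> real) \<Rightarrow> ('a \<Rightarrow> 'b \<Rightarrow> real) \<Rightarrow> 'a \<Rightarrow> real \<times> 'b \<Rightarrow> real" where
  "homogeneous_cost L1 L2 x p = L1 x * fst p + L2 x (snd p)"

lemma homogeneous_zero:
  fixes l :: "'a::real_vector \<Rightarrow> real"
  assumes "\<And>u r. r > 0 \<Longrightarrow> l (r *\<^sub>R u) = r * l u"
  shows "l 0 = 0"
  using assms[of 2 0] by simp

text \<open>The sum is twice the midpoint, and homogeneity releases the factor 2.\<close>

lemma homogeneous_convex_subadditive: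
  fixes l :: "'a::real_vector \<Rightarrow> real"
  assumes hom: "\<And>u r. r > 0 \<Longrightarrow> l (r *\<^sub>R u) = r * l u" and conv: "convex_on UNIV l"
  shows "l (u + u') \<le> l u + l u'"
proof -
  have "l (u + u') = l (2 *\<^sub>R ((1 - 1/2) *\<^sub>R u + (1/2) *\<^sub>R u'))" by (simp add: scaleR_add_right)
  also have "\<dots> = 2 * l ((1 - 1/2) *\<^sub>R u + (1/2) *\<^sub>R u')" by (rule hom) simp
  also have "\<dots> \<le> 2 * ((1 - 1/2) * l u + (1/2) * l u')"
    by (intro mult_left_mono convex_onD[OF conv]) auto
  finally show ?thesis by simp
qed

text \<open>Rescaling to the unit sphere. With \<open>l' = 0\<close> it yields linear growth; with
  \<open>l\<close> and \<open>l'\<close> taken at two states it yields a modulus of continuity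
  proportional to the norm.\<close>

lemma homogeneous_diff_bound:
  fixes l l' :: "'a::euclidean_space \<Rightarrow> real"
  assumes hom: "\<And>u r. r > 0 \<Longrightarrow> l (r *\<^sub>R u) = r * l u" "\<And>u r. r > 0 \<Longrightarrow> l' (r *\<^sub>R u) = r * l' u"
    and M: "\<And>u. norm u = 1 \<Longrightarrow> \<bar>l u - l' u\<bar> \<le> M"
  shows "\<bar>l w - l' w\<bar> \<le> M * norm w"
proof (cases "w = 0")
  case True
  then show ?thesis using homogeneous_zero[OF hom(1)] homogeneous_zero[OF hom(2)] by simp
next
  case False
  let ?u = "w /\<^sub>R norm w"
  have w: "w = norm w *\<^sub>R ?u" and n: "norm w > 0" using False by simp_all
  have "l w - l' w = norm w * (l ?u - l' ?u)"
    using hom(1)[OF n, of ?u] hom(2)[OF n, of ?u] w by (simp add: right_diff_distrib)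
  then have "\<bar>l w - l' w\<bar> = norm w * \<bar>l ?u - l' ?u\<bar>" by (simp add: abs_mult)
  also have "\<dots> \<le> norm w * M" using False by (intro mult_left_mono M) auto
  finally show ?thesis by (simp add: mult.commute)
qed

lemma homogeneous_cost_continuous:
  fixes L2 :: "'a::euclidean_space \<Rightarrow> 'b::euclidean_space \<Rightarrow> real"
  assumes L1: "continuous_on UNIV L1" and L2: "continuous_on UNIV (\<lambda>(x, u). L2 x u)"
  shows "continuous_on UNIV (\<lambda>(x, p). homogeneous_cost L1 L2 x p)"
proof -
  have "continuous_on UNIV (\<lambda>z::'a \<times> real \<times> 'b. L1 (fst z))"
    by (rule continuous_on_compose2[OF L1]) (auto intro: continuous_intros)
  moreover have "continuous_on UNIV (\<lambda>z::'a \<times> real \<times> 'b. (\<lambda>(x, u). L2 x u) (fst z, snd (snd z)))"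
    by (rule continuous_on_compose2[OF L2]) (auto intro!: continuous_intros)
  ultimately show ?thesis unfolding homogeneous_cost_def split_def by (intro continuous_intros) auto
qed

text \<open>Compactness of the ball times the unit sphere bounds \<open>L2\<close> linearly in
  \<open>u\<close>. Convexity then enters through subadditivity:
  \<open>L2 x a - L2 x b \<le> L2 x (a - b)\<close>, so the same constant is a Lipschitz
  constant.\<close>

lemma homogeneous_cost_bounds:
  fixes L2 :: "'a::euclidean_space \<Rightarrow> 'b::euclidean_space \<Rightarrow> real"
  assumes L1: "continuous_on UNIV L1" and L2: "continuous_on UNIV (\<lambda>(x, u). L2 x u)"
    and hom: "\<And>x u r. r > 0 \<Longrightarrow> L2 x (r *\<^sub>R u) = r * L2 x u"
    and conv: "\<And>x. convex_on UNIV (L2 x)"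
  obtains C where "0 \<le> C"
    "\<And>x p. x \<in> cball 0 R \<Longrightarrow> \<bar>homogeneous_cost L1 L2 x p\<bar> \<le> C * norm p"
    "\<And>x p q. x \<in> cball 0 R \<Longrightarrow>
       \<bar>homogeneous_cost L1 L2 x p - homogeneous_cost L1 L2 x q\<bar> \<le> C * norm (p - q)"
proof -
  have "bounded (L1 ` cball 0 R)"
    by (intro compact_imp_bounded compact_continuous_image continuous_on_subset[OF L1]) auto
  then obtain M1 where M1: "M1 > 0" "\<And>x. x \<in> cball 0 R \<Longrightarrow> \<bar>L1 x\<bar> \<le> M1" by (auto simp: bounded_pos)
  have "bounded ((\<lambda>(x, u). L2 x u) ` (cball 0 R \<times> sphere 0 1))"
    by (intro compact_imp_bounded compact_continuous_image continuous_on_subset[OF L2] compact_Times) auto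
  then obtain M2 where M2: "M2 > 0" "\<And>x u. x \<in> cball 0 R \<Longrightarrow> norm u = 1 \<Longrightarrow> \<bar>L2 x u\<bar> \<le> M2"
    unfolding bounded_pos by fastforce
  have L2b: "\<bar>L2 x w\<bar> \<le> M2 * norm w" if "x \<in> cball 0 R" for x w
    using homogeneous_diff_bound[of "L2 x" "\<lambda>_. 0" M2 w] hom M2(2)[OF that] by simp
  have L2l: "\<bar>L2 x w - L2 x w'\<bar> \<le> M2 * norm (w - w')" if x: "x \<in> cball 0 R" for x w w'
  proof -
    have *: "L2 x a - L2 x b \<le> M2 * norm (a - b)" for a b
      using homogeneous_convex_subadditive[of "L2 x" b "a - b", OF hom conv] L2b[OF x, of "a - b"] by simp
    show ?thesis using *[of w w'] *[of w' w] by (simp add: norm_minus_commute abs_le_iff)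
  qed
  have fs: "\<bar>fst p\<bar> \<le> norm p" "norm (snd p) \<le> norm p" for p :: "real \<times> 'b"
    using norm_fst_le[of "fst p" "snd p"] norm_snd_le[of "snd p" "fst p"] by simp_all
  show ?thesis
  proof
    show "0 \<le> M1 + M2" using M1 M2 by simp
    show lip: "\<bar>homogeneous_cost L1 L2 x p - homogeneous_cost L1 L2 x q\<bar> \<le> (M1 + M2) * norm (p - q)"
      if x: "x \<in> cball 0 R" for x p q
    proof -
      have "\<bar>L1 x * fst (p - q)\<bar> \<le> M1 * norm (p - q)"
        unfolding abs_mult using M1 x fs(1)[of "p - q"] by (intro mult_mono) auto
      moreover have "\<bar>L2 x (snd p) - L2 x (snd q)\<bar> \<le> M2 * norm (p - q)"
      proof -
        have "M2 * norm (snd (p - q)) \<le> M2 * norm (p - q)" 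
          by (rule mult_left_mono[OF fs(2)]) (use M2(1) in simp)
        then show ?thesis using L2l[OF x, of "snd p" "snd q"] by simp
      qed
      moreover have "homogeneous_cost L1 L2 x p - homogeneous_cost L1 L2 x q =
          L1 x * fst (p - q) + (L2 x (snd p) - L2 x (snd q))"
        by (simp add: homogeneous_cost_def right_diff_distrib)
      ultimately show ?thesis unfolding distrib_right by linarith
    qed
    show "\<bar>homogeneous_cost L1 L2 x p\<bar> \<le> (M1 + M2) * norm p" if x: "x \<in> cball 0 R" for x p
    proof -
      have "L2 x 0 = 0" by (rule homogeneous_zero) (rule hom)
      then have "homogeneous_cost L1 L2 x 0 = 0" by (simp add: homogeneous_cost_def)
      then show ?thesis using lip[OF x, of p 0] by simp
    qed
  qed
qed

text \<open>Compactness gives uniform continuity on bounded sets, while velocities are unbounded.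
  Homogeneity carries it from the unit sphere to all \<open>p\<close> with an error proportional to
  \<open>norm p\<close>.\<close>

lemma homogeneous_cost_uniformly_continuous:
  fixes L2 :: "'a::euclidean_space \<Rightarrow> 'b::euclidean_space \<Rightarrow> real"
  assumes L1: "continuous_on UNIV L1" and L2: "continuous_on UNIV (\<lambda>(x, u). L2 x u)"
    and hom: "\<And>x u r. r > 0 \<Longrightarrow> L2 x (r *\<^sub>R u) = r * L2 x u" and e: "\<epsilon> > 0"
  shows "\<exists>\<delta>>0. \<forall>x\<in>cball 0 R. \<forall>x'\<in>cball 0 R. norm (x - x') < \<delta> \<longrightarrow>
    (\<forall>p. \<bar>homogeneous_cost L1 L2 x p - homogeneous_cost L1 L2 x' p\<bar> \<le> \<epsilon> * norm p)"
proof -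
  have "uniformly_continuous_on (cball 0 R) L1"
    by (intro compact_uniformly_continuous continuous_on_subset[OF L1]) auto
  then obtain \<delta>1 where d1: "\<delta>1 > 0" "\<And>x x'. x \<in> cball 0 R \<Longrightarrow> x' \<in> cball 0 R \<Longrightarrow> dist x' x < \<delta>1 \<Longrightarrow>
      dist (L1 x') (L1 x) < \<epsilon> / 2"
    unfolding uniformly_continuous_on_def using e half_gt_zero by metis
  have "uniformly_continuous_on (cball 0 R \<times> sphere 0 1) (\<lambda>(x, u). L2 x u)"
    by (intro compact_uniformly_continuous continuous_on_subset[OF L2] compact_Times) auto
  then obtain \<delta>2 where d2: "\<delta>2 > 0" "\<And>z z'. z \<in> cball 0 R \<times> sphere 0 1 \<Longrightarrow> z' \<in> cball 0 R \<times> sphere 0 1 \<Longrightarrow>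
      dist z' z < \<delta>2 \<Longrightarrow> dist ((\<lambda>(x, u). L2 x u) z') ((\<lambda>(x, u). L2 x u) z) < \<epsilon> / 2"
    unfolding uniformly_continuous_on_def using e half_gt_zero by metis
  have main: "\<bar>homogeneous_cost L1 L2 x p - homogeneous_cost L1 L2 x' p\<bar> \<le> \<epsilon> * norm p"
    if x: "x \<in> cball 0 R" "x' \<in> cball 0 R" "norm (x - x') < min \<delta>1 \<delta>2" for x x' p
  proof -
    have fs: "\<bar>fst p\<bar> \<le> norm p" "norm (snd p) \<le> norm p"
      using norm_fst_le[of "fst p" "snd p"] norm_snd_le[of "snd p" "fst p"] by simp_all
    have "\<bar>L1 x - L1 x'\<bar> \<le> \<epsilon> / 2"
      using d1(2)[OF x(2,1)] x(3) by (simp add: dist_norm)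
    then have a: "\<bar>(L1 x - L1 x') * fst p\<bar> \<le> \<epsilon> / 2 * norm p"
      unfolding abs_mult using fs(1) e by (intro mult_mono) auto
    have "\<bar>L2 x (snd p) - L2 x' (snd p)\<bar> \<le> \<epsilon> / 2 * norm (snd p)"
    proof (rule homogeneous_diff_bound[OF hom hom])
      fix u :: 'b assume "norm u = 1"
      then show "\<bar>L2 x u - L2 x' u\<bar> \<le> \<epsilon> / 2"
        using d2(2)[of "(x', u)" "(x, u)"] x by (simp add: dist_norm dist_Pair_Pair)
    qed
    also have "\<dots> \<le> \<epsilon> / 2 * norm p" using fs(2) e by (intro mult_left_mono) auto
    finally have b: "\<bar>L2 x (snd p) - L2 x' (snd p)\<bar> \<le> \<epsilon> / 2 * norm p" .
    have "homogeneous_cost L1 L2 x p - homogeneous_cost L1 L2 x' p =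
        (L1 x - L1 x') * fst p + (L2 x (snd p) - L2 x' (snd p))"
      by (simp add: homogeneous_cost_def left_diff_distrib)
    moreover have "\<epsilon> * norm p = \<epsilon> / 2 * norm p + \<epsilon> / 2 * norm p" by simp
    ultimately show ?thesis using a b by linarith
  qed
  show ?thesis using d1(1) d2(1) main by (intro exI[of _ "min \<delta>1 \<delta>2"]) auto
qed

lemma ext_lagrangian_homogeneous:
  assumes L: "\<And>x u. L x u = L1 x + L2 x u"
    and hom: "\<And>x u r. r > 0 \<Longrightarrow> L2 x (r *\<^sub>R u) = r * L2 x u" and v: "0 \<le> v"
  shows "ext_lagrangian L y v w = ereal (homogeneous_cost L1 L2 y (v, w))"
proof -
  \<comment> \<open>The factor cancels in the homogeneous part for every positive
    \<open>\<eta>\<close>, so the limit at \<open>v = 0\<close> is the finite number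
    \<open>L2 y w\<close>.\<close>
  have *: "L y (w /\<^sub>R \<eta>) * \<eta> = L1 y * \<eta> + L2 y w" if "\<eta> > 0" for \<eta>
    using that hom[of "inverse \<eta>" y w] unfolding L by (simp add: field_simps)
  show ?thesis
  proof (cases "v > 0")
    case True
    then show ?thesis using *[OF True] by (simp add: ext_lagrangian_def homogeneous_cost_def)
  next
    case False
    with v have v0: "v = 0" by simp
    have "((\<lambda>\<eta>. ereal (L1 y * \<eta> + L2 y w)) \<longlongrightarrow> ereal (L1 y * 0 + L2 y w)) (at_right 0)"
      by (intro tendsto_intros)
    then have "((\<lambda>\<eta>. ereal (L y (w /\<^sub>R \<eta>) * \<eta>)) \<longlongrightarrow> ereal (L1 y * 0 + L2 y w)) (at_right 0)"
      by (rule Lim_transform_eventually)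
        (use * in \<open>auto simp: eventually_at_filter intro!: always_eventually\<close>)
    then have "Lim (at_right 0) (\<lambda>\<eta>. ereal (L y (w /\<^sub>R \<eta>) * \<eta>)) = ereal (L1 y * 0 + L2 y w)"
      by (intro tendsto_Lim) auto
    then show ?thesis using v0 by (simp add: ext_lagrangian_def homogeneous_cost_def)
  qed
qed

lemma ext_integral_cong_AE:
  assumes "AE t in M. h t = h' t"
  shows "ext_integral M h = ext_integral M h'"
proof -
  have "(\<integral>\<^sup>+ t. e2ennreal (h t) \<partial>M) = (\<integral>\<^sup>+ t. e2ennreal (h' t) \<partial>M)"
    "(\<integral>\<^sup>+ t. e2ennreal (- h t) \<partial>M) = (\<integral>\<^sup>+ t. e2ennreal (- h' t) \<partial>M)"
    using assms by (auto intro!: nn_integral_cong_AE elim!: eventually_mono)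
  then show ?thesis by (simp add: ext_integral_def)
qed

text \<open>Absolute integrability makes the positive and the negative part finite, so the extended
  difference is an ordinary one.\<close>

lemma ext_integral_absolutely_integrable:
  fixes h :: "real \<Rightarrow> real"
  assumes h: "h absolutely_integrable_on {a..b}"
  shows "ext_integral (lebesgue_on {a..b}) (\<lambda>t. ereal (h t)) = ereal (integral {a..b} h)"
proof -
  let ?M = "lebesgue_on {a..b}"
  have i: "integrable ?M h" using h by (simp add: integrable_lebesgue_on_Icc)
  then have fin: "(\<integral>\<^sup>+ t. ennreal (h t) \<partial>?M) < \<infinity>" "(\<integral>\<^sup>+ t. ennreal (- h t) \<partial>?M) < \<infinity>"
    unfolding real_integrable_def by (auto simp: less_top)
  have e: "enn2ereal x = ereal (enn2real x)" if "x < \<infinity>" for x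
    using that by (cases x) auto
  have "ext_integral ?M (\<lambda>t. ereal (h t)) =
      enn2ereal (\<integral>\<^sup>+ t. ennreal (h t) \<partial>?M) - enn2ereal (\<integral>\<^sup>+ t. ennreal (- h t) \<partial>?M)"
    by (simp add: ext_integral_def e2ennreal_ereal)
  also have "\<dots> = ereal (integral\<^sup>L ?M h)"
    unfolding e[OF fin(1)] e[OF fin(2)] real_lebesgue_integral_def[OF i] by simp
  finally show ?thesis using lebesgue_integral_eq_integral[OF i] by simp
qed

subsection \<open>Reduction to ordinary controls\<close>

text \<open>The first component of a continuous approximation may vanish, be negative or have the
  wrong integral. Absolute value plus \<open>\<eta>\<close> makes it positive, and division by its
  integral \<open>I\<close> normalizes it. Since \<open>I\<close> is within
  \<open>\<eta> * (1 + T)\<close> of 1, both corrections are small in mean.\<close>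

lemma approx_controls:
  fixes p :: "real \<Rightarrow> real \<times> 'b::euclidean_space"
  assumes p: "p absolutely_integrable_on {0..T}" and T: "0 < T" and N: "negligible N"
    and v: "\<And>t. t \<in> {0..T} - N \<Longrightarrow> 0 \<le> fst (p t)" and one: "integral {0..T} (\<lambda>t. fst (p t)) = 1"
    and d: "d > 0"
  obtains \<nu> \<omega> where "continuous_on UNIV \<nu>" "continuous_on UNIV \<omega>" "\<And>t. 0 < \<nu> t"
    "integral {0..T} \<nu> = 1" "integral {0..T} (\<lambda>t. norm ((\<nu> t, \<omega> t) - p t)) < d"
proof -
  \<comment> \<open>The errors add up to \<open>\<eta> * (1 + T)\<close> for normalizing,
    \<open>\<eta> * (1 + T)\<close> for the positive first component and \<open>\<eta>\<close> for
    the second; halving \<open>d\<close> makes the inequality strict.\<close>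
  define \<eta> where "\<eta> = d / 2 / (3 + 2 * T)"
  have "0 < d / 2 / c \<and> d / 2 / c * c < d" if "c > 0" for c using d that by simp
  from this[of "3 + 2 * T"] have eta: "\<eta> > 0" "\<eta> * (3 + 2 * T) < d" using T by (auto simp: \<eta>_def)
  \<comment> \<open>The absolute value changes \<open>p\<close> only on \<open>N\<close> and makes
    the first component nonnegative everywhere, so its distance to
    \<open>\<bar>fst (h t)\<bar>\<close> is controlled at every point.\<close>
  define p' where "p' = (\<lambda>t. (\<bar>fst (p t)\<bar>, snd (p t)))"
  have pp': "p' t = p t" if "t \<in> {0..T} - N" for t using v[OF that] by (simp add: p'_def)
  have p': "p' absolutely_integrable_on {0..T}"
    by (rule absolutely_integrable_spike[OF p N]) (rule pp')
  have v1: "integral {0..T} (\<lambda>t. fst (p' t)) = 1"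
    unfolding one[symmetric] by (rule integral_spike[OF N]) (simp add: pp')
  have vi: "(\<lambda>t. fst (p' t)) absolutely_integrable_on {0..T}"
    using absolutely_integrable_linear[OF p' bounded_linear_fst] by (simp add: o_def)
  from absolutely_integrable_approx_continuous[OF p' eta(1)] obtain h where
    h: "continuous_on UNIV h" "integral {0..T} (\<lambda>t. norm (p' t - h t)) < \<eta>" by blast
  note cS = continuous_on_subset[OF _ subset_UNIV]
  have hi: "h absolutely_integrable_on {0..T}" by (rule absolutely_integrable_continuous_real[OF cS[OF h(1)]])
  note D = absolutely_integrable_norm_diff[OF p' hi]
  define \<nu>0 where "\<nu>0 = (\<lambda>t. \<bar>fst (h t)\<bar> + \<eta>)"
  define I where "I = integral {0..T} \<nu>0"
  have c0: "continuous_on UNIV \<nu>0" unfolding \<nu>0_def using h(1) by (intro continuous_intros)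
  have i0: "\<nu>0 integrable_on {0..T}" by (rule integrable_continuous_real[OF cS[OF c0]])
  have De: "(\<lambda>t. norm (p' t - h t) + \<eta>) integrable_on {0..T}" by (intro integrable_add D integrable_const_ivl)
  have De': "integral {0..T} (\<lambda>t. norm (p' t - h t) + \<eta>) \<le> \<eta> * (1 + T)"
    using h(2) T by (subst integral_add[OF D]) (auto simp: algebra_simps)
  have close: "\<bar>\<nu>0 t - fst (p' t)\<bar> \<le> norm (p' t - h t) + \<eta>" for t
  proof -
    have "\<bar>fst (p' t - h t)\<bar> \<le> norm (p' t - h t)"
      using norm_fst_le[of "fst (p' t - h t)" "snd (p' t - h t)"] unfolding prod.collapse real_norm_def .
    moreover have "fst (p' t) \<ge> 0" by (simp add: p'_def)
    ultimately show ?thesis using eta(1) by (simp add: \<nu>0_def)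
  qed
  have "\<bar>I - 1\<bar> = norm (integral {0..T} (\<lambda>t. \<nu>0 t - fst (p' t)))"
    unfolding I_def v1[symmetric]
    using integral_diff[OF i0 set_lebesgue_integral_eq_integral(1)[OF vi]] by simp
  also have "\<dots> \<le> integral {0..T} (\<lambda>t. norm (p' t - h t) + \<eta>)"
    using close by (intro integral_norm_bound_integral De integrable_diff i0 set_lebesgue_integral_eq_integral(1)[OF vi]) auto
  finally have I1: "\<bar>I - 1\<bar> \<le> \<eta> * (1 + T)" using De' by simp
  have Ipos: "I > 0"
  proof -
    have "0 < integral {0..T} (\<lambda>t. \<eta>)" using eta T by simp
    also have "\<dots> \<le> I" unfolding I_def by (intro integral_le i0) (auto simp: \<nu>0_def)
    finally show ?thesis .
  qed
  define \<nu> where "\<nu> = (\<lambda>t. \<nu>0 t / I)"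
  have nu: "continuous_on UNIV \<nu>" "\<And>t. 0 < \<nu> t" "integral {0..T} \<nu> = 1"
  proof -
    show "continuous_on UNIV \<nu>" unfolding \<nu>_def using c0 Ipos by (intro continuous_intros) auto
    show "0 < \<nu> t" for t using eta Ipos by (simp add: \<nu>_def \<nu>0_def add_nonneg_pos)
    show "integral {0..T} \<nu> = 1" using Ipos by (simp add: \<nu>_def I_def)
  qed
  \<comment> \<open>Since \<open>\<nu>\<close> has integral 1, the normalizing error integrates to
    exactly \<open>\<bar>I - 1\<bar>\<close>.\<close>
  have nunu0: "\<bar>\<nu> t - \<nu>0 t\<bar> = \<bar>I - 1\<bar> * \<nu> t" for t
  proof -
    have "\<nu> t - \<nu>0 t = - ((I - 1) * \<nu> t)" using Ipos by (simp add: \<nu>_def field_simps)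
    then show ?thesis using nu(2)[of t] by (simp add: abs_mult)
  qed
  have nui: "\<nu> integrable_on {0..T}" by (rule integrable_continuous_real[OF cS[OF nu(1)]])
  let ?q = "\<lambda>t. (\<nu> t, snd (h t))"
  have cq: "continuous_on UNIV ?q" using nu(1) h(1) by (intro continuous_intros)
  have qi: "?q absolutely_integrable_on {0..T}" by (rule absolutely_integrable_continuous_real[OF cS[OF cq]])
  have pt: "norm (?q t - p' t) \<le> \<bar>I - 1\<bar> * \<nu> t + (norm (p' t - h t) + \<eta>) + norm (p' t - h t)" for t
  proof -
    have "norm (?q t - p' t) \<le> \<bar>\<nu> t - fst (p' t)\<bar> + norm (snd (h t) - snd (p' t))"
      using norm_Pair_le[of "\<nu> t - fst (p' t)" "snd (h t) - snd (p' t)"] by (simp add: minus_prod_def)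
    moreover have "\<bar>\<nu> t - fst (p' t)\<bar> \<le> \<bar>I - 1\<bar> * \<nu> t + (norm (p' t - h t) + \<eta>)"
      using close[of t] nunu0[of t] by linarith
    moreover have "norm (snd (h t) - snd (p' t)) \<le> norm (p' t - h t)"
      using norm_snd_le[of "snd (p' t - h t)" "fst (p' t - h t)"] unfolding prod.collapse
      by (simp only: snd_diff norm_minus_commute)
    ultimately show ?thesis by linarith
  qed
  have "integral {0..T} (\<lambda>t. norm (?q t - p t)) = integral {0..T} (\<lambda>t. norm (?q t - p' t))"
    by (rule integral_spike[OF N]) (simp add: pp')
  also have "\<dots> \<le> integral {0..T} (\<lambda>t. \<bar>I - 1\<bar> * \<nu> t + (norm (p' t - h t) + \<eta>) + norm (p' t - h t))"
    by (intro integral_le absolutely_integrable_norm_diff qi p' integrable_add De D integrable_on_mult_right nui pt)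
  also have "\<dots> = \<bar>I - 1\<bar> * 1 + integral {0..T} (\<lambda>t. norm (p' t - h t) + \<eta>) + integral {0..T} (\<lambda>t. norm (p' t - h t))"
    by (simp only: integral_add[OF integrable_add[OF integrable_on_mult_right[OF nui] De] D]
        integral_add[OF integrable_on_mult_right[OF nui] De] integral_mult_right nu(3))
  also have "\<dots> \<le> \<eta> * (1 + T) + \<eta> * (1 + T) + \<eta>" 
    using add_mono[OF add_mono[OF I1 De'] less_imp_le[OF h(2)]] by (simp only: mult_1_right)
  also have "\<dots> = \<eta> * (3 + 2 * T)" by (simp add: algebra_simps)
  also have "\<dots> < d" by (rule eta(2))
  finally have "integral {0..T} (\<lambda>t. norm (?q t - p t)) < d" .
  with nu show ?thesis by (intro that[of \<nu> "\<lambda>t. snd (h t)"]) (auto intro!: continuous_intros h(1))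
qed

text \<open>The field is homogeneous in the velocity, so pulling a factor \<open>\<nu>\<close> out
  of it and substituting \<open>t = V s\<close> turns the velocity \<open>(\<nu>, \<omega>)\<close>
  into \<open>(1, u)\<close>. The last clause is the same substitution for an arbitrary continuous
  integrand, later the cost.\<close>

lemma reparametrize_to_unit_time:
  fixes f :: "real^'n \<Rightarrow> real^'n" and g :: "'k::finite \<Rightarrow> real^'n \<Rightarrow> real^'n"
    and \<nu> :: "real \<Rightarrow> real" and \<omega> :: "real \<Rightarrow> real^'k" and z :: "real \<Rightarrow> real^'n"
  assumes f: "locally_lipschitz f" and g: "\<And>i. locally_lipschitz (g i)" and T: "0 < T"
    and \<nu>: "continuous_on {0..T} \<nu>" "\<And>t. 0 < \<nu> t" "integral {0..T} \<nu> = 1"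
    and \<omega>: "continuous_on {0..T} \<omega>"
    and z: "continuous_on {0..T} z"
      "\<And>t. t \<in> {0..T} \<Longrightarrow> z t = x0 + integral {0..t} (\<lambda>s. control_field f g (z s) (\<nu> s, \<omega> s))"
  obtains u x where "continuous_on {0..1} u" "solves_on f g x0 (\<lambda>_. 1) u 1 x" "x 1 = z T"
    "\<And>F :: real^'n \<Rightarrow> real^'k \<Rightarrow> real. continuous_on UNIV (\<lambda>(x, u). F x u) \<Longrightarrow>
       integral {0..1} (\<lambda>t. F (x t) (u t)) = integral {0..T} (\<lambda>s. \<nu> s * F (z s) (\<omega> s /\<^sub>R \<nu> s))"
proof -
  define V where "V = (\<lambda>t. integral {0..t} \<nu>)"
  have dV: "(V has_real_derivative \<nu> t) (at t within {0..T})" if "t \<in> {0..T}" for t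
    unfolding V_def by (rule integral_has_real_derivative[OF \<nu>(1) that])
  have cV: "continuous_on {0..T} V"
    unfolding V_def by (rule indefinite_integral_continuous_1[OF integrable_continuous_real[OF \<nu>(1)]])
  have V01: "V 0 = 0" "V T = 1" using \<nu>(3) by (simp_all add: V_def)
  have mono: "V s < V t" if "s \<in> {0..T}" "t \<in> {0..T}" "s < t" for s t
  proof (rule DERIV_pos_imp_increasing_open[OF that(3)])
    fix r assume r: "s < r" "r < t"
    then have "r \<in> {0..T}" "at r within {0..T} = at r" using that by (auto simp: at_within_Icc_at)
    then show "\<exists>y. (V has_real_derivative y) (at r) \<and> 0 < y" using dV[of r] \<nu>(2)[of r] by auto
  qed (use that in \<open>auto intro: continuous_on_subset[OF cV]\<close>)
  have inj: "inj_on V {0..T}"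
  proof (rule inj_onI)
    fix s t assume "s \<in> {0..T}" "t \<in> {0..T}" "V s = V t"
    then show "s = t" using mono[of s t] mono[of t s] by (cases s t rule: linorder_cases) auto
  qed
  have le: "V s \<le> V t" if "s \<in> {0..T}" "t \<in> {0..T}" "s \<le> t" for s t
    using mono[OF that(1,2)] that(3) by (cases "s = t") auto
  have img: "V ` {0..T} = {0..1}"
  proof
    show "V ` {0..T} \<subseteq> {0..1}" using le[of 0] le[of _ T] V01 T by fastforce
    show "{0..1} \<subseteq> V ` {0..T}"
    proof
      fix c :: real assume "c \<in> {0..1}"
      then have "\<exists>t\<ge>0. t \<le> T \<and> V t = c" using T V01 cV by (intro IVT') auto
      then show "c \<in> V ` {0..T}" by auto
    qed
  qed
  \<comment> \<open>The inverse of a continuous injection on a compact interval is continuous, which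
    makes \<open>u\<close> and \<open>x\<close> continuous.\<close>
  define \<sigma> where "\<sigma> = the_inv_into {0..T} V"
  have c\<sigma>: "continuous_on {0..1} \<sigma>"
    using continuous_on_inv_into[OF cV compact_Icc inj] unfolding img \<sigma>_def .
  have \<sigma>V: "\<sigma> (V s) = s" if "s \<in> {0..T}" for s
    unfolding \<sigma>_def by (rule the_inv_into_f_f[OF inj that])
  have V\<sigma>: "V (\<sigma> t) = t" "\<sigma> t \<in> {0..T}" if "t \<in> {0..1}" for t
  proof -
    have "t \<in> V ` {0..T}" using that img by simp
    then obtain s where s: "s \<in> {0..T}" "t = V s" by blast
    then show "V (\<sigma> t) = t" "\<sigma> t \<in> {0..T}" using \<sigma>V[OF s(1)] by simp_all
  qed
  define u where "u = (\<lambda>t. \<omega> (\<sigma> t) /\<^sub>R \<nu> (\<sigma> t))"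
  define x where "x = (\<lambda>t. z (\<sigma> t))"
  have sub: "\<sigma> ` {0..1} \<subseteq> {0..T}" using V\<sigma>(2) by blast
  have cu: "continuous_on {0..1} u"
    unfolding u_def using \<nu>(2)
    by (intro continuous_intros continuous_on_compose2[OF \<omega> c\<sigma> sub] continuous_on_compose2[OF \<nu>(1) c\<sigma> sub])
      (simp add: less_imp_neq[symmetric])
  have cx: "continuous_on {0..1} x" unfolding x_def by (rule continuous_on_compose2[OF z(1) c\<sigma> sub])
  have sb: "((\<lambda>s. \<nu> s *\<^sub>R h (V s)) has_integral integral {0..V r} h) {0..r}"
    if h: "continuous_on {0..1} h" and r: "r \<in> {0..T}" for h :: "real \<Rightarrow> 'c::euclidean_space" and r
  proof -
    have "((\<lambda>s. \<nu> s *\<^sub>R h (V s)) has_integral integral {V 0..V r} h) {0..r}"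
    proof (rule has_integral_substitution[OF _ _ _ h])
      show "V ` {0..r} \<subseteq> {0..1}" unfolding img[symmetric] using r by (intro image_mono) auto
      show "V 0 \<le> V r" using r T by (intro le) auto
      fix s assume "s \<in> {0..r}"
      then have "(V has_real_derivative \<nu> s) (at s within {0..T})" using r by (intro dV) auto
      then show "(V has_real_derivative \<nu> s) (at s within {0..r})"
        by (rule DERIV_subset) (use r in auto)
    qed (use r in auto)
    then show ?thesis by (simp add: V01)
  qed
  let ?h = "\<lambda>t. control_field f g (x t) (1, u t)"
  have c1u: "continuous_on {0..1} (\<lambda>t. (x t, 1::real, u t))" using cx cu by (intro continuous_intros)
  have ch: "continuous_on {0..1} ?h"
    using continuous_on_compose2[OF continuous_on_control_field[OF f g] c1u] by simp
  have xeq: "x t = x0 + integral {0..t} ?h" if t: "t \<in> {0..1}" for t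
  proof -
    have "((\<lambda>s. \<nu> s *\<^sub>R ?h (V s)) has_integral integral {0..V (\<sigma> t)} ?h) {0..\<sigma> t}"
      by (rule sb[OF ch V\<sigma>(2)[OF t]])
    then have "integral {0..t} ?h = integral {0..\<sigma> t} (\<lambda>s. \<nu> s *\<^sub>R ?h (V s))"
      unfolding V\<sigma>(1)[OF t] by (rule integral_unique[symmetric])
    also have "\<dots> = integral {0..\<sigma> t} (\<lambda>s. control_field f g (z s) (\<nu> s, \<omega> s))"
    proof (rule Henstock_Kurzweil_Integration.integral_cong)
      fix s assume "s \<in> {0..\<sigma> t}"
      then have "s \<in> {0..T}" using V\<sigma>(2)[OF t] by auto
      then have "\<nu> s *\<^sub>R ?h (V s) = control_field f g (z s) (\<nu> s *\<^sub>R (1, \<omega> s /\<^sub>R \<nu> s))"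
        by (simp only: x_def u_def \<sigma>V control_field_scaleR)
      also have "\<nu> s *\<^sub>R (1, \<omega> s /\<^sub>R \<nu> s) = (\<nu> s, \<omega> s)" using \<nu>(2)[of s] by simp
      finally show "\<nu> s *\<^sub>R ?h (V s) = control_field f g (z s) (\<nu> s, \<omega> s)" .
    qed
    finally show ?thesis using z(2)[OF V\<sigma>(2)[OF t]] by (simp add: x_def)
  qed
  have dx: "(x has_vector_derivative ?h t) (at t within {0..1})" if t: "t \<in> {0..1}" for t
  proof -
    have "((\<lambda>t. x0 + integral {0..t} ?h) has_vector_derivative 0 + ?h t) (at t within {0..1})"
      by (intro has_vector_derivative_add has_vector_derivative_const integral_has_vector_derivative[OF ch t])
    then have "((\<lambda>t. x0 + integral {0..t} ?h) has_vector_derivative ?h t) (at t within {0..1})" by simp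
    then show ?thesis
      by (rule has_vector_derivative_transform[OF t, rotated]) (rule xeq)
  qed
  \<comment> \<open>The control is continuous, hence the velocity of \<open>x\<close> is bounded and
    \<open>x\<close> is Lipschitz; this gives the absolute continuity demanded by
    \<open>solves_on\<close>.\<close>
  have "bounded (?h ` {0..1})" by (intro compact_imp_bounded compact_continuous_image ch) auto
  then obtain C where C: "C > 0" "\<And>t. t \<in> {0..1} \<Longrightarrow> norm (?h t) \<le> C" by (auto simp: bounded_pos)
  have "C-lipschitz_on {0..1} x"
  proof (rule bounded_derivative_imp_lipschitz)
    show "(x has_derivative (\<lambda>r. r *\<^sub>R ?h t)) (at t within {0..1})" if "t \<in> {0..1}" for t
      using dx[OF that] unfolding has_vector_derivative_def .
    show "onorm (\<lambda>r. r *\<^sub>R ?h t) \<le> C" if "t \<in> {0..1}" for t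
    proof (rule onorm_bound)
      show "norm (r *\<^sub>R ?h t) \<le> C * norm r" for r :: real
        using mult_left_mono[OF C(2)[OF that], of "\<bar>r\<bar>"] by (simp add: mult.commute)
    qed (use C(1) in simp)
  qed (use C in auto)
  then have ac: "abs_cont_on {0..1} x" by (rule lipschitz_imp_abs_cont_on)
  have x0: "x 0 = x0" using xeq[of 0] by simp
  have "solves_on f g x0 (\<lambda>_. 1) u 1 x"
    unfolding solves_on_def
  proof (intro conjI ac x0)
    show "AE t in lebesgue_on {0..1}. (x has_vector_derivative control_system f g (x t) 1 (u t)) (at t within {0..1})"
      by (rule AE_I2) (use dx in \<open>simp add: control_field_def\<close>)
  qed
  moreover have "x 1 = z T" using \<sigma>V[of T] V01 T by (simp add: x_def)
  moreover have "integral {0..1} (\<lambda>t. F (x t) (u t)) = integral {0..T} (\<lambda>s. \<nu> s * F (z s) (\<omega> s /\<^sub>R \<nu> s))"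
    if F: "continuous_on UNIV (\<lambda>(x, u). F x u)" for F :: "real^'n \<Rightarrow> real^'k \<Rightarrow> real"
  proof -
    have "continuous_on {0..1} (\<lambda>t. (x t, u t))" using cx cu by (intro continuous_intros)
    from continuous_on_compose2[OF F this] have cF: "continuous_on {0..1} (\<lambda>t. F (x t) (u t))" by simp
    have "integral {0..1} (\<lambda>t. F (x t) (u t)) = integral {0..T} (\<lambda>s. \<nu> s *\<^sub>R F (x (V s)) (u (V s)))"
      using integral_unique[OF sb[OF cF, of T]] T V01 by simp
    also have "\<dots> = integral {0..T} (\<lambda>s. \<nu> s * F (z s) (\<omega> s /\<^sub>R \<nu> s))"
      by (rule Henstock_Kurzweil_Integration.integral_cong) (simp add: x_def u_def \<sigma>V)
    finally show ?thesis .
  qed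
  ultimately show ?thesis using that[OF cu] by blast
qed

text \<open>Homogeneity forces \<open>L2 x 0 = 0\<close>, so \<open>L1\<close> is \<open>L\<close>
  at \<open>u = 0\<close> and inherits its continuity; \<open>L2\<close> is the difference, and for
  fixed \<open>x\<close> it differs from \<open>L\<close> by a constant.\<close>

lemma homogeneous_parts:
  fixes L :: "'a::euclidean_space \<Rightarrow> 'b::euclidean_space \<Rightarrow> real"
  assumes Lc: "continuous_on UNIV (\<lambda>(x, u). L x u)" and conv: "\<And>x. convex_on UNIV (L x)"
    and L: "\<And>x u. L x u = L1 x + L2 x u"
    and hom: "\<And>x u r. r > 0 \<Longrightarrow> L2 x (r *\<^sub>R u) = r * L2 x u"
  shows "continuous_on UNIV L1" "continuous_on UNIV (\<lambda>(x, u). L2 x u)" "convex_on UNIV (L2 x)"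
proof -
  have L20: "L2 x 0 = 0" for x by (rule homogeneous_zero) (rule hom)
  show L1: "continuous_on UNIV L1"
  proof -
    have "continuous_on UNIV (\<lambda>x. (\<lambda>(x, u). L x u) (x, 0))"
      by (rule continuous_on_compose2[OF Lc]) (auto intro!: continuous_intros)
    then show ?thesis by (simp add: L L20)
  qed
  show L2: "continuous_on UNIV (\<lambda>(x, u). L2 x u)"
  proof -
    have "continuous_on UNIV (\<lambda>z::'a \<times> 'b. L1 (fst z))"
      by (rule continuous_on_compose2[OF L1]) (auto intro: continuous_intros)
    from continuous_on_diff[OF Lc this] show ?thesis by (simp add: L split_def)
  qed
  show "convex_on UNIV (L2 x)"
  proof (rule convex_onI)
    fix t u u' assume t: "0 < t" "t < (1::real)"
    have "L x ((1 - t) *\<^sub>R u + t *\<^sub>R u') \<le> (1 - t) * L x u + t * L x u'"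
      using t by (intro convex_onD[OF conv]) auto
    then show "L2 x ((1 - t) *\<^sub>R u + t *\<^sub>R u') \<le> (1 - t) * L2 x u + t * L2 x u'"
      by (simp add: L algebra_simps)
  qed simp
qed

lemma homogeneous_cost_absolutely_integrable:
  fixes L2 :: "'a::euclidean_space \<Rightarrow> 'b::euclidean_space \<Rightarrow> real"
    and y :: "real \<Rightarrow> 'a" and p :: "real \<Rightarrow> real \<times> 'b"
  assumes L1: "continuous_on UNIV L1" and L2: "continuous_on UNIV (\<lambda>(x, u). L2 x u)"
    and hom: "\<And>x u r. r > 0 \<Longrightarrow> L2 x (r *\<^sub>R u) = r * L2 x u"
    and conv: "\<And>x. convex_on UNIV (L2 x)"
    and y: "continuous_on {a..b} y" and p: "p absolutely_integrable_on {a..b}"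
  shows "(\<lambda>t. homogeneous_cost L1 L2 (y t) (p t)) absolutely_integrable_on {a..b}"
proof -
  have "bounded (y ` {a..b})" by (intro compact_imp_bounded compact_continuous_image y) auto
  then obtain R where R: "R > 0" "\<And>t. t \<in> {a..b} \<Longrightarrow> y t \<in> cball 0 R" by (auto simp: bounded_pos)
  from homogeneous_cost_bounds[OF L1 L2 hom conv, of R] obtain C where C: "0 \<le> C" "\<And>x p. x \<in> cball 0 R \<Longrightarrow> \<bar>homogeneous_cost L1 L2 x p\<bar> \<le> C * norm p"
    "\<And>x p q. x \<in> cball 0 R \<Longrightarrow>
       \<bar>homogeneous_cost L1 L2 x p - homogeneous_cost L1 L2 x q\<bar> \<le> C * norm (p - q)"
    by blast
  show ?thesis
  proof (rule absolutely_integrable_compose_linear_growth[OF homogeneous_cost_continuous[OF L1 L2] _ y p])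
    show "norm (homogeneous_cost L1 L2 (y t) (p t)) \<le> C * norm (p t)" if "t \<in> {a..b}" for t
      unfolding real_norm_def by (rule C(2)[OF R(2)[OF that]])
  qed
qed

text \<open>Tolerances are chosen backwards: the accuracy of cost and end point dictates how close
  the trajectories must be, and this dictates how close the velocities must be.\<close>

lemma ordinary_control_approx:
  fixes f :: "real^'n \<Rightarrow> real^'n" and g :: "'k::finite \<Rightarrow> real^'n \<Rightarrow> real^'n"
    and L :: "real^'n \<Rightarrow> real^'k \<Rightarrow> real"
    and y :: "real \<Rightarrow> real^'n" and p :: "real \<Rightarrow> real \<times> (real^'k)"
  assumes f: "locally_lipschitz f" and g: "\<And>i. locally_lipschitz (g i)"
    and Lc: "continuous_on UNIV (\<lambda>(x, u). L x u)" and conv: "\<And>x. convex_on UNIV (L x)"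
    and L: "\<And>x u. L x u = L1 x + L2 x u"
    and hom: "\<And>x u r. r > 0 \<Longrightarrow> L2 x (r *\<^sub>R u) = r * L2 x u"
    and T: "0 < T" and p: "p absolutely_integrable_on {0..T}"
    and N: "negligible N" "\<And>t. t \<in> {0..T} - N \<Longrightarrow> 0 \<le> fst (p t)"
    and one: "integral {0..T} (\<lambda>t. fst (p t)) = 1"
    and y: "continuous_on {0..T} y"
      "\<And>t. t \<in> {0..T} \<Longrightarrow> y t = x0 + integral {0..t} (\<lambda>s. control_field f g (y s) (p s))"
    and e: "\<epsilon> > 0" "\<epsilon>' > 0"
  obtains u where "u \<in> near_feasible f g x0 (y T) \<epsilon>"
    "ordinary_cost f g L x0 u \<le> ereal (integral {0..T} (\<lambda>t. homogeneous_cost L1 L2 (y t) (p t)) + \<epsilon>')"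
proof -
  let ?\<Phi> = "control_field f g" and ?\<Lambda> = "homogeneous_cost L1 L2"
  have L1: "continuous_on UNIV L1" by (rule homogeneous_parts(1)[OF Lc conv L hom])
  have L2: "continuous_on UNIV (\<lambda>(x, u). L2 x u)" by (rule homogeneous_parts(2)[OF Lc conv L hom])
  have conv2: "convex_on UNIV (L2 x)" for x by (rule homogeneous_parts(3)[OF Lc conv L hom])
  have "bounded (y ` {0..T})" by (intro compact_imp_bounded compact_continuous_image y) auto
  then obtain R0 where R0: "R0 > 0" "\<And>t. t \<in> {0..T} \<Longrightarrow> norm (y t) \<le> R0" by (auto simp: bounded_pos)
  \<comment> \<open>The extra unit is the margin within which the perturbed trajectory may
    move.\<close>
  define R where "R = R0 + 1"
  have R: "0 \<le> R" "\<And>t. t \<in> {0..T} \<Longrightarrow> norm (y t) + 1 \<le> R" using R0 by (auto simp: R_def)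
  have yR: "y ` {0..T} \<subseteq> cball 0 R" using R(2) by fastforce
  from control_field_lipschitz[of f g R, OF f g] obtain K where K: "0 \<le> K"
    "\<And>x x' p. x \<in> cball 0 R \<Longrightarrow> x' \<in> cball 0 R \<Longrightarrow>
       norm (?\<Phi> x p - ?\<Phi> x' p) \<le> K * norm (x - x') * norm p" by blast
  from control_field_bound[of f g R, OF f g R(1)] obtain B where B: "0 \<le> B"
    "\<And>x p. x \<in> cball 0 R \<Longrightarrow> norm (?\<Phi> x p) \<le> B * norm p" by blast
  from homogeneous_cost_bounds[OF L1 L2 hom conv2, of R] obtain C where C: "0 \<le> C"
    "\<And>x p. x \<in> cball 0 R \<Longrightarrow> \<bar>?\<Lambda> x p\<bar> \<le> C * norm p"
    "\<And>x p q. x \<in> cball 0 R \<Longrightarrow> \<bar>?\<Lambda> x p - ?\<Lambda> x q\<bar> \<le> C * norm (p - q)"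
    by blast
  have uc: "\<exists>\<delta>>0. \<forall>x\<in>cball 0 R. \<forall>x'\<in>cball 0 R. norm (x - x') < \<delta> \<longrightarrow>
      (\<forall>p. \<bar>?\<Lambda> x p - ?\<Lambda> x' p\<bar> \<le> \<epsilon> * norm p)" if "\<epsilon> > 0" for \<epsilon>
    by (rule homogeneous_cost_uniformly_continuous[OF L1 L2 hom that])
  from integral_approx[OF homogeneous_cost_continuous[OF L1 L2] C(2,3) uc C(1) p y(1) yR e(2)]
  obtain d1 where d1: "d1 > 0"
    "\<And>q z. continuous_on {0..T} q \<Longrightarrow> continuous_on {0..T} z \<Longrightarrow> z ` {0..T} \<subseteq> cball 0 R \<Longrightarrow>
      (\<And>t. t \<in> {0..T} \<Longrightarrow> norm (z t - y t) < d1) \<Longrightarrow>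
      integral {0..T} (\<lambda>s. norm (q s - p s)) < d1 \<Longrightarrow>
      \<bar>integral {0..T} (\<lambda>s. ?\<Lambda> (z s) (q s)) - integral {0..T} (\<lambda>s. ?\<Lambda> (y s) (p s))\<bar> < \<epsilon>'"
    by blast
  \<comment> \<open>One bound on the trajectory serves twice: \<open>\<epsilon>\<close> for the end
    point, \<open>d1\<close> for the cost.\<close>
  have "min d1 \<epsilon> > 0" using d1(1) e(1) by simp
  from integral_equation_approx[OF continuous_on_control_field[OF f g] control_field_diff B(2) K(2) B(1) K(1)
      less_imp_le[OF T] R(1) p y(1) R(2) y(2) this]
  obtain d2 where d2: "d2 > 0"
    "\<And>q. continuous_on {0..T} q \<Longrightarrow> integral {0..T} (\<lambda>s. norm (q s - p s)) < d2 \<Longrightarrow>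
      \<exists>z. continuous_on {0..T} z \<and> (\<forall>t\<in>{0..T}. z t = x0 + integral {0..t} (\<lambda>s. ?\<Phi> (z s) (q s))) \<and>
        (\<forall>t\<in>{0..T}. norm (z t - y t) < min d1 \<epsilon> \<and> z t \<in> cball 0 R)"
    by blast
  have "min d1 d2 > 0" using d1(1) d2(1) by simp
  from approx_controls[OF p T N one this] obtain \<nu> \<omega> where nw: "continuous_on UNIV \<nu>" "continuous_on UNIV \<omega>"
    "\<And>t. 0 < \<nu> t" "integral {0..T} \<nu> = 1"
    "integral {0..T} (\<lambda>t. norm ((\<nu> t, \<omega> t) - p t)) < min d1 d2" by blast
  have c\<nu>: "continuous_on {0..T} \<nu>" and c\<omega>: "continuous_on {0..T} \<omega>"
    using continuous_on_subset[OF nw(1) subset_UNIV] continuous_on_subset[OF nw(2) subset_UNIV] .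
  have cq: "continuous_on {0..T} (\<lambda>t. (\<nu> t, \<omega> t))" by (intro continuous_intros c\<nu> c\<omega>)
  from d2(2)[OF cq] nw(5) obtain z where z: "continuous_on {0..T} z"
    "\<And>t. t \<in> {0..T} \<Longrightarrow> z t = x0 + integral {0..t} (\<lambda>s. ?\<Phi> (z s) (\<nu> s, \<omega> s))"
    "\<And>t. t \<in> {0..T} \<Longrightarrow> norm (z t - y t) < min d1 \<epsilon>" "\<And>t. t \<in> {0..T} \<Longrightarrow> z t \<in> cball 0 R" by auto
  have cost: "\<bar>integral {0..T} (\<lambda>s. ?\<Lambda> (z s) (\<nu> s, \<omega> s)) - integral {0..T} (\<lambda>s. ?\<Lambda> (y s) (p s))\<bar> < \<epsilon>'"
  proof (rule d1(2)[OF cq z(1)])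
    show "z ` {0..T} \<subseteq> cball 0 R" using z(4) by blast
    show "norm (z t - y t) < d1" if "t \<in> {0..T}" for t using z(3)[OF that] by simp
  qed (use nw(5) in simp)
  from reparametrize_to_unit_time[OF f g T c\<nu> nw(3,4) c\<omega> z(1,2)]
  obtain u x where ux: "continuous_on {0..1} u" "solves_on f g x0 (\<lambda>_. 1) u 1 x" "x 1 = z T"
    "\<And>F :: real^'n \<Rightarrow> real^'k \<Rightarrow> real. continuous_on UNIV (\<lambda>(x, u). F x u) \<Longrightarrow>
       integral {0..1} (\<lambda>t. F (x t) (u t)) = integral {0..T} (\<lambda>s. \<nu> s * F (z s) (\<omega> s /\<^sub>R \<nu> s))" by blast
  have ui: "u absolutely_integrable_on {0..1}" by (rule absolutely_integrable_continuous_real[OF ux(1)])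
  have "continuous_on {0..1} (\<lambda>t. (1::real, u t))" by (intro continuous_intros ux(1))
  then have ui1: "(\<lambda>t. (1::real, u t)) absolutely_integrable_on {0..1}"
    by (rule absolutely_integrable_continuous_real)
  have tr: "traj f g x0 (\<lambda>_. 1) u t = x t" if "t \<in> {0..1}" for t
    by (rule traj_eq[OF f g ui1 ux(2) that])
  show ?thesis
  proof
    have "norm (z T - y T) < \<epsilon>" using z(3)[of T] T by simp
    then show "u \<in> near_feasible f g x0 (y T) \<epsilon>"
      using ui ux(2,3) tr[of 1] by (auto simp: near_feasible_def traj_defined_def)
    have cx: "continuous_on {0..1} x" by (rule solves_on_integral(1)[OF ux(2), of 1]) simp
    have "continuous_on {0..1} (\<lambda>t. (\<lambda>(x, u). L x u) (x t, u t))"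
      by (rule continuous_on_compose2[OF Lc]) (auto intro!: continuous_intros cx ux(1))
    then have Li: "(\<lambda>t. L (x t) (u t)) absolutely_integrable_on {0..1}"
      by (intro absolutely_integrable_continuous_real) simp
    have "ordinary_cost f g L x0 u = ext_integral (lebesgue_on {0..1}) (\<lambda>t. ereal (L (x t) (u t)))"
      unfolding ordinary_cost_def
      by (rule ext_integral_cong_AE, rule AE_I2) (simp add: tr)
    also have "\<dots> = ereal (integral {0..1} (\<lambda>t. L (x t) (u t)))"
      by (rule ext_integral_absolutely_integrable[OF Li])
    also have "integral {0..1} (\<lambda>t. L (x t) (u t)) = integral {0..T} (\<lambda>s. \<nu> s * L (z s) (\<omega> s /\<^sub>R \<nu> s))"
      by (rule ux(4)[OF Lc])
    \<comment> \<open>Homogeneity makes this an identity: passing to the ordinary control adds no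
      further error.\<close>
    also have "\<dots> = integral {0..T} (\<lambda>s. ?\<Lambda> (z s) (\<nu> s, \<omega> s))"
    proof (rule Henstock_Kurzweil_Integration.integral_cong)
      fix s
      have "L2 (z s) (\<omega> s /\<^sub>R \<nu> s) = inverse (\<nu> s) * L2 (z s) (\<omega> s)" using nw(3)[of s] by (intro hom) simp
      then show "\<nu> s * L (z s) (\<omega> s /\<^sub>R \<nu> s) = ?\<Lambda> (z s) (\<nu> s, \<omega> s)"
        using nw(3)[of s] by (simp add: L homogeneous_cost_def field_simps)
    qed
    finally show "ordinary_cost f g L x0 u \<le> ereal (integral {0..T} (\<lambda>t. ?\<Lambda> (y t) (p t)) + \<epsilon>')"
      using cost by simp
  qed
qed

section \<open>Velocity, clock and final parameter of a generalized control\<close>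

lemma control_path_velocity:
  fixes P :: "real \<Rightarrow> real \<times> (real^'k)"
  assumes P: "P \<in> control_paths" and b: "0 \<le> b"
  shows "(\<lambda>t. (vdot P t, wdot P t)) absolutely_integrable_on {0..b}"
    "continuous_on {0..b} P"
    "0 \<le> s \<Longrightarrow> s \<le> b \<Longrightarrow> ((\<lambda>t. vdot P t) has_integral fst (P b) - fst (P s)) {s..b}"
    "\<exists>N. negligible N \<and> (\<forall>t\<in>{0..b} - N. 0 \<le> vdot P t)"
proof -
  have ac: "abs_cont_on {s..b} P" if "0 \<le> s" for s
    using P that by (auto simp: control_paths_def locally_abs_cont_on_def)
  \<comment> \<open>\<open>vdot\<close> and \<open>wdot\<close> are two-sided derivatives; the
    endpoints join the exceptional set because differentiability is established in the open
    interval.\<close>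
  define N where "N = {t \<in> {0<..<b}. \<not> P differentiable at t} \<union> {0, b}"
  have N: "negligible N"
    unfolding N_def by (intro negligible_Un abs_cont_differentiable_ae[OF ac b]) auto
  have der: "(P has_vector_derivative (vdot P t, wdot P t)) (at t within S)" if "t \<in> {0..b} - N" for t S
  proof -
    have "P differentiable at t" using that by (auto simp: N_def)
    then have "(P has_vector_derivative vector_derivative P (at t)) (at t)"
      by (simp add: vector_derivative_works)
    then show ?thesis by (simp add: vdot_def wdot_def has_vector_derivative_at_within)
  qed
  show "(\<lambda>t. (vdot P t, wdot P t)) absolutely_integrable_on {0..b}"
    by (rule abs_cont_derivative_absolutely_integrable[OF ac b N der]) auto
  show "continuous_on {0..b} P" by (rule abs_cont_on_imp_continuous_on[OF ac]) simp
  show "((\<lambda>t. vdot P t) has_integral fst (P b) - fst (P s)) {s..b}" if s: "0 \<le> s" "s \<le> b"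
  proof -
    have "((\<lambda>t. (vdot P t, wdot P t)) has_integral P b - P s) {s..b}"
      by (rule abs_cont_has_integral[OF ac[OF s(1)] s(2) N der]) (use s(1) in auto)
    from has_integral_linear[OF this bounded_linear_fst] show ?thesis by (simp add: o_def)
  qed
  have "AE t in lebesgue_on {0..}. vdot P t \<ge> 0" using P by (simp add: control_paths_def)
  then have "AE t in lebesgue. t \<in> {0..} \<longrightarrow> vdot P t \<ge> 0" by (subst (asm) AE_restrict_space_iff) auto
  then have "AE t in lebesgue. t \<in> {0..b} \<longrightarrow> vdot P t \<ge> 0" by (rule eventually_mono) auto
  then have "AE t in lebesgue_on {0..b}. vdot P t \<ge> 0" by (subst AE_restrict_space_iff) auto
  then show "\<exists>N. negligible N \<and> (\<forall>t\<in>{0..b} - N. 0 \<le> vdot P t)"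
    by (rule AE_lebesgue_on_negligible) blast
qed

text \<open>\<open>V\<close> is continuous and nondecreasing and exceeds 1 somewhere, so the set
  where \<open>V \<le> 1\<close> is compact and \<open>V\<close> equals 1 at its supremum. Hence
  \<open>v\<close> has integral 1 up to the final parameter, and the new time runs over
  \<open>[0, 1]\<close>.\<close>

lemma control_path_final_param:
  fixes P :: "real \<Rightarrow> real \<times> (real^'k)"
  assumes P: "P \<in> control_paths"
  shows "0 < final_param P" "fst (P (final_param P)) = 1"
proof -
  let ?V = "\<lambda>t. fst (P t)"
  have V0: "?V 0 = 0" using P by (simp add: control_paths_def)
  have mono: "?V s \<le> ?V t" if st: "0 \<le> s" "s \<le> t" for s t
  proof -
    have t0: "0 \<le> t" using st by simp
    from control_path_velocity(4)[OF P t0] obtain N where N: "negligible N"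
      "\<forall>t\<in>{0..t} - N. 0 \<le> vdot P t" by blast
    note hi = control_path_velocity(3)[OF P t0 st]
    have "((\<lambda>r. if r \<in> N then 0 else vdot P r) has_integral ?V t - ?V s) {s..t}"
      by (rule has_integral_spike[OF N(1) _ hi]) auto
    then have "0 \<le> ?V t - ?V s" by (rule has_integral_nonneg) (use N(2) st in auto)
    then show ?thesis by simp
  qed
  obtain b where b: "0 \<le> b" "1 < ?V b"
  proof -
    define l where "l = (SUP t\<in>{0..}. ereal (?V t))"
    \<comment> \<open>\<open>Lim\<close> carries information only when the limit exists;
      monotonicity supplies it as a supremum.\<close>
    have "((\<lambda>t. ereal (?V t)) \<longlongrightarrow> l) at_top"
    proof (rule increasing_tendsto)
      show "\<forall>\<^sub>F t in at_top. ereal (?V t) \<le> l"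
        using eventually_ge_at_top[of 0] by eventually_elim (auto simp: l_def intro: SUP_upper)
      fix x assume "x < l"
      then obtain s where s: "s \<ge> 0" "x < ereal (?V s)" unfolding l_def less_SUP_iff by auto
      show "\<forall>\<^sub>F t in at_top. x < ereal (?V t)"
        using eventually_ge_at_top[of s]
        by eventually_elim (use s mono in \<open>force intro: less_le_trans\<close>)
    qed
    then have "Lim at_top (\<lambda>t. ereal (?V t)) = l" by (intro tendsto_Lim) auto
    then have "1 < l" using P by (simp add: control_paths_def)
    then obtain s where "s \<ge> 0" "1 < ereal (?V s)" unfolding l_def less_SUP_iff by auto
    then show ?thesis using that by simp
  qed
  define A where "A = {s. 0 \<le> s \<and> ?V s \<le> 1}"
  have Ab: "s < b" if "s \<in> A" for s
  proof (rule ccontr)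
    assume "\<not> s < b"
    then have "?V b \<le> ?V s" using b(1) by (intro mono) auto
    then show False using b(2) that by (simp add: A_def)
  qed
  have A0: "0 \<in> A" using V0 by (simp add: A_def)
  have bdd: "bdd_above A" using Ab by (intro bdd_aboveI[of _ b]) (auto intro: less_imp_le)
  have cV: "continuous_on {0..b} ?V"
    by (intro continuous_on_fst control_path_velocity(2)[OF P b(1)])
  have "A = {0..b} \<inter> ?V -` {..1}" using Ab by (force simp: A_def)
  moreover have "closed ({0..b} \<inter> ?V -` {..1})"
    by (intro continuous_closed_preimage cV) auto
  ultimately have "closed A" by simp
  have T: "final_param P = Sup A" by (simp add: final_param_def A_def)
  have SA: "Sup A \<in> A" using A0 bdd \<open>closed A\<close> by (intro closed_contains_Sup) auto
  have Sb: "Sup A \<in> {0..b}" using SA Ab by (force simp: A_def)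
  \<comment> \<open>The value 1 is attained at or beyond \<open>Sup A\<close>; such a point belongs
    to \<open>A\<close> and so must be \<open>Sup A\<close> itself.\<close>
  have "\<exists>t\<ge>Sup A. t \<le> b \<and> ?V t = 1"
    by (rule IVT') (use SA Sb b in \<open>auto simp: A_def intro: continuous_on_subset[OF cV]\<close>)
  then obtain t where t: "Sup A \<le> t" "?V t = 1" by blast
  have "t \<in> A" using t Sb by (auto simp: A_def)
  then have "t = Sup A" using t(1) cSup_upper[OF _ bdd] by (intro antisym) auto
  then show V1: "fst (P (final_param P)) = 1" using t(2) T by simp
  have "final_param P \<ge> 0" using Sb T by simp
  then show "0 < final_param P" using V1 V0 by (cases "final_param P = 0") auto
qed

section \<open>Equivalence classes and the limit of vanishing tolerance\<close>

text \<open>Serves for the inverse given by \<open>the_inv_into\<close>, whose values are determined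
  on \<open>[0, \<infinity>)\<close> only.\<close>

lemma locally_abs_cont_on_cong:
  assumes "locally_abs_cont_on J h" "\<And>t. t \<in> J \<Longrightarrow> h' t = h t"
  shows "locally_abs_cont_on J h'"
  unfolding locally_abs_cont_on_def
proof (intro allI impI)
  fix a b assume ab: "{a..b} \<subseteq> J"
  then have "abs_cont_on {a..b} h" using assms(1) by (auto simp: locally_abs_cont_on_def)
  then show "abs_cont_on {a..b} h'"
  proof (rule abs_cont_on_norm_le)
    fix s t assume "s \<in> {a..b}" "t \<in> {a..b}"
    then have "h' s = h s" "h' t = h t" using ab assms(2) by blast+
    then show "norm (h' t - h' s) \<le> norm (h t - h s)" by simp
  qed
qed

lemma id_in_time_changes: "(\<lambda>t. t) \<in> time_changes"
proof -
  have "locally_abs_cont_on {0..} (\<lambda>t::real. t)"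
    unfolding locally_abs_cont_on_def
    by (intro allI impI lipschitz_imp_abs_cont_on[of 1]) (auto intro: lipschitz_onI)
  moreover from this have "locally_abs_cont_on {0..} (the_inv_into {0..} (\<lambda>t::real. t))"
    by (rule locally_abs_cont_on_cong) (simp add: the_inv_into_f_f[of "\<lambda>t. t"] inj_on_def
        the_inv_into_f_eq)
  ultimately show ?thesis
    by (auto simp: time_changes_def mono_on_def bij_betw_def inj_on_def)
qed

text \<open>Reflexivity puts every path into its own class, so the choice in
  \<open>representative\<close> yields a member. The identity time change realizes the value 0, and
  each essential supremum is nonnegative.\<close>

lemma equiv_paths_refl: "equiv_paths P P"
proof -
  \<comment> \<open>On a null space the essential supremum of 0 would be
    \<open>- \<infinity>\<close>; the half-line has positive measure.\<close>
  have nz: "emeasure (lebesgue_on {0::real..}) (space (lebesgue_on {0::real..})) \<noteq> 0"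
  proof
    assume "emeasure (lebesgue_on {0::real..}) (space (lebesgue_on {0::real..})) = 0"
    then have "emeasure lebesgue {0::real..} = 0" by (simp add: emeasure_restrict_space)
    moreover have "emeasure lebesgue {0..1::real} \<le> emeasure lebesgue {0::real..}" by (intro emeasure_mono) auto
    ultimately show False by simp
  qed
  let ?E = "\<lambda>\<alpha>. esssup (lebesgue_on {0::real..}) (\<lambda>s. ereal (norm (P s - P (\<alpha> s))))"
  have c0: "esssup (lebesgue_on {0::real..}) (\<lambda>s. 0 :: ereal) = 0" by (rule esssup_const[OF nz])
  have "(INF \<alpha>\<in>time_changes. ?E \<alpha>) \<le> ?E (\<lambda>t. t)" by (rule INF_lower[OF id_in_time_changes])
  also have "?E (\<lambda>t. t) = esssup (lebesgue_on {0..}) (\<lambda>s::real. 0 :: ereal)" by (simp add: zero_ereal_def)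
  also note c0
  finally have "(INF \<alpha>\<in>time_changes. ?E \<alpha>) \<le> 0" .
  moreover have "0 \<le> (INF \<alpha>\<in>time_changes. ?E \<alpha>)"
  proof (rule INF_greatest)
    fix \<alpha>
    have "esssup (lebesgue_on {0::real..}) (\<lambda>s. 0 :: ereal) \<le> ?E \<alpha>" by (rule esssup_mono) auto
    then show "0 \<le> ?E \<alpha>" by (simp add: c0)
  qed
  ultimately show ?thesis unfolding equiv_paths_def by (rule antisym)
qed

lemma representative_in_control_paths:
  assumes "C \<in> generalized_controls"
  shows "representative C \<in> control_paths"
proof -
  from assms obtain P where "P \<in> control_paths"
    "C = {(P, Q). P \<in> control_paths \<and> Q \<in> control_paths \<and> equiv_paths P Q} `` {P}"
    unfolding generalized_controls_def by (rule quotientE)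
  then have "P \<in> C" "C \<subseteq> control_paths" using equiv_paths_refl[of P] by auto
  then show ?thesis unfolding representative_def by (metis someI subsetD)
qed

text \<open>A smaller tolerance leaves fewer controls, so the infimum grows as \<epsilon> decreases
  and the one-sided limit exists as a supremum.\<close>

lemma Lim_INF_near_feasible_le:
  assumes "\<And>\<epsilon>. \<epsilon> > 0 \<Longrightarrow> (INF u\<in>near_feasible f g x0 x1 \<epsilon>. J u) \<le> (c :: ereal)"
  shows "Lim (at_right 0) (\<lambda>\<epsilon>. INF u\<in>near_feasible f g x0 x1 \<epsilon>. J u) \<le> c"
proof -
  let ?I = "\<lambda>\<epsilon>. INF u\<in>near_feasible f g x0 x1 \<epsilon>. J u"
  define l where "l = (SUP \<epsilon>\<in>{0<..}. ?I \<epsilon>)"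
  have anti: "?I \<epsilon> \<le> ?I \<epsilon>'" if "\<epsilon>' \<le> \<epsilon>" for \<epsilon> \<epsilon>'
    by (rule INF_superset_mono) (use that in \<open>auto simp: near_feasible_def\<close>)
  have "(?I \<longlongrightarrow> l) (at_right 0)"
  proof (rule increasing_tendsto)
    show "\<forall>\<^sub>F \<epsilon> in at_right 0. ?I \<epsilon> \<le> l"
      using eventually_at_right_less[of 0] by eventually_elim (auto simp: l_def intro: SUP_upper)
    fix x assume "x < l"
    then obtain \<epsilon>' where e: "\<epsilon>' > 0" "x < ?I \<epsilon>'" unfolding l_def less_SUP_iff by auto
    have "\<forall>\<^sub>F \<epsilon> in at_right 0. \<epsilon> < \<epsilon>'" by (rule eventually_at_right_field[THEN iffD2]) (use e(1) in auto)
    then show "\<forall>\<^sub>F \<epsilon> in at_right 0. x < ?I \<epsilon>"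
      by eventually_elim (use e(2) anti in \<open>meson less_imp_le less_le_trans\<close>)
  qed
  then have "Lim (at_right 0) ?I = l" by (intro tendsto_Lim) auto
  also have "l \<le> c" unfolding l_def using assms by (intro SUP_least) auto
  finally show ?thesis .
qed

theorem corollary38:
  fixes f :: "real^'n \<Rightarrow> real^'n"
    and g :: "'k::finite \<Rightarrow> real^'n \<Rightarrow> real^'n"
    and L :: "real^'n \<Rightarrow> real^'k \<Rightarrow> real"
    and L1 :: "real^'n \<Rightarrow> real"
    and L2 :: "real^'n \<Rightarrow> real^'k \<Rightarrow> real"
    and x0 x1 :: "real^'n"
  assumes "locally_lipschitz f"
    and "\<And>i. locally_lipschitz (g i)"
    and "continuous_on UNIV (\<lambda>(x, u). L x u)"
    and "\<And>x. convex_on UNIV (L x)"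
    and "\<And>x u. L x u = L1 x + L2 x u"
    and "\<And>x u r. r > 0 \<Longrightarrow> L2 x (r *\<^sub>R u) = r * L2 x u"
  shows "\<not> lavrentiev_gap f g L x0 x1"
proof -
  \<comment> \<open>A bound by the cost of each feasible generalized control is enough; if there is
    none, the infimum is \<open>\<infinity>\<close> and cannot be exceeded.\<close>
  have "Lim (at_right 0) (\<lambda>\<epsilon>. INF u\<in>near_feasible f g x0 x1 \<epsilon>. ordinary_cost f g L x0 u)
      \<le> generalized_cost f g L x0 C" if C: "C \<in> generalized_controls" "reaches_target f g x0 x1 C" for C
  proof -
    define P where "P = representative C"
    define T where "T = final_param P"
    define p where "p = (\<lambda>t. (vdot P t, wdot P t))"
    have P: "P \<in> control_paths" unfolding P_def by (rule representative_in_control_paths[OF C(1)])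
    have T: "0 < T" "fst (P T) = 1" using control_path_final_param[OF P] by (simp_all add: T_def)
    note T0 = less_imp_le[OF T(1)]
    have p: "p absolutely_integrable_on {0..T}" unfolding p_def by (rule control_path_velocity(1)[OF P T0])
    from control_path_velocity(4)[OF P T0] obtain N where N: "negligible N"
      "\<And>t. t \<in> {0..T} - N \<Longrightarrow> 0 \<le> fst (p t)" by (auto simp: p_def)
    have "P 0 = 0" using P by (simp add: control_paths_def)
    \<comment> \<open>The integral of \<open>v\<close> is the increment of the clock, from 0 to its
      value 1 at the final parameter.\<close>
    then have one: "integral {0..T} (\<lambda>t. fst (p t)) = 1"
      using integral_unique[OF control_path_velocity(3)[OF P T0 order_refl T0]] T(2) by (simp add: p_def)
    from C(2) obtain y where y: "solves_on f g x0 (vdot P) (wdot P) T y"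
      and x1: "traj f g x0 (vdot P) (wdot P) T = x1"
      by (auto simp: reaches_target_def Let_def P_def T_def traj_defined_def)
    have tr: "traj f g x0 (vdot P) (wdot P) t = y t" if "t \<in> {0..T}" for t
      by (rule traj_eq[OF assms(1,2) p[unfolded p_def] y that])
    have yT: "y T = x1" using tr[of T] x1 T0 by simp
    have yc: "continuous_on {0..T} y" by (rule solves_on_integral(1)[OF y, of T]) (use T0 in simp)
    have yi: "y t = x0 + integral {0..t} (\<lambda>s. control_field f g (y s) (p s))" if "t \<in> {0..T}" for t
      unfolding p_def by (rule solves_on_integral(2)[OF y that])
    let ?\<Lambda> = "\<lambda>t. homogeneous_cost L1 L2 (y t) (p t)"
    have approx: "(INF u\<in>near_feasible f g x0 x1 \<epsilon>. ordinary_cost f g L x0 u) \<le> ereal (integral {0..T} ?\<Lambda>)"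
      if e: "\<epsilon> > 0" for \<epsilon>
    proof (rule ereal_le_epsilon2)
      fix \<epsilon>' :: real assume "0 < \<epsilon>'"
      from ordinary_control_approx[OF assms T(1) p N one yc yi e this]
      obtain u where "u \<in> near_feasible f g x0 x1 \<epsilon>"
        "ordinary_cost f g L x0 u \<le> ereal (integral {0..T} ?\<Lambda> + \<epsilon>')" unfolding yT by blast
      then show "(INF u\<in>near_feasible f g x0 x1 \<epsilon>. ordinary_cost f g L x0 u) \<le>
          ereal (integral {0..T} ?\<Lambda>) + ereal \<epsilon>'" by (simp add: INF_lower2)
    qed
    \<comment> \<open>The formula for the extended Lagrangian requires \<open>v \<ge> 0\<close>,
      which holds off \<open>N\<close>; the cost ignores null sets.\<close>
    have "AE t in lebesgue_on {0..T}. ext_lagrangian L (traj f g x0 (vdot P) (wdot P) t) (vdot P t) (wdot P t) = ereal (?\<Lambda> t)"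
    proof (rule negligible_imp_AE_lebesgue_on[OF N(1)])
      fix t assume t: "t \<in> {0..T} - N"
      have v: "0 \<le> vdot P t" using N(2)[OF t] by (simp add: p_def)
      have "ext_lagrangian L (y t) (vdot P t) (wdot P t) =
          ereal (homogeneous_cost L1 L2 (y t) (vdot P t, wdot P t))"
        by (rule ext_lagrangian_homogeneous[OF assms(5,6) v])
      then show "ext_lagrangian L (traj f g x0 (vdot P) (wdot P) t) (vdot P t) (wdot P t) = ereal (?\<Lambda> t)"
        using t by (simp add: tr p_def)
    qed simp
    then have "generalized_cost f g L x0 C = ext_integral (lebesgue_on {0..T}) (\<lambda>t. ereal (?\<Lambda> t))"
      unfolding generalized_cost_def Let_def P_def[symmetric] T_def[symmetric] by (rule ext_integral_cong_AE)
    also have "\<dots> = ereal (integral {0..T} ?\<Lambda>)"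
      by (intro ext_integral_absolutely_integrable homogeneous_cost_absolutely_integrable
          homogeneous_parts[OF assms(3-6)] assms(6) yc p)
    finally show ?thesis using approx by (simp add: Lim_INF_near_feasible_le)
  qed
  then show ?thesis unfolding lavrentiev_gap_def not_less by (intro INF_greatest) auto
qed

end
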